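(* There exists an absolute constant $C>0$ with the following property. Let $A\subset\mathbb{R}^2$ be a finite set with $|A|=N$, let $M\ge 1$, and let $R_M\subset A^2$ be the set of ordered pairs $(a,b)$ of points of $A$ such that $a$ and $b$ are not both contained in any line or circle that contains more than $M$ points of $A$. Let $$\mathcal Q_M=|\{(a,b,c,d)\in A^4:\ (a,b)\in R_M,\ a\neq b,\ c\ne d,\ \mathcal B(a,b)=\mathcal B(c,d)\}|.$$ Then $$\mathcal Q_M\le C\left(MN^2+\log^{1/2}(N)\,N^{5/2}\right).$$
   Context: For distinct $a,b\in\mathbb{R}^2$, $\mathcal B(a,b)=\{x\in\mathbb{R}^2:\ |a-x|=|b-x|\}$ denotes the perpendicular bisector of $a$ and $b$ (a line). *)

theory Defs
  imports "HOL-Analysis.Analysis"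
begin

definition bisector :: "real^2 \<Rightarrow> real^2 \<Rightarrow> (real^2) set" where
  "bisector a b = {x. norm (a - x) = norm (b - x)}"

definition is_line :: "(real^2) set \<Rightarrow> bool" where
  "is_line L \<longleftrightarrow> affine L \<and> aff_dim L = 1"

definition is_circle :: "(real^2) set \<Rightarrow> bool" where
  "is_circle K \<longleftrightarrow> (\<exists>p r. r > 0 \<and> K = sphere p r)"

definition poor_pairs :: "(real^2) set \<Rightarrow> real \<Rightarrow> ((real^2) \<times> (real^2)) set" where
  "poor_pairs A M = {(a, b) \<in> A \<times> A.
     \<not> (\<exists>S. (is_line S \<or> is_circle S) \<and> real (card (A \<inter> S)) > M \<and> a \<in> S \<and> b \<in> S)}"

definition bisector_quadruples ::
  "(real^2) set \<Rightarrow> real \<Rightarrow> ((real^2) \<times> (real^2) \<times> (real^2) \<times> (real^2)) set" where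
  "bisector_quadruples A M = {(a, b, c, d) \<in> A \<times> A \<times> A \<times> A.
     (a, b) \<in> poor_pairs A M \<and> a \<noteq> b \<and> c \<noteq> d \<and> bisector a b = bisector c d}"

end

theory Submission
  imports Defs "HOL-Computational_Algebra.Polynomial"
begin

text \<open>
  Identify the plane with the complex numbers. A quadruple is a pair \<open>p = (a, c)\<close> together with a
  reflection taking it to another pair \<open>q = (b, d)\<close> of points of \<open>A\<close>. By Cauchy--Schwarz it suffices to count
  triples \<open>(p, q, q')\<close> in which both \<open>q\<close> and \<open>q'\<close> are reflections of \<open>p\<close>. If \<open>a, b, b'\<close> are collinear, poorness of
  \<open>(a, b)\<close> leaves \<open>M\<close> choices for \<open>b'\<close>. Otherwise both axes pass through the circumcentre \<open>z\<close> of \<open>a, b, b'\<close>, and \<open>q, q'\<close>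
  differ by a rotation about \<open>z\<close>. Circles about such \<open>z\<close> carrying many reflections of \<open>p\<close> (or of \<open>q\<close>) become, after an
  inversion, lines rich in points, and a Beck-type bound shows that they account for a small fraction of the
  triples plus \<open>O(M)\<close> per edge. The remaining triples are controlled by the sum of \<open>R\<^sup>2\<close> over the rotations with
  \<open>R \<ge> 3\<close>, where \<open>R\<close> counts the pairs of \<open>A\<close> matched by the rotation.

  In the Elekes--Sharir parametrisation, the rotations matching a pair of points form a line in space, and \<open>R\<close> is
  the number of lines through a point. A polynomial of minimal degree vanishing on the lines is flat along any
  line with many 3-rich points, which forces too many lines into one plane; this bounds the 3-rich incidences when
  the number of lines is at most the square of the largest number in a plane. For larger \<open>R\<close>, a compressed
  quadtree cuts \<open>A\<close> into cells such that every isometry matches only boundedly many cells per cell, and the bound is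
  applied to each pair of cells. Summing over \<open>R\<close> yields the logarithm.
\<close>

section \<open>Three-rich points of lines in space\<close>

text \<open>A rotation and the pairs \<open>q, q'\<close> do not determine \<open>p\<close>: many
  neighbours of \<open>q\<close> may be reflected in axes through the centre \<open>z\<close>. The
  energy bound helps only if the circle about \<open>z\<close> carries few of them, which is why
  rich circles are split off. They are met twice, seen from \<open>p\<close> and seen from
  \<open>q\<close>; each time a quarter of all triples is lost, and this half is absorbed on the
  left. Rotations with at most two matches need no incidence theorem, since \<open>a, b, b'\<close>
  fix the rotation and leave two choices for \<open>snd q\<close>. With \<open>E\<close> edges and
  \<open>D\<close> triples, \<open>D <= C (M E + N^3 (1 + log N))\<close> and
  \<open>E^2 <= N^2 D\<close> form a quadratic inequality for \<open>E\<close>, whence the exponents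
  5/2 and 1/2.

  The bound for 3-rich points gains nothing at higher multiplicity, and space is never partitioned.
  The gain \<open>1 / j\<close> comes from the plane: with cells of \<open>O(N / j)\<close> points,
  a rotation with \<open>j\<close> matches meets so few pairs of cells that at least half of its
  matches lie in pairs where it has three or more, and each pair of cells yields only
  \<open>O((N / j)^2)\<close> lines.\<close>

lemma homogeneous_system_nontrivial:
  fixes a :: "'j \<Rightarrow> 'i \<Rightarrow> real"
  assumes "finite J" "finite I" "card J < card I"
  shows "\<exists>c. (\<exists>i\<in>I. c i \<noteq> 0) \<and> (\<forall>j\<in>J. (\<Sum>i\<in>I. a j i * c i) = 0)"
  using assms
proof (induction J arbitrary: I a rule: finite_induct)
  case empty
  then obtain i where "i \<in> I" by fastforce
  then show ?case by (intro exI[of _ "\<lambda>_. 1"]) auto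
next
  case (insert j J)
  show ?case
  proof (cases "\<forall>i\<in>I. a j i = 0")
    case True
    from insert.IH[of I a] insert.prems insert.hyps obtain c where
      "\<exists>i\<in>I. c i \<noteq> 0" "\<forall>j\<in>J. (\<Sum>i\<in>I. a j i * c i) = 0" by auto
    with True show ?thesis by (intro exI[of _ c]) auto
  next
    case False
    then obtain i0 where i0: "i0 \<in> I" "a j i0 \<noteq> 0" by blast
    define a' where "a' = (\<lambda>k i. a k i - a k i0 * a j i / a j i0)"
    have "card J < card (I - {i0})" using insert i0 by simp
    with insert.IH[of "I - {i0}" a'] insert.prems obtain c where
      c: "\<exists>i\<in>I - {i0}. c i \<noteq> 0" "\<forall>k\<in>J. (\<Sum>i\<in>I - {i0}. a' k i * c i) = 0" by auto
    define s where "s = (\<Sum>i\<in>I - {i0}. a j i * c i)"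
    define c' where "c' = c(i0 := - s / a j i0)"
    have split: "(\<Sum>i\<in>I. a k i * c' i) = - a k i0 * s / a j i0 + (\<Sum>i\<in>I - {i0}. a k i * c i)" for k
    proof -
      have "(\<Sum>i\<in>I. a k i * c' i) = a k i0 * c' i0 + (\<Sum>i\<in>I - {i0}. a k i * c' i)"
        using insert.prems i0 by (simp add: sum.remove)
      also have "(\<Sum>i\<in>I - {i0}. a k i * c' i) = (\<Sum>i\<in>I - {i0}. a k i * c i)"
        by (intro sum.cong) (auto simp: c'_def)
      finally show ?thesis by (simp add: c'_def)
    qed
    have "(\<Sum>i\<in>I. a k i * c' i) = 0" if "k \<in> J" for k
    proof -
      have "(\<Sum>i\<in>I - {i0}. a' k i * c i) = (\<Sum>i\<in>I - {i0}. a k i * c i) - a k i0 / a j i0 * s"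
        unfolding a'_def s_def by (simp add: sum_subtractf sum_distrib_left algebra_simps)
      with c(2) that split[of k] show ?thesis by (simp add: field_simps)
    qed
    moreover have "(\<Sum>i\<in>I. a j i * c' i) = 0"
      using split[of j] i0 by (simp add: s_def)
    moreover have "\<exists>i\<in>I. c' i \<noteq> 0" using c(1) by (auto simp: c'_def)
    ultimately show ?thesis by (intro exI[of _ c']) auto
  qed
qed

text \<open>Let \<open>r\<close> vanish at \<open>t\<close> and \<open>s\<close> not. Unless
  \<open>r = 0\<close>, the order of \<open>s * r'\<close> at \<open>t\<close> is one below that of
  \<open>r\<close>, while \<open>r * s'\<close> has at least the order of \<open>r\<close>; so a
  zero Wronskian forces \<open>r = 0\<close>. This is applied to the combination of \<open>p\<close>
  and \<open>q\<close> that vanishes at \<open>t\<close>, paired with whichever of the two does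
  not.\<close>

lemma proportional_if_wronskian_0:
  fixes p q :: "real poly"
  assumes W: "p * pderiv q = q * pderiv p"
  shows "smult (poly q t) p = smult (poly p t) q"
proof -
  have *: "r = 0" if "poly r t = 0" "poly s t \<noteq> 0" "r * pderiv s = s * pderiv r" for r s :: "real poly"
  proof (rule ccontr)
    assume r: "r \<noteq> 0"
    have s: "s \<noteq> 0" using that by auto
    have o: "order t r \<noteq> 0" using r that(1) by (simp add: order_root)
    have dr: "pderiv r \<noteq> 0"
      using r that(1) by (metis pderiv_eq_0_iff degree_eq_zeroE poly_pCons mult_zero_right add.right_neutral poly_0 pCons_0_0)
    have os: "order t s = 0" using that(2) by (simp add: order_root)
    have ne: "s * pderiv r \<noteq> 0" using s dr by simp
    have "order t (s * pderiv r) = order t r - 1"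
      using order_mult[OF ne] os order_pderiv[OF r that(1)] by simp
    moreover have "order t (r * pderiv s) \<ge> order t r"
      using order_mult[of r "pderiv s" t] ne that(3) by simp
    ultimately show False using that(3) o by simp
  qed
  show ?thesis
  proof (cases "poly p t = 0 \<and> poly q t = 0")
    case True then show ?thesis by simp
  next
    case False
    let ?r = "smult (poly q t) p - smult (poly p t) q"
    have "poly ?r t = 0" by simp
    moreover have "?r * pderiv p = p * pderiv ?r" "?r * pderiv q = q * pderiv ?r"
      using W by (simp_all add: algebra_simps pderiv_diff pderiv_smult)
    ultimately have "?r = 0" using *[of ?r p] *[of ?r q] False by blast
    then show ?thesis by simp
  qed
qed

text \<open>
  A polynomial in three variables is its array of coefficients. Coefficients with an exponent above \<open>D\<close> are
  ignored by \<open>ev D\<close>.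
\<close>

definition ev :: "nat \<Rightarrow> (nat \<Rightarrow> nat \<Rightarrow> nat \<Rightarrow> real) \<Rightarrow> real poly \<Rightarrow> real poly \<Rightarrow> real poly \<Rightarrow> real poly"
  where "ev D c X Y T = (\<Sum>i\<le>D. \<Sum>j\<le>D. \<Sum>k\<le>D. smult (c i j k) (X ^ i * Y ^ j * T ^ k))"

definition dx :: "(nat \<Rightarrow> nat \<Rightarrow> nat \<Rightarrow> real) \<Rightarrow> nat \<Rightarrow> nat \<Rightarrow> nat \<Rightarrow> real"
  where "dx c i j k = real (Suc i) * c (Suc i) j k"
definition dy :: "(nat \<Rightarrow> nat \<Rightarrow> nat \<Rightarrow> real) \<Rightarrow> nat \<Rightarrow> nat \<Rightarrow> nat \<Rightarrow> real"
  where "dy c i j k = real (Suc j) * c i (Suc j) k"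
definition dt :: "(nat \<Rightarrow> nat \<Rightarrow> nat \<Rightarrow> real) \<Rightarrow> nat \<Rightarrow> nat \<Rightarrow> nat \<Rightarrow> real"
  where "dt c i j k = real (Suc k) * c i j (Suc k)"

definition deg_le :: "nat \<Rightarrow> (nat \<Rightarrow> nat \<Rightarrow> nat \<Rightarrow> real) \<Rightarrow> bool"
  where "deg_le d c \<longleftrightarrow> (\<forall>i j k. c i j k \<noteq> 0 \<longrightarrow> i + j + k \<le> d)"

lemma deg_le_mono: "deg_le d c \<Longrightarrow> d \<le> e \<Longrightarrow> deg_le e c"
  unfolding deg_le_def by (meson order_trans)

lemma deg_le_partial:
  assumes "deg_le d c"
  shows "deg_le (d - 1) (dx c)" "deg_le (d - 1) (dy c)" "deg_le (d - 1) (dt c)"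
proof -
  have *: "i + j + k \<le> d" if "c i j k \<noteq> 0" for i j k
    using assms that unfolding deg_le_def by blast
  show "deg_le (d - 1) (dx c)" "deg_le (d - 1) (dy c)" "deg_le (d - 1) (dt c)"
    unfolding deg_le_def dx_def dy_def dt_def using * by fastforce+
qed

lemma partial_commute: "dx (dy c) = dy (dx c)" "dx (dt c) = dt (dx c)" "dy (dt c) = dt (dy c)"
  by (auto simp: dx_def dy_def dt_def fun_eq_iff)

text \<open>For differentiating \<open>ev\<close>: the lowest term carries the exponent 0 as a
  factor, and the coefficient beyond \<open>D\<close> is zero.\<close>

lemma sum_atMost_shift:
  fixes f :: "nat \<Rightarrow> 'a::comm_monoid_add"
  assumes "f 0 = 0" "f (Suc D) = 0"
  shows "(\<Sum>i\<le>D. f i) = (\<Sum>i\<le>D. f (Suc i))"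
  using sum.atMost_Suc_shift[of f D] sum.atMost_Suc[of f D] assms by simp

lemma pderiv_sum: "pderiv (\<Sum>i\<in>I. f i) = (\<Sum>i\<in>I. pderiv (f i))"
  by (induction I rule: infinite_finite_induct) (auto simp: pderiv_add)

text \<open>The chain rule. The degree hypothesis makes truncation at \<open>D\<close> harmless: a
  derivative would otherwise see coefficients with exponent \<open>Suc D\<close>, which
  \<open>ev D c\<close> ignores.\<close>

lemma pderiv_ev:
  assumes c: "deg_le D c"
  shows "pderiv (ev D c X Y T) = pderiv X * ev D (dx c) X Y T + pderiv Y * ev D (dy c) X Y T
    + pderiv T * ev D (dt c) X Y T"
proof -
  have z: "c i j k = 0" if "i + j + k > D" for i j k
    using c that unfolding deg_le_def by (meson not_le)
  have "pderiv (ev D c X Y T) = (\<Sum>i\<le>D. \<Sum>j\<le>D. \<Sum>k\<le>D.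
      smult (c i j k) (smult (of_nat i) (X ^ (i - 1) * pderiv X) * Y ^ j * T ^ k)
      + smult (c i j k) (X ^ i * smult (of_nat j) (Y ^ (j - 1) * pderiv Y) * T ^ k)
      + smult (c i j k) (X ^ i * Y ^ j * smult (of_nat k) (T ^ (k - 1) * pderiv T)))"
    unfolding ev_def pderiv_sum
    by (intro sum.cong refl) (simp add: pderiv_smult pderiv_mult pderiv_power algebra_simps smult_add_right)
  also have "\<dots> = (\<Sum>i\<le>D. \<Sum>j\<le>D. \<Sum>k\<le>D. smult (c i j k) (smult (of_nat i) (X ^ (i - 1) * pderiv X) * Y ^ j * T ^ k))
     + (\<Sum>i\<le>D. \<Sum>j\<le>D. \<Sum>k\<le>D. smult (c i j k) (X ^ i * smult (of_nat j) (Y ^ (j - 1) * pderiv Y) * T ^ k))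
     + (\<Sum>i\<le>D. \<Sum>j\<le>D. \<Sum>k\<le>D. smult (c i j k) (X ^ i * Y ^ j * smult (of_nat k) (T ^ (k - 1) * pderiv T)))"
    by (simp add: sum.distrib)
  also have "(\<Sum>i\<le>D. \<Sum>j\<le>D. \<Sum>k\<le>D. smult (c i j k) (smult (of_nat i) (X ^ (i - 1) * pderiv X) * Y ^ j * T ^ k))
      = pderiv X * ev D (dx c) X Y T"
    unfolding ev_def sum_distrib_left
    by (subst sum_atMost_shift) (auto simp: z dx_def intro!: sum.cong simp: algebra_simps smult_add_right)
  also have "(\<Sum>i\<le>D. \<Sum>j\<le>D. \<Sum>k\<le>D. smult (c i j k) (X ^ i * smult (of_nat j) (Y ^ (j - 1) * pderiv Y) * T ^ k))
      = pderiv Y * ev D (dy c) X Y T"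
    unfolding ev_def sum_distrib_left
    by (rule sum.cong[OF refl], subst sum_atMost_shift) (auto simp: z dy_def intro!: sum.cong simp: algebra_simps smult_add_right)
  also have "(\<Sum>i\<le>D. \<Sum>j\<le>D. \<Sum>k\<le>D. smult (c i j k) (X ^ i * Y ^ j * smult (of_nat k) (T ^ (k - 1) * pderiv T)))
      = pderiv T * ev D (dt c) X Y T"
    unfolding ev_def sum_distrib_left
    by (rule sum.cong[OF refl], rule sum.cong[OF refl], subst sum_atMost_shift) (auto simp: z dt_def intro!: sum.cong simp: algebra_simps smult_add_right)
  finally show ?thesis .
qed

lemma degree_ev_le:
  assumes "deg_le d c" "degree X \<le> 1" "degree Y \<le> 1" "degree T \<le> 1"
  shows "degree (ev D c X Y T) \<le> d"
  unfolding ev_def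
proof (intro degree_sum_le finite_atMost)
  fix i j k
  show "degree (smult (c i j k) (X ^ i * Y ^ j * T ^ k)) \<le> d"
  proof (cases "c i j k = 0")
    case False
    then have ijk: "i + j + k \<le> d" using assms(1) unfolding deg_le_def by blast
    have pw: "degree (Z ^ n) \<le> n" if "degree Z \<le> 1" for Z :: "real poly" and n
      using order_trans[OF degree_power_le mult_le_mono1[OF that]] by simp
    have "degree (X ^ i * Y ^ j * T ^ k) \<le> degree (X ^ i) + degree (Y ^ j) + degree (T ^ k)"
      by (meson add_le_mono1 degree_mult_le order_trans)
    also have "\<dots> \<le> i + j + k" using pw assms by (intro add_mono) auto
    finally show ?thesis using ijk False by (simp add: degree_smult_eq)
  qed simp
qed

lemma poly_ev_cong:
  assumes "poly X t = poly X' t" "poly Y t = poly Y' t" "poly T t = poly T' t"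
  shows "poly (ev D c X Y T) t = poly (ev D c X' Y' T') t"
  using assms unfolding ev_def by (simp add: poly_sum poly_power)

text \<open>
  A quadratic form that is null in three directions of the tangent plane vanishes on that plane; hence the
  gradient and its derivative along \<open>u\<close> are parallel. Directions \<open>(v, 1)\<close> are represented by \<open>v\<close>.
\<close>

lemma three_null_directions:
  assumes g: "\<And>v. v \<in> V \<Longrightarrow> fst v * px + snd v * py + pt = 0"
    and h: "\<And>v. v \<in> V \<Longrightarrow> (fst v)\<^sup>2 * pxx + 2 * fst v * snd v * pxy + (snd v)\<^sup>2 * pyy
          + 2 * fst v * pxt + 2 * snd v * pyt + ptt = (0::real)"
    and V: "u \<in> V" "v \<in> V" "w \<in> V" "u \<noteq> v" "u \<noteq> w" "v \<noteq> w"
  shows "px * (fst u * pxy + snd u * pyy + pyt) = py * (fst u * pxx + snd u * pxy + pxt)"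
proof (cases "px = 0 \<and> py = 0")
  case False
  then have n: "px\<^sup>2 + py\<^sup>2 \<noteq> 0" by (simp add: sum_power2_eq_zero_iff)
  \<comment> \<open>The directions in \<open>V\<close> lie on a line of the chart, by
    \<open>g\<close>; \<open>s v\<close> is the coordinate of \<open>v - u\<close> along its
    direction \<open>(- py, px)\<close>.\<close>
  define s where "s v = (px * (snd v - snd u) - py * (fst v - fst u)) / (px\<^sup>2 + py\<^sup>2)" for v
  have v: "fst v = fst u - s v * py \<and> snd v = snd u + s v * px" if "v \<in> V" for v
  proof -
    have e: "px * (fst v - fst u) + py * (snd v - snd u) = 0"
      using g[OF that] g[OF V(1)] by algebra
    have "(px\<^sup>2 + py\<^sup>2) * (fst v - fst u) = - (px * (snd v - snd u) - py * (fst v - fst u)) * py"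
      using e by algebra
    moreover have "(px\<^sup>2 + py\<^sup>2) * (snd v - snd u) = (px * (snd v - snd u) - py * (fst v - fst u)) * px"
      using e by algebra
    ultimately show ?thesis using n unfolding s_def by (simp add: field_simps)
  qed
  \<comment> \<open>On that line the quadratic form is \<open>s * (2 * W + s * K)\<close>, without
    constant term because \<open>u\<close> is null. Two distinct nonzero roots give
    \<open>K = 0\<close> and then \<open>W = 0\<close>.\<close>
  define W where "W = px * (fst u * pxy + snd u * pyy + pyt) - py * (fst u * pxx + snd u * pxy + pxt)"
  define K where "K = py\<^sup>2 * pxx - 2 * px * py * pxy + px\<^sup>2 * pyy"
  have k: "2 * W + s v * K = 0" if "v \<in> V" "v \<noteq> u" for v
  proof -
    have nz: "s v \<noteq> 0" using v[OF that(1)] that(2) by (auto simp: prod_eq_iff)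
    have "s v * (2 * W + s v * K) = 0"
      using h[OF that(1)] h[OF V(1)] v[OF that(1)] unfolding W_def K_def by algebra
    with nz show ?thesis by simp
  qed
  have "s v \<noteq> s w" using v[OF V(2)] v[OF V(3)] V(6) by (auto simp: prod_eq_iff)
  moreover have "(s v - s w) * K = 0"
  proof -
    have "2 * W + s v * K = 0" "2 * W + s w * K = 0" using k V by auto
    then show ?thesis unfolding left_diff_distrib by linarith
  qed
  ultimately have "K = 0" by simp
  then have "W = 0" using k[of v] V by simp
  then show ?thesis unfolding W_def by simp
qed simp

text \<open>The pair \<open>(m, v)\<close> encodes the line of all points \<open>(m + t v, t)\<close> in \<open>\<complex> \<times> \<real>\<close>.\<close>

definition lpt :: "complex \<times> complex \<Rightarrow> real \<Rightarrow> complex"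
  where "lpt l t = fst l + of_real t * snd l"

definition through :: "(complex \<times> complex) set \<Rightarrow> complex \<times> complex \<Rightarrow> real \<Rightarrow> (complex \<times> complex) set"
  where "through L l t = {l' \<in> L. lpt l' t = lpt l t}"

text \<open>Incidences rather than points: a point on three or more lines occurs once for each of
  them, named by the line and the height \<open>t\<close>.\<close>

definition rich :: "(complex \<times> complex) set \<Rightarrow> ((complex \<times> complex) \<times> real) set"
  where "rich L = {(l, t). l \<in> L \<and> 3 \<le> card (through L l t)}"

lemma lines_meet_once:
  assumes "lpt l t = lpt l' t" "lpt l s = lpt l' s" "t \<noteq> s"
  shows "l = l'"
proof -
  have "of_real (t - s) * (snd l - snd l') = (lpt l t - lpt l' t) - (lpt l s - lpt l' s)"
    by (simp add: lpt_def algebra_simps)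
  then have "snd l = snd l'" using assms by simp
  with assms(1) show ?thesis by (simp add: lpt_def prod_eq_iff)
qed

text \<open>Each such \<open>t\<close> selects a second line through the point, and different
  heights select different lines because two lines meet only once.\<close>

lemma finite_rich_parameters:
  assumes "finite L"
  shows "finite {t. (l, t) \<in> rich L}"
proof -
  let ?T = "{t. (l, t) \<in> rich L}"
  have "\<exists>l'. l' \<in> through L l t \<and> l' \<noteq> l" if "t \<in> ?T" for t
  proof (rule ccontr)
    assume "\<not> ?thesis"
    then have "through L l t \<subseteq> {l}" by auto
    from card_mono[OF _ this] show False using that by (simp add: rich_def)
  qed
  then obtain f where f: "\<And>t. t \<in> ?T \<Longrightarrow> f t \<in> through L l t \<and> f t \<noteq> l" by metis
  have "inj_on f ?T"
  proof (rule inj_onI, rule ccontr)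
    fix s t assume st: "s \<in> ?T" "t \<in> ?T" "f s = f t" "s \<noteq> t"
    have "lpt (f t) t = lpt l t" "lpt (f s) s = lpt l s" "f t \<noteq> l" using f st(1,2) unfolding through_def by blast+
    then show False using lines_meet_once[of "f t" t l s] st(3,4) by auto
  qed
  moreover have "f ` ?T \<subseteq> L" using f unfolding through_def by auto
  ultimately show ?thesis using assms inj_on_finite by blast
qed

text \<open>The restriction of the polynomial to the line, as a polynomial in the height.\<close>

definition evl :: "nat \<Rightarrow> (nat \<Rightarrow> nat \<Rightarrow> nat \<Rightarrow> real) \<Rightarrow> complex \<times> complex \<Rightarrow> real poly"
  where "evl D c l = ev D c [:Re (fst l), Re (snd l):] [:Im (fst l), Im (snd l):] [:0, 1:]"

lemma pderiv_evl:
  assumes "deg_le D c"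
  shows "pderiv (evl D c l) =
    smult (Re (snd l)) (evl D (dx c) l) + smult (Im (snd l)) (evl D (dy c) l) + evl D (dt c) l"
  unfolding evl_def pderiv_ev[OF assms] by (simp add: pderiv_pCons)

lemma degree_evl_le: "deg_le d c \<Longrightarrow> degree (evl D c l) \<le> d"
  unfolding evl_def by (rule degree_ev_le) auto

lemma poly_evl_cong: "lpt l' t = lpt l t \<Longrightarrow> poly (evl D c l') t = poly (evl D c l) t"
  unfolding evl_def lpt_def by (rule poly_ev_cong) (auto simp: complex_eq_iff)

text \<open>Parameter counting: exponents up to \<open>2 B\<close> give \<open>(2 B + 1)^3\<close>
  coefficients and total degree at most \<open>6 B\<close>. Each line imposes \<open>6 B + 1\<close>
  linear conditions, and \<open>B^2 (6 B + 1) < (2 B + 1)^3\<close>.\<close>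

lemma exists_vanishing_polynomial:
  assumes "finite L" "card L \<le> B\<^sup>2"
  shows "\<exists>c. c \<noteq> (\<lambda>_ _ _. 0) \<and> deg_le (6 * B) c \<and> (\<forall>l\<in>L. evl (6 * B) c l = 0)"
proof -
  let ?D = "6 * B"
  define I where "I = {..2 * B} \<times> {..2 * B} \<times> {..2 * B}"
  define m where "m l = (\<lambda>(i, j, k). [:Re (fst l), Re (snd l):] ^ i * [:Im (fst l), Im (snd l):] ^ j * [:0, 1:] ^ k)"
    for l :: "complex \<times> complex"
  have "card (L \<times> {..?D}) \<le> B\<^sup>2 * (6 * B + 1)" using mult_le_mono1[OF assms(2), of "6 * B + 1"] by (simp add: card_cartesian_product)
  also have "\<dots> < (2 * B + 1) ^ 3" by (simp add: power2_eq_square power3_eq_cube algebra_simps)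
  also have "\<dots> = card I" unfolding I_def by (simp add: card_cartesian_product power3_eq_cube)
  finally have less: "card (L \<times> {..?D}) < card I" .
  have fin: "finite (L \<times> {..?D})" "finite I" using assms by (auto simp: I_def)
  from homogeneous_system_nontrivial[OF fin less, of "\<lambda>(l, n) i. coeff (m l i) n"]
  obtain c' where c': "\<exists>i\<in>I. c' i \<noteq> 0"
    "\<And>l n. l \<in> L \<Longrightarrow> n \<le> ?D \<Longrightarrow> (\<Sum>i\<in>I. coeff (m l i) n * c' i) = 0" by auto
  define c where "c i j k = (if (i, j, k) \<in> I then c' (i, j, k) else 0)" for i j k
  have "c \<noteq> (\<lambda>_ _ _. 0)" using c'(1) unfolding c_def fun_eq_iff by auto
  moreover have dl: "deg_le ?D c" unfolding deg_le_def c_def I_def by auto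
  moreover have "evl ?D c l = 0" if l: "l \<in> L" for l
  proof (rule poly_eqI)
    fix n
    show "coeff (evl ?D c l) n = coeff 0 n"
    proof (cases "n \<le> ?D")
      case True
      have "evl ?D c l = (\<Sum>(i, j, k)\<in>{..?D} \<times> {..?D} \<times> {..?D}. smult (c i j k) (m l (i, j, k)))"
        unfolding evl_def ev_def m_def by (simp add: sum.cartesian_product)
      also have "\<dots> = (\<Sum>(i, j, k)\<in>I. smult (c i j k) (m l (i, j, k)))"
        by (intro sum.mono_neutral_right) (auto simp: I_def c_def split: if_splits)
      also have "\<dots> = (\<Sum>i\<in>I. smult (c' i) (m l i))"
        by (intro sum.cong) (auto simp: c_def)
      finally have "coeff (evl ?D c l) n = (\<Sum>i\<in>I. coeff (m l i) n * c' i)"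
        by (simp add: coeff_sum mult.commute)
      then show ?thesis using c'(2)[OF l True] by simp
    next
      case False
      then show ?thesis using degree_evl_le[OF dl, of ?D l] by (simp add: coeff_eq_0)
    qed
  qed
  ultimately show ?thesis by blast
qed

text \<open>By minimality of the degree, a partial derivative that vanishes on all lines is zero. If
  all three were, the polynomial would be a nonzero constant vanishing on a line.\<close>

lemma minimal_vanishing_polynomial:
  assumes "finite L" "L \<noteq> {}" "card L \<le> B\<^sup>2"
  shows "\<exists>c l. deg_le (6 * B) c \<and> (\<forall>l\<in>L. evl (6 * B) c l = 0) \<and> l \<in> L \<and>
    (evl (6 * B) (dx c) l \<noteq> 0 \<or> evl (6 * B) (dy c) l \<noteq> 0 \<or> evl (6 * B) (dt c) l \<noteq> 0)"
proof -
  let ?D = "6 * B"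
  let ?P = "\<lambda>d. \<exists>c. c \<noteq> (\<lambda>_ _ _. 0) \<and> deg_le d c \<and> (\<forall>l\<in>L. evl ?D c l = 0)"
  define d where "d = (LEAST d. ?P d)"
  have ex: "?P ?D" using exists_vanishing_polynomial[OF assms(1,3)] .
  then have "?P d" unfolding d_def by (rule LeastI)
  then obtain c where c: "c \<noteq> (\<lambda>_ _ _. 0)" "deg_le d c" "\<forall>l\<in>L. evl ?D c l = 0" by blast
  have "d \<le> ?D" unfolding d_def using ex by (rule Least_le)
  then have "deg_le ?D c" using c(2) deg_le_mono by blast
  moreover have "\<exists>l\<in>L. evl ?D (dx c) l \<noteq> 0 \<or> evl ?D (dy c) l \<noteq> 0 \<or> evl ?D (dt c) l \<noteq> 0"
  proof (rule ccontr)
    assume "\<not> ?thesis"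
    then have van: "\<forall>l\<in>L. evl ?D (dx c) l = 0" "\<forall>l\<in>L. evl ?D (dy c) l = 0" "\<forall>l\<in>L. evl ?D (dt c) l = 0" by auto
    have low: "c' = (\<lambda>_ _ _. 0)" if "deg_le (d - 1) c'" "\<forall>l\<in>L. evl ?D c' l = 0" "d > 0" for c'
    proof (rule ccontr)
      assume "c' \<noteq> (\<lambda>_ _ _. 0)"
      then have "?P (d - 1)" using that by blast
      then have "d \<le> d - 1" unfolding d_def by (rule Least_le)
      then show False using that by simp
    qed
    have cz: "c i j k = 0" if "i + j + k > 0" for i j k
    \<comment> \<open>For \<open>d = 0\<close> truncated subtraction gives \<open>d - 1 = d\<close>,
      so minimality says nothing; but then there are no coefficients of positive degree.\<close>
    proof (cases "d = 0")
      case True then show ?thesis using c(2) that unfolding deg_le_def by auto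
    next
      case False
      then have "dx c = (\<lambda>_ _ _. 0)" "dy c = (\<lambda>_ _ _. 0)" "dt c = (\<lambda>_ _ _. 0)"
        using low[OF deg_le_partial(1)[OF c(2)] van(1)] low[OF deg_le_partial(2)[OF c(2)] van(2)]
          low[OF deg_le_partial(3)[OF c(2)] van(3)] by auto
      then have "real (Suc i) * c (Suc i) j k = 0" "real (Suc j) * c i (Suc j) k = 0"
        "real (Suc k) * c i j (Suc k) = 0" for i j k
        unfolding dx_def dy_def dt_def fun_eq_iff by blast+
      then have *: "c (Suc i) j k = 0" "c i (Suc j) k = 0" "c i j (Suc k) = 0" for i j k
        by (metis mult_eq_0_iff of_nat_eq_0_iff nat.distinct(2))+
      show ?thesis using that * by (cases i; cases j; cases k) auto
    qed
    obtain l where l: "l \<in> L" using assms by blast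
    have "evl ?D c l = (\<Sum>(i, j, k)\<in>{..?D} \<times> {..?D} \<times> {..?D}. smult (c i j k)
        ([:Re (fst l), Re (snd l):] ^ i * [:Im (fst l), Im (snd l):] ^ j * [:0, 1:] ^ k))"
      unfolding evl_def ev_def by (simp add: sum.cartesian_product)
    also have "\<dots> = (\<Sum>(i, j, k)\<in>{(0,0,0)}. smult (c i j k)
        ([:Re (fst l), Re (snd l):] ^ i * [:Im (fst l), Im (snd l):] ^ j * [:0, 1:] ^ k))"
    proof (intro sum.mono_neutral_right ballI)
      fix x assume x: "x \<in> {..?D} \<times> {..?D} \<times> {..?D} - {(0, 0, 0)}"
      obtain i j k where ijk: "x = (i, j, k)" by (metis surj_pair)
      then have "c i j k = 0" using x by (intro cz) auto
      then show "(case x of (i, j, k) \<Rightarrow> smult (c i j k)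
        ([:Re (fst l), Re (snd l):] ^ i * [:Im (fst l), Im (snd l):] ^ j * [:0, 1:] ^ k)) = 0"
        by (simp add: ijk)
    qed auto
    finally have "c 0 0 0 = 0" using c(3) l by simp
    with cz have "c i j k = 0" for i j k by (cases "i + j + k > 0") auto
    with c(1) show False by (auto simp: fun_eq_iff)
  qed
  ultimately show ?thesis using c(3) by blast
qed

text \<open>
  Take a line on which the gradient of a vanishing polynomial of minimal degree is not identically zero. The
  Wronskian of its components vanishes at all 3-rich points of the line, so if these are many the tangent plane is
  constant and contains the other lines through the noncritical rich points.
\<close>

lemma exists_line_with_few_rich_points:
  assumes fin: "finite L" and ne: "L \<noteq> {}" and card: "card L \<le> B\<^sup>2"
    and planes: "\<And>n \<mu> \<nu>. n \<noteq> 0 \<Longrightarrow> card {l \<in> L. inner n (fst l) = \<mu> \<and> inner n (snd l) = \<nu>} \<le> B"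
  shows "\<exists>l\<in>L. card {t. (l, t) \<in> rich L} \<le> 20 * B"
proof -
  let ?D = "6 * B"
  obtain c l where c: "deg_le ?D c" and van: "\<And>l. l \<in> L \<Longrightarrow> evl ?D c l = 0" and l: "l \<in> L"
    and nc: "evl ?D (dx c) l \<noteq> 0 \<or> evl ?D (dy c) l \<noteq> 0 \<or> evl ?D (dt c) l \<noteq> 0"
    using minimal_vanishing_polynomial[OF fin ne card] by blast
  have B: "B \<ge> 1"
    using card fin ne by (metis One_nat_def Suc_leI card_gt_0_iff gr0I not_le zero_power2)
  have d1: "deg_le ?D (dx c)" "deg_le ?D (dy c)" "deg_le ?D (dt c)"
    using deg_le_partial[OF c] deg_le_mono by (meson diff_le_self)+
  define qx where "qx = evl ?D (dx c) l"
  define qy where "qy = evl ?D (dy c) l"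
  define f where "f c t = poly (evl ?D c l) t" for c t
  have first: "smult (Re (snd l)) (evl ?D (dx c) l) + smult (Im (snd l)) (evl ?D (dy c) l) + evl ?D (dt c) l = 0"
    if "l \<in> L" for l using pderiv_evl[OF c, of l] van[OF that] by simp
  \<comment> \<open>The derivative along \<open>l\<close> vanishes, so \<open>qx = qy = 0\<close>
    would make the third component of the gradient vanish on \<open>l\<close> as well.\<close>
  have q0: "qx \<noteq> 0 \<or> qy \<noteq> 0"
    using nc first[OF l] unfolding qx_def qy_def by auto
  have g: "Re (snd l') * f (dx c) t + Im (snd l') * f (dy c) t + f (dt c) t = 0" if "l' \<in> through L l t" for l' t
  proof -
    have l': "l' \<in> L" "lpt l' t = lpt l t" using that unfolding through_def by auto
    show ?thesis
      using arg_cong[OF first[OF l'(1)], of "\<lambda>p. poly p t"] poly_evl_cong[OF l'(2)] unfolding f_def by simp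
  qed
  \<comment> \<open>The second derivative along \<open>l'\<close>, with its coefficients read off on
    \<open>l\<close>, since both lines pass through the point.\<close>
  have h: "(Re (snd l'))\<^sup>2 * f (dx (dx c)) t + 2 * Re (snd l') * Im (snd l') * f (dx (dy c)) t
      + (Im (snd l'))\<^sup>2 * f (dy (dy c)) t + 2 * Re (snd l') * f (dx (dt c)) t
      + 2 * Im (snd l') * f (dy (dt c)) t + f (dt (dt c)) t = 0" if "l' \<in> through L l t" for l' t
  proof -
    have l': "l' \<in> L" "lpt l' t = lpt l t" using that unfolding through_def by auto
    have "pderiv (smult (Re (snd l')) (evl ?D (dx c) l') + smult (Im (snd l')) (evl ?D (dy c) l') + evl ?D (dt c) l') = 0"
      using first[OF l'(1)] by simp
    then have "poly (pderiv (smult (Re (snd l')) (evl ?D (dx c) l') + smult (Im (snd l')) (evl ?D (dy c) l') + evl ?D (dt c) l')) t = 0"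
      by simp
    then show ?thesis
      unfolding pderiv_add pderiv_smult pderiv_evl[OF d1(1)] pderiv_evl[OF d1(2)] pderiv_evl[OF d1(3)]
      by (simp add: poly_evl_cong[OF l'(2)] f_def partial_commute power2_eq_square algebra_simps)
  qed
  define R where "R = {t. (l, t) \<in> rich L}"
  have finR: "finite R" unfolding R_def by (rule finite_rich_parameters[OF fin])
  define W where "W = qx * pderiv qy - qy * pderiv qx"
  have W0: "poly W t = 0" if "t \<in> R" for t
  proof -
    have lt: "l \<in> through L l t" using l by (simp add: through_def)
    have c3: "card (through L l t) \<ge> 3" using that by (simp add: R_def rich_def)
    have fth: "finite (through L l t)" using fin by (simp add: through_def)
    have "card (through L l t - {l}) \<ge> 2" using c3 lt fth by simp
    then obtain l1 l2 where l12: "l1 \<in> through L l t - {l}" "l2 \<in> through L l t - {l}" "l1 \<noteq> l2"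
      by (metis card_le_Suc0_iff_eq fth finite_Diff not_less_eq_eq numeral_2_eq_2)
    define dir where "dir = (\<lambda>l::complex \<times> complex. (Re (snd l), Im (snd l)))"
    have inj: "dir a \<noteq> dir b" if "a \<in> through L l t" "b \<in> through L l t" "a \<noteq> b" for a b
      using that unfolding through_def dir_def lpt_def by (auto simp: prod_eq_iff complex_eq_iff)
    have dirs: "dir l \<noteq> dir l1" "dir l \<noteq> dir l2" "dir l1 \<noteq> dir l2"
      using inj[of l l1] inj[of l l2] inj[of l1 l2] l12 lt by auto
    have "f (dx c) t * (fst (dir l) * f (dx (dy c)) t + snd (dir l) * f (dy (dy c)) t + f (dy (dt c)) t)
      = f (dy c) t * (fst (dir l) * f (dx (dx c)) t + snd (dir l) * f (dx (dy c)) t + f (dx (dt c)) t)"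
      by (rule three_null_directions[of "dir ` through L l t" _ _ "f (dt c) t" _ _ _ _ _ "f (dt (dt c)) t" _ "dir l1" "dir l2"])
        (use g h lt l12 dirs in \<open>auto simp: dir_def\<close>)
    then show ?thesis
      unfolding W_def qx_def qy_def pderiv_evl[OF d1(1)] pderiv_evl[OF d1(2)]
      by (simp add: f_def dir_def partial_commute)
  qed
  show ?thesis
  proof (rule bexI[OF _ l], rule ccontr)
    assume "\<not> card {t. (l, t) \<in> rich L} \<le> 20 * B"
    \<comment> \<open>The degree of \<open>W\<close> is at most \<open>12 B\<close>, so more than
      \<open>20 B\<close> zeros force \<open>W = 0\<close>; discarding at most \<open>6 B\<close>
      critical points then leaves more than \<open>B\<close>.\<close>
    then have big: "card R > 20 * B" unfolding R_def by simp
    have dq: "degree qx \<le> ?D" "degree qy \<le> ?D"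
      unfolding qx_def qy_def using degree_evl_le d1 by auto
    have few: "card {t \<in> R. poly p t = 0} \<le> degree p" if "p \<noteq> 0" for p :: "real poly"
    proof -
      have "card {t \<in> R. poly p t = 0} \<le> card {t. poly p t = 0}"
        by (rule card_mono) (use poly_roots_finite[OF that] in auto)
      then show ?thesis using card_poly_roots_bound[OF that] by simp
    qed
    have "degree W \<le> 2 * ?D"
      unfolding W_def
    proof (rule degree_diff_le)
      show "degree (qx * pderiv qy) \<le> 2 * ?D"
        using degree_mult_le[of qx "pderiv qy"] dq by (simp add: degree_pderiv)
      show "degree (qy * pderiv qx) \<le> 2 * ?D"
        using degree_mult_le[of qy "pderiv qx"] dq by (simp add: degree_pderiv)
    qed
    moreover have "{t \<in> R. poly W t = 0} = R" using W0 by auto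
    ultimately have "W = 0" using few[of W] big by force
    then have propor: "poly qy s * poly qx t = poly qx s * poly qy t" for s t
      using proportional_if_wronskian_0[of qx qy s] unfolding W_def
      by (metis eq_iff_diff_eq_0 poly_smult)
    define Q where "Q = {t \<in> R. \<not> (poly qx t = 0 \<and> poly qy t = 0)}"
    have "card {t \<in> R. poly qx t = 0 \<and> poly qy t = 0} \<le> ?D"
    proof -
      have "{t \<in> R. poly qx t = 0 \<and> poly qy t = 0} \<subseteq> {t \<in> R. poly qx t = 0}"
        "{t \<in> R. poly qx t = 0 \<and> poly qy t = 0} \<subseteq> {t \<in> R. poly qy t = 0}" by auto
      then have "card {t \<in> R. poly qx t = 0 \<and> poly qy t = 0} \<le> card {t \<in> R. poly qx t = 0}"
        "card {t \<in> R. poly qx t = 0 \<and> poly qy t = 0} \<le> card {t \<in> R. poly qy t = 0}"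
        using finR by (auto intro!: card_mono)
      then show ?thesis using q0 few[of qx] few[of qy] dq by force
    qed
    moreover have "R = Q \<union> {t \<in> R. poly qx t = 0 \<and> poly qy t = 0}" unfolding Q_def by auto
    ultimately have Qbig: "card Q > B"
      using big card_Un_le[of Q "{t \<in> R. poly qx t = 0 \<and> poly qy t = 0}"] by simp
    then obtain t0 where t0: "t0 \<in> Q" by (metis card.empty ex_in_conv not_less_zero)
    \<comment> \<open>The horizontal part of the gradient at one noncritical point; by
      \<open>propor\<close> it has the same direction at the others.\<close>
    define n where "n = Complex (poly qx t0) (poly qy t0)"
    have n0: "n \<noteq> 0" using t0 unfolding n_def Q_def by (auto simp: complex_eq_iff)
    have "\<exists>l'. l' \<in> through L l t \<and> l' \<noteq> l" if "t \<in> Q" for t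
    proof (rule ccontr)
      assume "\<not> ?thesis"
      then have "through L l t \<subseteq> {l}" by auto
      from card_mono[OF _ this] show False using that by (simp add: Q_def R_def rich_def)
    qed
    then obtain k where k: "\<And>t. t \<in> Q \<Longrightarrow> k t \<in> through L l t" "\<And>t. t \<in> Q \<Longrightarrow> k t \<noteq> l" by metis
    have kl: "lpt (k t) t = lpt l t" if "t \<in> Q" for t using k(1)[OF that] by (simp add: through_def)
    have inj: "inj_on k Q"
    proof (rule inj_onI, rule ccontr)
      fix s t assume st: "s \<in> Q" "t \<in> Q" "k s = k t" "s \<noteq> t"
      then show False using lines_meet_once[of "k t" t l s] kl[of s] kl[of t] k(2)[of t] by simp
    qed
    \<comment> \<open>The lines of \<open>L\<close> that lie, together with \<open>l\<close>, in one
      plane of the form \<open>n . z = \<mu> + \<nu> t\<close>.\<close>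
    define Pl where "Pl = {l' \<in> L. inner n (fst l') = inner n (fst l) \<and> inner n (snd l') = inner n (snd l)}"
    have "k ` Q \<subseteq> Pl"
    proof
      fix l' assume "l' \<in> k ` Q"
      then obtain t where t: "t \<in> Q" "l' = k t" by blast
      define a where "a = Re (snd l') - Re (snd l)"
      define b where "b = Im (snd l') - Im (snd l)"
      have lt: "l \<in> through L l t" using l by (simp add: through_def)
      have ab: "a * poly qx t + b * poly qy t = 0"
        using g[OF k(1)[OF t(1)]] g[OF lt] t(2) unfolding a_def b_def f_def qx_def qy_def
        by (simp add: algebra_simps)
      have "poly qx t * (a * poly qx t0 + b * poly qy t0) = 0" "poly qy t * (a * poly qx t0 + b * poly qy t0) = 0"
        using ab propor[of t0 t] by algebra+
      then have s: "a * poly qx t0 + b * poly qy t0 = 0" using t(1) unfolding Q_def by auto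
      have m: "fst l' = fst l - of_real t * (snd l' - snd l)"
        using kl[OF t(1)] t(2) unfolding lpt_def by (simp add: algebra_simps)
      have i2: "inner n (snd l' - snd l) = 0"
        using s unfolding n_def a_def b_def inner_complex_def by (simp add: algebra_simps)
      then have "inner n (fst l') = inner n (fst l)"
        unfolding m by (simp add: inner_diff_right flip: scaleR_conv_of_real)
      with i2 show "l' \<in> Pl"
        using k(1)[OF t(1)] t(2) unfolding Pl_def through_def by (simp add: inner_diff_right)
    qed
    then have "card Q \<le> card Pl"
      using inj fin by (intro card_inj_on_le[of k]) (auto simp: Pl_def)
    also have "\<dots> \<le> B" unfolding Pl_def by (rule planes[OF n0])
    finally show False using Qbig by simp
  qed
qed

text \<open>
  Removing a line with \<open>r\<close> rich points destroys at most \<open>3 r\<close> incidences: its own, and those of the two other lines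
  at points that drop from three lines to two.
\<close>

lemma card_rich_le:
  assumes "finite L" "card L \<le> B\<^sup>2"
    and "\<And>n \<mu> \<nu>. n \<noteq> 0 \<Longrightarrow> card {l \<in> L. inner n (fst l) = \<mu> \<and> inner n (snd l) = \<nu>} \<le> B"
  shows "finite (rich L) \<and> card (rich L) \<le> 60 * B * card L"
  using assms
proof (induction "card L" arbitrary: L)
  case 0
  then show ?case by (simp add: rich_def)
next
  case (Suc m)
  then have "L \<noteq> {}" by auto
  from exists_line_with_few_rich_points[OF Suc.prems(1) this Suc.prems(2,3)] obtain l where
    l: "l \<in> L" and few: "card {t. (l, t) \<in> rich L} \<le> 20 * B" by blast
  define T where "T = {t. (l, t) \<in> rich L}"
  have fT: "finite T" unfolding T_def by (rule finite_rich_parameters[OF Suc.prems(1)])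
  define L' where "L' = L - {l}"
  have fL': "finite L'" using Suc.prems by (simp add: L'_def)
  have cL': "card L' = m" using Suc l by (simp add: L'_def)
  \<comment> \<open>\<open>B\<close> stays fixed while lines are deleted, since both hypotheses pass
    to subsets.\<close>
  have IH: "finite (rich L') \<and> card (rich L') \<le> 60 * B * card L'"
  proof (rule Suc.hyps(1))
    show "card L' \<le> B\<^sup>2" using Suc.prems(2) Suc.hyps(2) cL' by simp
    fix n :: complex and \<mu> \<nu> assume "n \<noteq> 0"
    have "card {l \<in> L'. inner n (fst l) = \<mu> \<and> inner n (snd l) = \<nu>} \<le> card {l \<in> L. inner n (fst l) = \<mu> \<and> inner n (snd l) = \<nu>}"
      using Suc.prems(1) by (intro card_mono) (auto simp: L'_def)
    with Suc.prems(3)[OF \<open>n \<noteq> 0\<close>] show "card {l \<in> L'. inner n (fst l) = \<mu> \<and> inner n (snd l) = \<nu>} \<le> B"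
      using order_trans by blast
  qed (use cL' fL' in auto)
  define T3 where "T3 = {t \<in> T. card (through L l t) \<le> 3}"
  have sub: "rich L \<subseteq> rich L' \<union> {l} \<times> T \<union> (\<Union>t\<in>T3. (through L l t - {l}) \<times> {t})"
  proof (rule subsetI, rule ccontr)
    fix x
    assume x: "x \<in> rich L" "x \<notin> rich L' \<union> {l} \<times> T \<union> (\<Union>t\<in>T3. (through L l t - {l}) \<times> {t})"
    obtain m v t where xe: "x = ((m, v), t)" by (metis surj_pair)
    have r: "((m, v), t) \<in> rich L" and n1: "((m, v), t) \<notin> (\<Union>t\<in>T3. (through L l t - {l}) \<times> {t})"
      and n2: "((m, v), t) \<notin> {l} \<times> T" and n3: "((m, v), t) \<notin> rich L'" using x xe by auto
    let ?k = "(m, v)"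
    have kl: "?k \<noteq> l" using n2 r unfolding T_def by auto
    have kL: "?k \<in> L" "card (through L ?k t) \<ge> 3" using r unfolding rich_def by auto
    have th: "through L' ?k t = through L ?k t - {l}" unfolding through_def L'_def by auto
    have f: "finite (through L ?k t)" using Suc.prems(1) by (simp add: through_def)
    have "card (through L' ?k t) \<ge> 3"
    proof (cases "l \<in> through L ?k t")
      case False then show ?thesis using kL th by simp
    next
      case True
      then have eq: "through L l t = through L ?k t" unfolding through_def by auto
      then have "t \<in> T" using l kL unfolding T_def rich_def by auto
      have "\<not> card (through L l t) \<le> 3"
      proof
        assume "card (through L l t) \<le> 3"
        then have "t \<in> T3" using \<open>t \<in> T\<close> by (simp add: T3_def)
        moreover have "?k \<in> through L l t - {l}" using kl kL eq by (auto simp: through_def)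
        ultimately show False using n1 by blast
      qed
      then show ?thesis using th True f eq by simp
    qed
    then have "((m, v), t) \<in> rich L'" using kL kl unfolding rich_def L'_def by auto
    with n3 show False by blast
  qed
  have c2: "card ((through L l t - {l}) \<times> {t}) \<le> 2" if "t \<in> T3" for t
  proof -
    have "l \<in> through L l t" using l by (simp add: through_def)
    then show ?thesis using that Suc.prems(1) by (auto simp: T3_def card_cartesian_product through_def)
  qed
  have fT3: "finite T3" using fT by (simp add: T3_def)
  have "card (\<Union>t\<in>T3. (through L l t - {l}) \<times> {t}) \<le> (\<Sum>t\<in>T3. card ((through L l t - {l}) \<times> {t}))"
    by (rule card_UN_le[OF fT3])
  also have "\<dots> \<le> card T3 * 2" using sum_bounded_above[OF c2] by simp
  also have "\<dots> \<le> card T * 2" using fT by (simp add: T3_def card_mono)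
  finally have b3: "card (\<Union>t\<in>T3. (through L l t - {l}) \<times> {t}) \<le> card T * 2" .
  have fin: "finite (rich L' \<union> {l} \<times> T \<union> (\<Union>t\<in>T3. (through L l t - {l}) \<times> {t}))"
    using IH fT fT3 Suc.prems(1) by (auto simp: through_def)
  have "card (rich L) \<le> card (rich L' \<union> {l} \<times> T \<union> (\<Union>t\<in>T3. (through L l t - {l}) \<times> {t}))"
    by (rule card_mono[OF fin sub])
  also have "\<dots> \<le> card (rich L') + card ({l} \<times> T) + card (\<Union>t\<in>T3. (through L l t - {l}) \<times> {t})"
    by (meson card_Un_le order_trans add_le_mono1)
  also have "\<dots> \<le> 60 * B * m + 20 * B + 20 * B * 2"
    using IH few b3 cL' by (simp add: card_cartesian_product T_def)
  also have "\<dots> = 60 * B * card L" using Suc.hyps(2)[symmetric] by (simp add: algebra_simps)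
  finally show ?case using finite_subset[OF sub fin] by blast
qed

section \<open>Lines containing many points of a planar set\<close>

definition hyp :: "complex \<Rightarrow> real \<Rightarrow> complex set"
  where "hyp u e = {z. inner u z = e}"

lemma hyp_param:
  assumes "u \<noteq> 0" "z \<in> hyp u e" "w \<in> hyp u e"
  shows "\<exists>r. z = w + of_real r * (\<i> * u)"
proof -
  define n where "n = (Re u)\<^sup>2 + (Im u)\<^sup>2"
  have n: "n \<noteq> 0" using assms(1) unfolding n_def by (simp add: complex_eq_iff sum_power2_eq_zero_iff)
  define a where "a = Re z - Re w"
  define b where "b = Im z - Im w"
  have e: "Re u * a + Im u * b = 0"
    using assms(2,3) unfolding hyp_def inner_complex_def a_def b_def by (simp add: algebra_simps)
  define r where "r = (Re u * b - Im u * a) / n"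
  have "n * a = - (Re u * b - Im u * a) * Im u" "n * b = (Re u * b - Im u * a) * Re u"
    using e unfolding n_def by algebra+
  then have "a = - r * Im u" "b = r * Re u" using n unfolding r_def by (simp_all add: field_simps)
  then show ?thesis unfolding a_def b_def
    by (intro exI[of _ r]) (simp add: complex_eq_iff algebra_simps)
qed

lemma hyp_eqI:
  assumes "u \<noteq> 0" "v \<noteq> 0" "x \<noteq> y" "x \<in> hyp u e" "y \<in> hyp u e" "x \<in> hyp v f" "y \<in> hyp v f"
  shows "hyp u e = hyp v f"
proof -
  have *: "hyp u e \<subseteq> hyp v f" if h: "u \<noteq> 0" "x \<in> hyp u e" "y \<in> hyp u e" "x \<in> hyp v f" "y \<in> hyp v f" for u v e f
  proof
    fix z assume z: "z \<in> hyp u e"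
    obtain r where r: "y = x + of_real r * (\<i> * u)" using hyp_param[OF h(1,3,2)] by blast
    obtain s where s: "z = x + of_real s * (\<i> * u)" using hyp_param[OF h(1) z h(2)] by blast
    have "r \<noteq> 0" using r assms(3) by auto
    have yx: "y - x = of_real r * (\<i> * u)" using r by simp
    have "z = x + (s / r) *\<^sub>R (y - x)" unfolding yx using s \<open>r \<noteq> 0\<close> by (simp add: scaleR_conv_of_real)
    then have "inner v z = inner v x + (s / r) * (inner v y - inner v x)"
      by (simp add: inner_add_right inner_diff_right)
    then show "z \<in> hyp v f" using h unfolding hyp_def by simp
  qed
  show ?thesis using *[of u e v f] *[of v f u e] assms by blast
qed

text \<open>Between the opposite quadrants of \<open>a\<close> and \<open>d\<close> both functionals
  change with the same sign, between those of \<open>b\<close> and \<open>c\<close> with opposite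
  signs. A single direction vector cannot do both.\<close>

lemma line_misses_quadrant:
  assumes "u \<noteq> 0" "a \<in> hyp u e" "b \<in> hyp u e" "c \<in> hyp u e" "d \<in> hyp u e"
    "inner p a > \<mu>" "inner q a > \<nu>" "inner p b > \<mu>" "inner q b < \<nu>"
    "inner p c < \<mu>" "inner q c > \<nu>" "inner p d < \<mu>" "inner q d < \<nu>"
  shows False
proof -
  obtain r where r: "a = d + of_real r * (\<i> * u)" using hyp_param assms by blast
  obtain s where s: "b = c + of_real s * (\<i> * u)" using hyp_param assms by blast
  define \<alpha> where "\<alpha> = inner p (\<i> * u)"
  define \<beta> where "\<beta> = inner q (\<i> * u)"
  have "inner p a = inner p d + r * \<alpha>" "inner q a = inner q d + r * \<beta>"
    "inner p b = inner p c + s * \<alpha>" "inner q b = inner q c + s * \<beta>"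
    unfolding r s \<alpha>_def \<beta>_def by (simp_all add: inner_add_right flip: scaleR_conv_of_real)
  then have "r * \<alpha> > 0" "r * \<beta> > 0" "s * \<alpha> > 0" "s * \<beta> < 0" using assms by linarith+
  then show False by (auto simp: zero_less_mult_iff mult_less_0_iff)
qed

section \<open>Medians, simultaneous halving and quartering\<close>

lemma continuous_on_Max_image:
  fixes f :: "'i \<Rightarrow> real \<Rightarrow> real"
  assumes "finite I" "I \<noteq> {}" "\<And>i. i \<in> I \<Longrightarrow> continuous_on U (f i)"
  shows "continuous_on U (\<lambda>s. Max ((\<lambda>i. f i s) ` I))"
  using assms
proof (induction I rule: finite_ne_induct)
  case (insert i I)
  then have "(\<lambda>s. Max ((\<lambda>i. f i s) ` insert i I)) = (\<lambda>s. max (f i s) (Max ((\<lambda>i. f i s) ` I)))"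
    by (auto simp: fun_eq_iff)
  then show ?case using insert by (auto intro!: continuous_on_max)
qed simp

lemma continuous_on_Min_image:
  fixes f :: "'i \<Rightarrow> real \<Rightarrow> real"
  assumes "finite I" "I \<noteq> {}" "\<And>i. i \<in> I \<Longrightarrow> continuous_on U (f i)"
  shows "continuous_on U (\<lambda>s. Min ((\<lambda>i. f i s) ` I))"
  using assms
proof (induction I rule: finite_ne_induct)
  case (insert i I)
  then have "(\<lambda>s. Min ((\<lambda>i. f i s) ` insert i I)) = (\<lambda>s. min (f i s) (Min ((\<lambda>i. f i s) ` I)))"
    by (auto simp: fun_eq_iff)
  then show ?case using insert by (auto intro!: continuous_on_min)
qed simp

definition halves :: "'a set \<Rightarrow> ('a \<Rightarrow> real) \<Rightarrow> real \<Rightarrow> bool"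
  where "halves S f m \<longleftrightarrow> 2 * card {x \<in> S. f x < m} \<le> card S \<and> 2 * card {x \<in> S. f x > m} \<le> card S"

text \<open>The order statistic of rank \<open>(card S + 1) div 2\<close>, written as a minimum of
  maxima so that it depends continuously on \<open>f\<close>.\<close>

definition median :: "'a set \<Rightarrow> ('a \<Rightarrow> real) \<Rightarrow> real"
  where "median S f = Min ((\<lambda>T. Max (f ` T)) ` {T. T \<subseteq> S \<and> card T = (card S + 1) div 2})"

lemma median_family:
  assumes "finite S" "S \<noteq> {}"
  shows "finite {T. T \<subseteq> S \<and> card T = (card S + 1) div 2}"
    and "{T. T \<subseteq> S \<and> card T = (card S + 1) div 2} \<noteq> {}"
    and "T \<subseteq> S \<Longrightarrow> card T = (card S + 1) div 2 \<Longrightarrow> finite T \<and> T \<noteq> {}"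
proof -
  show "finite {T. T \<subseteq> S \<and> card T = (card S + 1) div 2}" using assms by auto
  have c: "card S > 0" using assms by (simp add: card_gt_0_iff)
  have "(card S + 1) div 2 \<le> card S" using c by linarith
  then obtain T0 where "T0 \<subseteq> S" "card T0 = (card S + 1) div 2" "finite T0"
    by (rule obtain_subset_with_card_n)
  then show "{T. T \<subseteq> S \<and> card T = (card S + 1) div 2} \<noteq> {}" by blast
  show "T \<subseteq> S \<Longrightarrow> card T = (card S + 1) div 2 \<Longrightarrow> finite T \<and> T \<noteq> {}"
    using assms c finite_subset by fastforce
qed

lemma median_attained:
  assumes "finite S" "S \<noteq> {}"
  shows "\<exists>T\<subseteq>S. card T = (card S + 1) div 2 \<and> T \<noteq> {} \<and> finite T \<and> median S f = Max (f ` T)"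
proof -
  have "median S f \<in> (\<lambda>T. Max (f ` T)) ` {T. T \<subseteq> S \<and> card T = (card S + 1) div 2}"
    unfolding median_def by (rule Min_in) (use median_family(1,2)[OF assms] in auto)
  then obtain T where T: "T \<subseteq> S" "card T = (card S + 1) div 2" "median S f = Max (f ` T)" by blast
  with median_family(3)[OF assms T(1,2)] show ?thesis by blast
qed

lemma median_value:
  assumes "finite S" "S \<noteq> {}"
  shows "\<exists>x\<in>S. median S f = f x"
proof -
  obtain T where T: "T \<subseteq> S" "T \<noteq> {}" "finite T" "median S f = Max (f ` T)" using median_attained[OF assms] by metis
  then have "median S f \<in> f ` T" by simp
  then show ?thesis using T by blast
qed

lemma halves_median:
  assumes "finite S" "S \<noteq> {}"
  shows "halves S f (median S f)"
proof -
  let ?k = "(card S + 1) div 2" and ?m = "median S f"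
  obtain T where T: "T \<subseteq> S" "card T = ?k" "finite T" "?m = Max (f ` T)" using median_attained[OF assms] by metis
  have "T \<subseteq> {x \<in> S. f x \<le> ?m}" using T by auto
  moreover have "finite {x \<in> S. f x \<le> ?m}" using assms by simp
  ultimately have "?k \<le> card {x \<in> S. f x \<le> ?m}" unfolding T(2)[symmetric] by (rule card_mono[rotated])
  moreover have "card S = card {x \<in> S. f x \<le> ?m} + card {x \<in> S. f x > ?m}"
    using assms by (subst card_Un_disjoint[symmetric]) (auto intro: arg_cong[of _ _ card])
  ultimately have 1: "2 * card {x \<in> S. f x > ?m} \<le> card S" by linarith
  have "card {x \<in> S. f x < ?m} < ?k"
  proof (rule ccontr)
    assume "\<not> ?thesis"
    then have "?k \<le> card {x \<in> S. f x < ?m}" by simp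
    then obtain T' where
      T': "T' \<subseteq> {x \<in> S. f x < ?m}" "card T' = ?k" "finite T'" by (rule obtain_subset_with_card_n)
    then have T'S: "T' \<subseteq> S" by auto
    have ne: "finite T'" "T' \<noteq> {}" using median_family(3)[OF assms T'S T'(2)] by auto
    have "?m \<le> Max (f ` T')" unfolding median_def
      by (rule Min_le) (use median_family(1)[OF assms] T'S T'(2) in auto)
    moreover have "Max (f ` T') < ?m" using ne T'(1) by auto
    ultimately show False by simp
  qed
  then have "2 * card {x \<in> S. f x < ?m} \<le> card S" by linarith
  with 1 show ?thesis unfolding halves_def by simp
qed

lemma continuous_on_median:
  fixes f :: "real \<Rightarrow> 'a \<Rightarrow> real"
  assumes S: "finite S" "S \<noteq> {}" and f: "\<And>x. x \<in> S \<Longrightarrow> continuous_on U (\<lambda>s. f s x)"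
  shows "continuous_on U (\<lambda>s. median S (f s))"
  unfolding median_def
proof (rule continuous_on_Min_image)
  fix T assume T: "T \<in> {T. T \<subseteq> S \<and> card T = (card S + 1) div 2}"
  show "continuous_on U (\<lambda>s. Max (f s ` T))"
    by (rule continuous_on_Max_image[of T U "\<lambda>x s. f s x"]) (use T median_family(3)[OF S, of T] f in auto)
qed (use median_family(1,2)[OF S] in auto)

text \<open>A shear at least as steep as every segment from \<open>P\<close> to \<open>Q\<close>
  brings \<open>Q\<close> below \<open>P\<close>.\<close>

lemma separated_slope:
  fixes P Q :: "complex set"
  assumes "finite P" "finite Q" "\<And>z w. z \<in> P \<Longrightarrow> w \<in> Q \<Longrightarrow> Re z < Re w"
  shows "\<exists>s\<ge>0. \<forall>z\<in>P. \<forall>w\<in>Q. Im w - s * Re w \<le> Im z - s * Re z"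
proof -
  let ?F = "insert 0 ((\<lambda>(z, w). (Im w - Im z) / (Re w - Re z)) ` (P \<times> Q))"
  have fin: "finite ?F" using assms by auto
  have "Im w - Max ?F * Re w \<le> Im z - Max ?F * Re z" if "z \<in> P" "w \<in> Q" for z w
  proof -
    have "(Im w - Im z) / (Re w - Re z) \<le> Max ?F"
      by (rule Max_ge[OF fin]) (use that in force)
    then have "Im w - Im z \<le> Max ?F * (Re w - Re z)" using assms(3)[OF that] by (simp add: divide_simps)
    then show ?thesis by (simp add: algebra_simps)
  qed
  moreover have "Max ?F \<ge> 0" by (rule Max_ge[OF fin]) simp
  ultimately show ?thesis by blast
qed

text \<open>A discrete ham sandwich theorem. The difference of the medians of the sheared heights is
  continuous in the slope and changes sign between two extreme slopes.\<close>

lemma simultaneous_halving: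
  fixes P Q :: "complex set"
  assumes fin: "finite P" "finite Q" and sep: "\<And>z w. z \<in> P \<Longrightarrow> w \<in> Q \<Longrightarrow> Re z < Re w"
  shows "\<exists>s e. halves P (\<lambda>z. Im z - s * Re z) e \<and> halves Q (\<lambda>z. Im z - s * Re z) e"
proof -
  have emp: "halves {} f e" for f :: "complex \<Rightarrow> real" and e by (simp add: halves_def)
  show ?thesis
  proof (cases "P = {} \<or> Q = {}")
    case True
    then show ?thesis using emp halves_median fin by metis
  next
    case False
    define f where "f s z = Im z - s * Re z" for s z
    define g where "g s = median P (f s) - median Q (f s)" for s
    have cont: "continuous_on UNIV g"
      unfolding g_def by (intro continuous_on_diff continuous_on_median) (use False fin in \<open>auto simp: f_def intro!: continuous_intros\<close>)
    obtain s1 where s1: "s1 \<ge> 0" "\<forall>z\<in>P. \<forall>w\<in>Q. Im w - s1 * Re w \<le> Im z - s1 * Re z"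
      using separated_slope[OF fin sep] by blast
    \<comment> \<open>Conjugation reverses heights, so the same lemma supplies the extreme negative
      slope.\<close>
    have sep': "\<And>z w. z \<in> cnj ` P \<Longrightarrow> w \<in> cnj ` Q \<Longrightarrow> Re z < Re w" using sep by auto
    obtain s2 where s2: "s2 \<ge> 0" "\<forall>z\<in>cnj ` P. \<forall>w\<in>cnj ` Q. Im w - s2 * Re w \<le> Im z - s2 * Re z"
      using separated_slope[OF finite_imageI[OF fin(1)] finite_imageI[OF fin(2)] sep'] by blast
    have mv: "\<exists>z\<in>P. \<exists>w\<in>Q. median P (f s) = f s z \<and> median Q (f s) = f s w" for s
      using median_value[of P "f s"] median_value[of Q "f s"] False fin by blast
    have "g s1 \<ge> 0"
      using mv[of s1] s1(2) unfolding g_def f_def by auto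
    moreover have "g (- s2) \<le> 0"
    proof -
      obtain z w where zw: "z \<in> P" "w \<in> Q" "median P (f (- s2)) = f (- s2) z" "median Q (f (- s2)) = f (- s2) w"
        using mv[of "- s2"] by blast
      have "Im (cnj w) - s2 * Re (cnj w) \<le> Im (cnj z) - s2 * Re (cnj z)" using s2(2) zw(1,2) by blast
      then show ?thesis using zw(3,4) by (simp add: g_def f_def)
    qed
    ultimately obtain s where "g s = 0"
      using IVT'[of g "- s2" 0 s1] s1 s2 continuous_on_subset[OF cont] by fastforce
    then have "median P (f s) = median Q (f s)" by (simp add: g_def)
    moreover have "halves P (f s) (median P (f s))" "halves Q (f s) (median Q (f s))" using halves_median fin False by auto
    ultimately show ?thesis unfolding f_def by metis
  qed
qed

text \<open>The quadrants are open: points on the two dividing lines belong to none of them.\<close>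

definition quadrants :: "complex set \<Rightarrow> complex \<Rightarrow> real \<Rightarrow> complex \<Rightarrow> real \<Rightarrow> complex set set"
  where "quadrants S p \<mu> q \<nu> =
    {{z \<in> S. inner p z > \<mu> \<and> inner q z > \<nu>}, {z \<in> S. inner p z > \<mu> \<and> inner q z < \<nu>},
     {z \<in> S. inner p z < \<mu> \<and> inner q z > \<nu>}, {z \<in> S. inner p z < \<mu> \<and> inner q z < \<nu>}}"

lemma card_quadrants: "finite (quadrants S p \<mu> q \<nu>)" "card (quadrants S p \<mu> q \<nu>) \<le> 4"
  unfolding quadrants_def by (auto simp: card_insert_if)

lemma card_quadrants_hit:
  assumes "u \<noteq> 0"
  shows "card {X \<in> quadrants S p \<mu> q \<nu>. X \<inter> hyp u e \<noteq> {}} \<le> 3"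
proof -
  have "\<exists>X\<in>quadrants S p \<mu> q \<nu>. X \<inter> hyp u e = {}"
  proof (rule ccontr)
    assume "\<not> ?thesis"
    then have hit: "X \<inter> hyp u e \<noteq> {}" if "X \<in> quadrants S p \<mu> q \<nu>" for X using that by blast
    obtain a where "a \<in> {z \<in> S. inner p z > \<mu> \<and> inner q z > \<nu>} \<inter> hyp u e"
      using hit[of "{z \<in> S. inner p z > \<mu> \<and> inner q z > \<nu>}"] unfolding quadrants_def by blast
    moreover obtain b where "b \<in> {z \<in> S. inner p z > \<mu> \<and> inner q z < \<nu>} \<inter> hyp u e"
      using hit[of "{z \<in> S. inner p z > \<mu> \<and> inner q z < \<nu>}"] unfolding quadrants_def by blast
    moreover obtain c where "c \<in> {z \<in> S. inner p z < \<mu> \<and> inner q z > \<nu>} \<inter> hyp u e"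
      using hit[of "{z \<in> S. inner p z < \<mu> \<and> inner q z > \<nu>}"] unfolding quadrants_def by blast
    moreover obtain d where "d \<in> {z \<in> S. inner p z < \<mu> \<and> inner q z < \<nu>} \<inter> hyp u e"
      using hit[of "{z \<in> S. inner p z < \<mu> \<and> inner q z < \<nu>}"] unfolding quadrants_def by blast
    ultimately show False using line_misses_quadrant[OF assms, of a e b c d \<mu> p \<nu> q] by blast
  qed
  then have "{X \<in> quadrants S p \<mu> q \<nu>. X \<inter> hyp u e \<noteq> {}} \<subset> quadrants S p \<mu> q \<nu>" by blast
  from psubset_card_mono[OF card_quadrants(1) this] show ?thesis using card_quadrants(2)[of S p \<mu> q \<nu>] by simp
qed

text \<open>A vertical median line, followed by a line that halves both of its open sides at
  once.\<close>

lemma quartering: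
  assumes fin: "finite S"
  shows "\<exists>p \<mu> q \<nu>. p \<noteq> 0 \<and> q \<noteq> 0 \<and> (\<forall>X\<in>quadrants S p \<mu> q \<nu>. 4 * card X \<le> card S)"
proof -
  have "\<exists>\<mu>. halves S Re \<mu>"
    using halves_median[OF fin, of Re] by (cases "S = {}") (auto simp: halves_def)
  then obtain \<mu> where \<mu>: "halves S Re \<mu>" by blast
  define P where "P = {z \<in> S. Re z < \<mu>}"
  define Q where "Q = {z \<in> S. Re z > \<mu>}"
  obtain s e where se: "halves P (\<lambda>z. Im z - s * Re z) e" "halves Q (\<lambda>z. Im z - s * Re z) e"
    using simultaneous_halving[of P Q] fin unfolding P_def Q_def by force
  have PQ: "2 * card P \<le> card S" "2 * card Q \<le> card S" using \<mu> by (auto simp: halves_def P_def Q_def)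
  have q: "inner (Complex (- s) 1) z = Im z - s * Re z" for z by (simp add: inner_complex_def)
  have "{z \<in> S. inner 1 z > \<mu> \<and> inner (Complex (- s) 1) z > e} = {z \<in> Q. Im z - s * Re z > e}"
    "{z \<in> S. inner 1 z > \<mu> \<and> inner (Complex (- s) 1) z < e} = {z \<in> Q. Im z - s * Re z < e}"
    "{z \<in> S. inner 1 z < \<mu> \<and> inner (Complex (- s) 1) z > e} = {z \<in> P. Im z - s * Re z > e}"
    "{z \<in> S. inner 1 z < \<mu> \<and> inner (Complex (- s) 1) z < e} = {z \<in> P. Im z - s * Re z < e}"
    unfolding q P_def Q_def by (auto simp: inner_complex_def)
  then have "\<forall>X\<in>quadrants S 1 \<mu> (Complex (- s) 1) e. 4 * card X \<le> card S"
    using se PQ unfolding quadrants_def halves_def by auto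
  moreover have "Complex (- s) 1 \<noteq> 0" by (simp add: complex_eq_iff)
  ultimately show ?thesis by (metis zero_neq_one)
qed

text \<open>\<open>F\<close> holds the cells after \<open>h\<close> rounds of quartering;
  \<open>Z\<close> is to absorb the points that fall on dividing lines.\<close>

definition line_partition :: "nat \<Rightarrow> complex set \<Rightarrow> complex set set \<Rightarrow> complex set \<Rightarrow> bool"
  where "line_partition h S F Z \<longleftrightarrow> finite F \<and> card F \<le> 4 ^ h \<and> Z \<subseteq> S \<and> S \<subseteq> Z \<union> \<Union>F \<and>
    (\<forall>X\<in>F. X \<subseteq> S \<and> 4 ^ h * card X \<le> card S) \<and>
    (\<forall>u e. u \<noteq> 0 \<longrightarrow> card {X \<in> F. X \<inter> hyp u e \<noteq> {}} \<le> 3 ^ h)"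

text \<open>A round loses at most \<open>2 M\<close> points on its two dividing lines, besides the
  losses in the four quadrants; hence the recursion from \<open>c\<close> to
  \<open>2 + 4 * c\<close>. A line enters only three of the four quadrants in every round.\<close>

lemma line_partition_exists:
  "\<exists>c::nat. \<forall>S M. finite S \<longrightarrow> (\<forall>u e. u \<noteq> 0 \<longrightarrow> card (S \<inter> hyp u e) \<le> M) \<longrightarrow>
    (\<exists>F Z. line_partition h S F Z \<and> card Z \<le> c * M)"
proof (induction h)
  case 0
  have "line_partition 0 S {S} {}" for S
    unfolding line_partition_def by (auto simp: card_le_Suc0_iff_eq)
  then show ?case by (metis card.empty le0)
next
  case (Suc h)
  then obtain c where c: "\<And>S M. finite S \<Longrightarrow> (\<forall>u e. u \<noteq> 0 \<longrightarrow> card (S \<inter> hyp u e) \<le> M) \<Longrightarrow>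
    (\<exists>F Z. line_partition h S F Z \<and> card Z \<le> c * M)" by blast
  have "\<exists>F Z. line_partition (Suc h) S F Z \<and> card Z \<le> (2 + 4 * c) * M"
    if fin: "finite S" and M: "\<forall>u e. u \<noteq> 0 \<longrightarrow> card (S \<inter> hyp u e) \<le> M" for S M
  proof -
    obtain p \<mu> q \<nu> where pq: "p \<noteq> 0" "q \<noteq> 0" and quarter: "\<And>X. X \<in> quadrants S p \<mu> q \<nu> \<Longrightarrow> 4 * card X \<le> card S"
      using quartering[OF fin] by blast
    define G where "G = quadrants S p \<mu> q \<nu>"
    have GS: "X \<subseteq> S" if "X \<in> G" for X using that unfolding G_def quadrants_def by auto
    have G: "finite G" "card G \<le> 4" unfolding G_def using card_quadrants by auto
    have "\<exists>F Z. line_partition h X F Z \<and> card Z \<le> c * M" if "X \<in> G" for X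
    proof (rule c)
      show "finite X" using GS[OF that] fin finite_subset by blast
      have "card (X \<inter> hyp u e) \<le> card (S \<inter> hyp u e)" for u e
        using GS[OF that] fin by (intro card_mono) auto
      then show "\<forall>u e. u \<noteq> 0 \<longrightarrow> card (X \<inter> hyp u e) \<le> M" using M order_trans by blast
    qed
    then obtain F Z where FZ: "\<And>X. X \<in> G \<Longrightarrow> line_partition h X (F X) (Z X)"
      and Z: "\<And>X. X \<in> G \<Longrightarrow> card (Z X) \<le> c * M" by metis
    define F' where "F' = (\<Union>X\<in>G. F X)"
    define Z' where "Z' = (S \<inter> hyp p \<mu>) \<union> (S \<inter> hyp q \<nu>) \<union> (\<Union>X\<in>G. Z X)"
    have bound: "card (\<Union>X\<in>H. K X) \<le> n * m" if "H \<subseteq> G" "card H \<le> n" "\<And>X. X \<in> H \<Longrightarrow> card (K X) \<le> m"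
      for H n m and K :: "complex set \<Rightarrow> 'b set"
    proof -
      have "card (\<Union>X\<in>H. K X) \<le> (\<Sum>X\<in>H. card (K X))" using that G finite_subset by (intro card_UN_le) blast
      also have "\<dots> \<le> card H * m" using sum_bounded_above[of H "\<lambda>X. card (K X)" m] that by simp
      finally show ?thesis using that(2) by (meson mult_le_mono1 order_trans)
    qed
    have "card Z' \<le> card (S \<inter> hyp p \<mu>) + card (S \<inter> hyp q \<nu>) + card (\<Union>X\<in>G. Z X)"
      unfolding Z'_def by (meson card_Un_le order_trans add_le_mono1)
    also have "\<dots> \<le> M + M + 4 * (c * M)"
      using M pq bound[OF order_refl G(2) Z] by (intro add_mono) auto
    finally have "card Z' \<le> (2 + 4 * c) * M" by (simp add: algebra_simps)
    moreover have "line_partition (Suc h) S F' Z'"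
      unfolding line_partition_def
    proof (intro conjI allI impI)
      show "finite F'" using G FZ unfolding F'_def line_partition_def by blast
      show "card F' \<le> 4 ^ Suc h" unfolding F'_def
        using bound[OF order_refl G(2), of F "4 ^ h"] FZ unfolding line_partition_def by simp
      have ZX: "Z X \<subseteq> X" "X \<subseteq> Z X \<union> \<Union>(F X)" if "X \<in> G" for X
        using FZ[OF that] unfolding line_partition_def by blast+
      show "Z' \<subseteq> S" unfolding Z'_def using ZX(1) GS by blast
      show "S \<subseteq> Z' \<union> \<Union>F'"
      proof
        fix z assume z: "z \<in> S"
        show "z \<in> Z' \<union> \<Union>F'"
        proof (cases "inner p z = \<mu> \<or> inner q z = \<nu>")
          case True then show ?thesis using z unfolding Z'_def hyp_def by auto
        next
          case False
          then have "z \<in> \<Union>G" unfolding G_def quadrants_def using z by auto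
          then obtain X where X: "X \<in> G" "z \<in> X" by blast
          with ZX(2)[OF X(1)] have "z \<in> Z X \<or> z \<in> \<Union>(F X)" by blast
          with X(1) show ?thesis unfolding Z'_def F'_def by blast
        qed
      qed
      show "\<forall>X\<in>F'. X \<subseteq> S \<and> 4 ^ Suc h * card X \<le> card S"
      proof
        fix Y assume "Y \<in> F'"
        then obtain X where X: "X \<in> G" "Y \<in> F X" unfolding F'_def by blast
        then have "Y \<subseteq> X" "4 ^ h * card Y \<le> card X" using FZ[OF X(1)] unfolding line_partition_def by blast+
        moreover have "4 * card X \<le> card S" using quarter X(1) unfolding G_def by blast
        ultimately show "Y \<subseteq> S \<and> 4 ^ Suc h * card Y \<le> card S" using GS[OF X(1)] by auto
      qed
      fix u e assume u: "(u::complex) \<noteq> 0"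
      let ?H = "{X \<in> G. X \<inter> hyp u e \<noteq> {}}"
      have sub: "{Y \<in> F'. Y \<inter> hyp u e \<noteq> {}} \<subseteq> (\<Union>X\<in>?H. {Y \<in> F X. Y \<inter> hyp u e \<noteq> {}})"
        using FZ unfolding F'_def line_partition_def by blast
      have "finite (\<Union>X\<in>?H. {Y \<in> F X. Y \<inter> hyp u e \<noteq> {}})" using G FZ unfolding line_partition_def by auto
      from card_mono[OF this sub] have "card {Y \<in> F'. Y \<inter> hyp u e \<noteq> {}} \<le> card (\<Union>X\<in>?H. {Y \<in> F X. Y \<inter> hyp u e \<noteq> {}})" .
      also have "\<dots> \<le> 3 * 3 ^ h"
        by (rule bound) (use card_quadrants_hit[OF u] FZ u in \<open>auto simp: G_def line_partition_def\<close>)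
      finally show "card {Y \<in> F'. Y \<inter> hyp u e \<noteq> {}} \<le> 3 ^ Suc h" by simp
    qed
    ultimately show ?thesis by blast
  qed
  then show ?case by blast
qed

text \<open>Ordered pairs of distinct points are counted, and each lies on at most one line. Because
  \<open>X\<close> is part of \<open>Y\<close>, exactly one partner is excluded for each point,
  which is the \<open>- 1\<close>.\<close>

lemma card_same_line_pairs_le:
  fixes \<L> :: "'a set set"
  assumes fin: "finite \<L>" "finite X" "finite Y" and sub: "X \<subseteq> Y"
    and two: "\<And>l l' x y. l \<in> \<L> \<Longrightarrow> l' \<in> \<L> \<Longrightarrow> x \<in> l \<inter> l' \<Longrightarrow> y \<in> l \<inter> l' \<Longrightarrow> x \<noteq> y \<Longrightarrow> l = l'"
  shows "(\<Sum>l\<in>\<L>. card (X \<inter> l) * (card (Y \<inter> l) - 1)) \<le> card X * card Y"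
proof -
  define P where "P l = Sigma (X \<inter> l) (\<lambda>x. Y \<inter> l - {x})" for l
  have cP: "card (P l) = card (X \<inter> l) * (card (Y \<inter> l) - 1)" for l
  proof -
    have "card (P l) = (\<Sum>x\<in>X \<inter> l. card (Y \<inter> l - {x}))"
      unfolding P_def using fin by (intro card_SigmaI) auto
    also have "\<dots> = (\<Sum>x\<in>X \<inter> l. card (Y \<inter> l) - 1)"
      using fin sub by (intro sum.cong) auto
    finally show ?thesis by simp
  qed
  have "(\<Sum>l\<in>\<L>. card (P l)) = card (\<Union>l\<in>\<L>. P l)"
  proof (rule card_UN_disjoint[symmetric])
    show "\<forall>l\<in>\<L>. finite (P l)" using fin unfolding P_def by auto
    show "\<forall>l\<in>\<L>. \<forall>l'\<in>\<L>. l \<noteq> l' \<longrightarrow> P l \<inter> P l' = {}"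
      unfolding P_def using two by blast
  qed (rule fin)
  also have "\<dots> \<le> card (X \<times> Y)"
    by (rule card_mono) (use fin in \<open>auto simp: P_def\<close>)
  finally show ?thesis unfolding cP by (simp add: card_cartesian_product)
qed

text \<open>
  A line meets at most \<open>3 ^ h\<close> of the \<open>4 ^ h\<close> cells of an iterated quartering, so by Cauchy--Schwarz a constant
  proportion of the pairs on a rich line lie in a common cell, and there are few such pairs altogether.
\<close>

lemma rich_lines_bound:
  fixes h :: nat
  shows "\<exists>c::nat. \<forall>S M (\<L> :: complex set set). finite S \<longrightarrow> finite \<L> \<longrightarrow>
    (\<forall>u e. u \<noteq> 0 \<longrightarrow> card (S \<inter> hyp u e) \<le> M) \<longrightarrow>
    (\<forall>l\<in>\<L>. (\<exists>u e. u \<noteq> 0 \<and> l = hyp u e) \<and> card (S \<inter> l) \<ge> 4 * 3 ^ h) \<longrightarrow>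
    (\<Sum>l\<in>\<L>. real (card (S \<inter> l)) ^ 2) \<le> 2 * (3 / 4) ^ h * real (card S) ^ 2 + real c * real M * real (card S)"
proof -
  obtain c where c: "\<And>S M. finite S \<Longrightarrow> (\<forall>u e. u \<noteq> 0 \<longrightarrow> card (S \<inter> hyp u e) \<le> M) \<Longrightarrow>
    (\<exists>F Z. line_partition h S F Z \<and> card Z \<le> c * M)" using line_partition_exists[of h] by blast
  have "(\<Sum>l\<in>\<L>. real (card (S \<inter> l)) ^ 2) \<le> 2 * (3 / 4) ^ h * real (card S) ^ 2 + real (4 * c) * real M * real (card S)"
    if fin: "finite S" "finite \<L>" and M: "\<forall>u e. u \<noteq> 0 \<longrightarrow> card (S \<inter> hyp u e) \<le> M"
      and \<L>: "\<forall>l\<in>\<L>. (\<exists>u e. u \<noteq> 0 \<and> l = hyp u e) \<and> card (S \<inter> l) \<ge> 4 * 3 ^ h" for S M \<L>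
  proof -
    obtain F Z where FZ: "line_partition h S F Z" "card Z \<le> c * M" using c[OF fin(1) M] by blast
    have F: "finite F" "card F \<le> 4 ^ h" "Z \<subseteq> S" "S \<subseteq> Z \<union> \<Union>F"
      "\<And>X. X \<in> F \<Longrightarrow> X \<subseteq> S" "\<And>X. X \<in> F \<Longrightarrow> 4 ^ h * card X \<le> card S"
      "\<And>u e. u \<noteq> 0 \<Longrightarrow> card {X \<in> F. X \<inter> hyp u e \<noteq> {}} \<le> 3 ^ h"
      using FZ(1) unfolding line_partition_def by blast+
    have two: "l = l'" if "l \<in> \<L>" "l' \<in> \<L>" "x \<in> l \<inter> l'" "y \<in> l \<inter> l'" "x \<noteq> y" for l l' x y
      using \<L> that hyp_eqI by (metis Int_iff)
    have finX: "finite X" if "X \<in> F" for X using F(5)[OF that] fin finite_subset by blast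
    define n where "n = real (card S)"
    have single: "real (card (S \<inter> l)) ^ 2 \<le>
        2 * 3 ^ h * (\<Sum>X\<in>F. real (card (X \<inter> l) * (card (X \<inter> l) - 1))) + 4 * real (card (Z \<inter> l) * (card (S \<inter> l) - 1))"
      if l: "l \<in> \<L>" for l
    proof -
      define \<rho> where "\<rho> = real (card (S \<inter> l))"
      define \<zeta> where "\<zeta> = real (card (Z \<inter> l))"
      define \<tau> where "\<tau> = (\<Sum>X\<in>F. real (card (X \<inter> l)))"
      define \<sigma> where "\<sigma> = (\<Sum>X\<in>F. real (card (X \<inter> l) * (card (X \<inter> l) - 1)))"
      define k where "k = (3::real) ^ h"
      have k1: "k \<ge> 1" by (simp add: k_def)
      \<comment> \<open>The threshold serves the case where \<open>Z\<close> holds less than half of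
        the line: then \<open>\<tau> >= 2 * k\<close>, and the diagonal term
        \<open>k * \<tau>\<close> is at most half of the square of \<open>\<tau>\<close>.\<close>
      have big: "\<rho> \<ge> 4 * k"
      proof -
        have "4 * 3 ^ h \<le> card (S \<inter> l)" using \<L> l by blast
        then have "real (4 * 3 ^ h) \<le> \<rho>" unfolding \<rho>_def by (simp only: of_nat_le_iff)
        then show ?thesis by (simp add: k_def)
      qed
      have \<sigma>0: "\<sigma> \<ge> 0" unfolding \<sigma>_def by (intro sum_nonneg) simp
      have \<zeta>0: "\<zeta> \<ge> 0" "\<tau> \<ge> 0" unfolding \<zeta>_def \<tau>_def by (auto intro: sum_nonneg)
      have "card (S \<inter> l) \<le> card ((Z \<inter> l) \<union> (\<Union>X\<in>F. X \<inter> l))"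
        using F fin finX by (intro card_mono) (auto intro: finite_subset)
      also have "\<dots> \<le> card (Z \<inter> l) + card (\<Union>X\<in>F. X \<inter> l)" by (rule card_Un_le)
      also have "\<dots> \<le> card (Z \<inter> l) + (\<Sum>X\<in>F. card (X \<inter> l))" by (intro add_left_mono card_UN_le F(1))
      finally have "real (card (S \<inter> l)) \<le> real (card (Z \<inter> l) + (\<Sum>X\<in>F. card (X \<inter> l)))" by (simp only: of_nat_le_iff)
      then have cover: "\<rho> \<le> \<zeta> + \<tau>" unfolding \<rho>_def \<zeta>_def \<tau>_def by simp
      have "\<zeta> * \<rho> \<le> 2 * real (card (Z \<inter> l) * (card (S \<inter> l) - 1))"
      proof -
        have "card (S \<inter> l) \<ge> 2" using big k1 unfolding \<rho>_def by linarith
        then have "\<rho> \<le> 2 * real (card (S \<inter> l) - 1)" unfolding \<rho>_def by simp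
        then have "\<zeta> * \<rho> \<le> \<zeta> * (2 * real (card (S \<inter> l) - 1))" using \<zeta>0 by (intro mult_left_mono)
        then show ?thesis unfolding \<zeta>_def by simp
      qed
      \<comment> \<open>Either half of the points of the line lie in \<open>Z\<close>, or
        Cauchy--Schwarz over the at most \<open>k\<close> cells that it meets applies.\<close>
      moreover have "\<rho>\<^sup>2 \<le> 2 * k * \<sigma> + 2 * (\<zeta> * \<rho>)"
      proof (cases "\<zeta> \<ge> \<rho> / 2")
        case True
        have "\<rho> * \<rho> \<le> (2 * \<zeta>) * \<rho>" using True big k1 by (intro mult_right_mono) auto
        moreover have "2 * k * \<sigma> \<ge> 0" using k1 \<sigma>0 by simp
        ultimately show ?thesis unfolding power2_eq_square mult.assoc by linarith
      next
        case False
        then have \<tau>2: "\<tau> \<ge> 2 * k" using cover big by linarith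
        let ?H = "{X \<in> F. X \<inter> l \<noteq> {}}"
        have cH: "real (card ?H) \<le> k"
        proof -
          obtain u e where ue: "u \<noteq> 0" "l = hyp u e" using \<L> l by blast
          have "card ?H \<le> 3 ^ h" using F(7)[OF ue(1), of e] ue(2) by simp
          then have "real (card ?H) \<le> real (3 ^ h)" by (simp only: of_nat_le_iff)
          then show ?thesis by (simp add: k_def)
        qed
        have \<tau>H: "\<tau> = (\<Sum>X\<in>?H. real (card (X \<inter> l)))"
          unfolding \<tau>_def using F(1) by (intro sum.mono_neutral_right) auto
        have "(\<Sum>X\<in>?H. real (card (X \<inter> l)))\<^sup>2 \<le> (\<Sum>X\<in>?H. (1::real)\<^sup>2) * (\<Sum>X\<in>?H. (real (card (X \<inter> l)))\<^sup>2)"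
          using Cauchy_Schwarz_ineq_sum[of "\<lambda>_. 1::real" "\<lambda>X. real (card (X \<inter> l))" ?H] by simp
        then have "\<tau>\<^sup>2 \<le> real (card ?H) * (\<Sum>X\<in>?H. (real (card (X \<inter> l)))\<^sup>2)" unfolding \<tau>H by simp
        also have "\<dots> \<le> k * (\<Sum>X\<in>?H. (real (card (X \<inter> l)))\<^sup>2)"
          using cH by (intro mult_right_mono sum_nonneg) auto
        also have "(\<Sum>X\<in>?H. (real (card (X \<inter> l)))\<^sup>2) = (\<Sum>X\<in>F. (real (card (X \<inter> l)))\<^sup>2)"
          using F(1) by (intro sum.mono_neutral_left) auto
        also have "\<dots> = (\<Sum>X\<in>F. real (card (X \<inter> l) * (card (X \<inter> l) - 1)) + real (card (X \<inter> l)))"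
        proof (intro sum.cong refl)
          fix X
          show "(real (card (X \<inter> l)))\<^sup>2 = real (card (X \<inter> l) * (card (X \<inter> l) - 1)) + real (card (X \<inter> l))"
            by (cases "card (X \<inter> l)") (auto simp: power2_eq_square algebra_simps)
        qed
        also have "\<dots> = \<sigma> + \<tau>" unfolding \<sigma>_def \<tau>_def by (simp only: sum.distrib)
        finally have "\<tau>\<^sup>2 \<le> k * \<sigma> + k * \<tau>" by (simp add: algebra_simps)
        moreover have "2 * k * \<tau> \<le> \<tau> * \<tau>" using \<tau>2 \<zeta>0 by (intro mult_right_mono) auto
        ultimately have \<tau>sq: "\<tau>\<^sup>2 \<le> 2 * k * \<sigma>" by (simp add: power2_eq_square)
        have "(\<rho> - \<zeta>)\<^sup>2 \<le> \<tau>\<^sup>2" using cover False big k1 by (intro power_mono) linarith+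
        then have "\<rho>\<^sup>2 \<le> \<tau>\<^sup>2 + 2 * (\<zeta> * \<rho>) - \<zeta>\<^sup>2" by (simp add: power2_diff algebra_simps)
        moreover have "\<zeta>\<^sup>2 \<ge> 0" by simp
        ultimately show ?thesis using \<tau>sq by linarith
      qed
      ultimately show ?thesis unfolding \<rho>_def \<sigma>_def k_def by linarith
    qed
    have "(\<Sum>l\<in>\<L>. real (card (S \<inter> l)) ^ 2) \<le> (\<Sum>l\<in>\<L>.
        2 * 3 ^ h * (\<Sum>X\<in>F. real (card (X \<inter> l) * (card (X \<inter> l) - 1))) + 4 * real (card (Z \<inter> l) * (card (S \<inter> l) - 1)))"
      by (intro sum_mono single)
    also have "\<dots> = 2 * 3 ^ h * (\<Sum>X\<in>F. real (\<Sum>l\<in>\<L>. card (X \<inter> l) * (card (X \<inter> l) - 1)))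
        + 4 * real (\<Sum>l\<in>\<L>. card (Z \<inter> l) * (card (S \<inter> l) - 1))"
      unfolding sum.distrib sum_distrib_left[symmetric] of_nat_sum
      by (subst sum.swap) (rule refl)
    \<comment> \<open>A cell has at most \<open>n / 4 ^ h\<close> points and there are at most
      \<open>4 ^ h\<close> cells; this turns the factor \<open>3 ^ h\<close> into
      \<open>(3 / 4) ^ h\<close>.\<close>
    also have "\<dots> \<le> 2 * 3 ^ h * (\<Sum>X\<in>F. (n / 4 ^ h)\<^sup>2) + 4 * real (c * M * card S)"
    proof (intro add_mono mult_left_mono sum_mono)
      fix X assume X: "X \<in> F"
      have "(\<Sum>l\<in>\<L>. card (X \<inter> l) * (card (X \<inter> l) - 1)) \<le> card X * card X"
        by (rule card_same_line_pairs_le[OF fin(2) finX[OF X] finX[OF X] order_refl two])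
      then have "real (\<Sum>l\<in>\<L>. card (X \<inter> l) * (card (X \<inter> l) - 1)) \<le> (real (card X))\<^sup>2"
        unfolding power2_eq_square of_nat_mult[symmetric] of_nat_le_iff .
      also have "\<dots> \<le> (n / 4 ^ h)\<^sup>2"
      proof (intro power_mono)
        have "real (4 ^ h * card X) \<le> n" unfolding n_def using F(6)[OF X] by (simp only: of_nat_le_iff)
        then show "real (card X) \<le> n / 4 ^ h" by (simp add: field_simps)
      qed simp
      finally show "real (\<Sum>l\<in>\<L>. card (X \<inter> l) * (card (X \<inter> l) - 1)) \<le> (n / 4 ^ h)\<^sup>2" .
    next
      have "(\<Sum>l\<in>\<L>. card (Z \<inter> l) * (card (S \<inter> l) - 1)) \<le> card Z * card S"
        by (rule card_same_line_pairs_le[OF fin(2) finite_subset[OF F(3) fin(1)] fin(1) F(3) two])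
      also have "\<dots> \<le> c * M * card S" using FZ(2) by (rule mult_le_mono1)
      finally show "real (\<Sum>l\<in>\<L>. card (Z \<inter> l) * (card (S \<inter> l) - 1)) \<le> real (c * M * card S)"
        by (simp only: of_nat_le_iff)
    qed auto
    also have "(\<Sum>X\<in>F. (n / 4 ^ h)\<^sup>2) \<le> 4 ^ h * (n / 4 ^ h)\<^sup>2"
    proof -
      have "real (card F) \<le> real (4 ^ h)" using F(2) by (simp only: of_nat_le_iff)
      then have "real (card F) * (n / 4 ^ h)\<^sup>2 \<le> 4 ^ h * (n / 4 ^ h)\<^sup>2" by (intro mult_right_mono) auto
      then show ?thesis by simp
    qed
    also have "2 * 3 ^ h * (4 ^ h * (n / 4 ^ h)\<^sup>2) = 2 * (3 / 4) ^ h * n\<^sup>2"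
      by (simp add: power_divide power2_eq_square)
    finally show ?thesis unfolding n_def by (simp add: mult.assoc)
  qed
  then show ?thesis by blast
qed

section \<open>Partitions adapted to isometries\<close>

text \<open>
  Think of \<open>idx k y\<close> as the dyadic square of level \<open>k\<close> containing \<open>y\<close>, larger \<open>k\<close> being finer. A cell \<open>(C, k)\<close> is a set
  inside one square of level \<open>k\<close>; it may be a square with a smaller square removed. Separation says that a
  square contained in the outer squares of two cells cannot meet both cells.
\<close>

definition cells_separated :: "(nat \<Rightarrow> 'a \<Rightarrow> 'b) \<Rightarrow> ('a set \<times> nat) set \<Rightarrow> bool"
  where "cells_separated idx \<C> \<longleftrightarrow>
    (\<forall>c\<in>\<C>. \<forall>d\<in>\<C>. c \<noteq> d \<longrightarrow> (\<forall>y\<in>fst c. \<forall>z\<in>fst d. idx (max (snd c) (snd d)) y \<noteq> idx (max (snd c) (snd d)) z))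
    \<and> (\<forall>c\<in>\<C>. \<forall>y\<in>fst c. \<forall>z\<in>fst c. idx (snd c) y = idx (snd c) z)"

text \<open>One recursion step of the quadtree: \<open>f p\<close> and \<open>n p\<close> are the
  numbers of cells and points of a child. The new cell, the slack 3 and four children with one cell
  each cost \<open>8 * x\<close>; each child with more cells repays \<open>4 * x\<close>. If there
  is just one of these, \<open>n p <= N - x\<close> closes the gap.\<close>

lemma cell_count_arith:
  fixes f n :: "'c \<Rightarrow> real"
  assumes P: "finite P" "card P \<le> 4" and x: "x > 0" and N: "N > 2 * x"
    and f: "\<And>p. p \<in> P \<Longrightarrow> f p \<le> 1 \<or> x * (f p + 3) \<le> 4 * n p"
    and n: "\<And>p. p \<in> P \<Longrightarrow> 0 \<le> n p" "\<And>p. p \<in> P \<Longrightarrow> n p \<le> N - x" "sum n P \<le> N"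
  shows "x * (1 + sum f P + 3) \<le> 4 * N"
proof -
  define G where "G = {p \<in> P. \<not> f p \<le> 1}"
  have G: "finite G" "G \<subseteq> P" using P by (auto simp: G_def)
  define b where "b = real (card G)"
  have cards: "real (card (P - G)) \<le> 4 - b"
  proof -
    have "card P = card G + card (P - G)" using P G by (metis card_Diff_subset card_mono le_add_diff_inverse)
    then show ?thesis using P(2) unfolding b_def by linarith
  qed
  have sP: "sum f P = sum f G + sum f (P - G)" using G P by (metis add.commute sum.subset_diff)
  have "sum f (P - G) \<le> (\<Sum>p\<in>P - G. 1)" by (intro sum_mono) (auto simp: G_def)
  then have 1: "sum f (P - G) \<le> 4 - b" using cards by simp
  have "(\<Sum>p\<in>G. x * (f p + 3)) \<le> (\<Sum>p\<in>G. 4 * n p)"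
    by (intro sum_mono) (use f in \<open>auto simp: G_def\<close>)
  then have 2: "x * sum f G + 3 * x * b \<le> 4 * sum n G"
    unfolding distrib_left sum.distrib sum_distrib_left[symmetric] by (simp add: b_def mult.commute mult.left_commute)
  have nG: "sum n G \<le> N" using sum_mono2[OF P(1) G(2), of n] n by force
  have "x * sum f (P - G) \<le> x * (4 - b)" using 1 x by simp
  then have 3: "x * (1 + sum f P + 3) \<le> 8 * x - 4 * x * b + 4 * sum n G"
    using 2 unfolding sP by (simp add: algebra_simps)
  consider "card G = 0" | "card G = 1" | "card G \<ge> 2" by linarith
  then show ?thesis
  proof cases
    case 1
    then have "G = {}" "b = 0" using G by (auto simp: b_def)
    then show ?thesis using 3 N by simp
  next
    case 2
    then obtain p where "G = {p}" by (meson card_1_singletonE)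
    then have "sum n G \<le> N - x" "b = 1" using n(2) G by (auto simp: b_def)
    then show ?thesis using 3 by (simp add: algebra_simps)
  next
    case 3
    then have "b \<ge> 2" by (simp add: b_def)
    then have "x * 2 \<le> x * b" using x by simp
    then show ?thesis using \<open>x * (1 + sum f P + 3) \<le> 8 * x - 4 * x * b + 4 * sum n G\<close> nG
      by (simp add: algebra_simps)
  qed
qed

locale hierarchy =
  fixes idx :: "nat \<Rightarrow> 'a \<Rightarrow> 'b"
  assumes refine1: "idx (Suc k) y = idx (Suc k) z \<Longrightarrow> idx k y = idx k z"
    and four: "(\<And>y z. y \<in> S \<Longrightarrow> z \<in> S \<Longrightarrow> idx k y = idx k z) \<Longrightarrow> finite S \<Longrightarrow> card (idx (Suc k) ` S) \<le> 4"
    and separates: "y \<noteq> z \<Longrightarrow> \<exists>k. idx k y \<noteq> idx k z"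
begin

lemma refine: "idx k y = idx k z \<Longrightarrow> j \<le> k \<Longrightarrow> idx j y = idx j z"
  by (induction k rule: nat_induct) (auto simp: le_Suc_eq dest: refine1)

lemma eventually_inj:
  assumes "finite S"
  shows "\<exists>k. inj_on (idx k) S"
proof -
  obtain f where f: "\<And>y z. y \<noteq> z \<Longrightarrow> idx (f y z) y \<noteq> idx (f y z) z" using separates by metis
  define k where "k = Max ((\<lambda>(y, z). f y z) ` (S \<times> S))"
  have "inj_on (idx k) S"
  proof (rule inj_onI, rule ccontr)
    fix y z assume yz: "y \<in> S" "z \<in> S" "idx k y = idx k z" "y \<noteq> z"
    have "f y z \<le> k" unfolding k_def by (rule Max_ge) (use assms yz in force)+
    then show False using refine[OF yz(3)] f[OF yz(4)] by blast
  qed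
  then show ?thesis ..
qed

text \<open>A plain quadtree may descend many levels without splitting off points. So the descent
  jumps to the deepest square \<open>Q\<close> that still holds all but fewer than \<open>x\<close>
  points: the rest becomes one cell, and the children of \<open>Q\<close>, each missing at least
  \<open>x\<close> points, are treated recursively.\<close>

lemma cells_exist:
  assumes "finite S" "\<And>y z. y \<in> S \<Longrightarrow> z \<in> S \<Longrightarrow> idx k y = idx k z" "x \<ge> (1::nat)"
  shows "\<exists>\<C>. finite \<C> \<and> (\<Union>c\<in>\<C>. fst c) = S \<and> (\<forall>c\<in>\<C>. card (fst c) \<le> 2 * x \<and> snd c \<ge> k) \<and>
    cells_separated idx \<C> \<and> (card \<C> \<le> 1 \<or> x * (card \<C> + 3) \<le> 4 * card S)"
  using assms
proof (induction "card S" arbitrary: S k rule: less_induct)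
  case less
  note finS = less.prems(1) and same = less.prems(2) and x = less.prems(3)
  define n where "n = card S"
  show ?case
  proof (cases "n \<le> 2 * x")
    case True
    moreover have "cells_separated idx {(S, k)}" unfolding cells_separated_def by (auto intro: same)
    ultimately show ?thesis by (intro exI[of _ "{(S, k)}"]) (simp add: n_def)
  next
    case False
    \<comment> \<open>The levels at which some square misses fewer than \<open>x\<close> points of
      \<open>S\<close>. Level \<open>k\<close> is one; no level on which \<open>idx\<close> is
      injective is, since \<open>n - x >= 1\<close>.\<close>
    define K where "K = {j. j \<ge> k \<and> (\<exists>q. card {y \<in> S. idx j y = q} > n - x)}"
    have "n > 0" using False by simp
    then obtain y0 where y0: "y0 \<in> S" unfolding n_def by (metis card_gt_0_iff ex_in_conv)
    have "{y \<in> S. idx k y = idx k y0} = S" using same y0 by blast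
    then have "card {y \<in> S. idx k y = idx k y0} > n - x" using x \<open>n > 0\<close> by (simp add: n_def)
    then have kK: "k \<in> K" unfolding K_def by blast
    obtain k1 where k1: "inj_on (idx k1) S" using eventually_inj[OF finS] by blast
    have Kb: "j < k1" if "j \<in> K" for j
    proof (rule ccontr)
      assume "\<not> j < k1"
      then have inj: "inj_on (idx j) S" using k1 refine unfolding inj_on_def by (meson not_less)
      obtain q where q: "card {y \<in> S. idx j y = q} > n - x" using \<open>j \<in> K\<close> unfolding K_def by blast
      have "card {y \<in> S. idx j y = q} \<le> 1"
        using inj finS unfolding inj_on_def by (auto simp: card_le_Suc0_iff_eq)
      then show False using q False x by simp
    qed
    have finK: "finite K" using Kb by (intro finite_subset[of K "{..<k1}"]) auto
    define m where "m = Max K"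
    have mK: "m \<in> K" unfolding m_def using finK kK by (intro Max_in) auto
    \<comment> \<open>Maximality of \<open>m\<close> guarantees that every child misses at least
      \<open>x\<close> points.\<close>
    have top: "card {y \<in> S. idx (Suc m) y = q} \<le> n - x" for q
    proof (rule ccontr)
      assume "\<not> ?thesis"
      then have "n - x < card {y \<in> S. idx (Suc m) y = q}" by simp
      moreover have "k \<le> Suc m" using mK by (simp add: K_def)
      ultimately have "Suc m \<in> K" unfolding K_def by blast
      then show False using Max_ge[OF finK, of "Suc m"] unfolding m_def by simp
    qed
    have km: "k \<le> m" using mK by (simp add: K_def)
    obtain q where q: "card {y \<in> S. idx m y = q} > n - x" using mK unfolding K_def by blast
    define Q where "Q = {y \<in> S. idx m y = q}"
    have QS: "Q \<subseteq> S" by (auto simp: Q_def)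
    have finQ: "finite Q" using finS QS finite_subset by blast
    define P where "P = idx (Suc m) ` Q"
    have finP: "finite P" using finQ by (simp add: P_def)
    have P4: "card P \<le> 4" unfolding P_def by (rule four) (auto simp: Q_def finS)
    define Sp where "Sp p = {y \<in> Q. idx (Suc m) y = p}" for p
    have SpS: "card (Sp p) \<le> n - x" for p
    proof -
      have "card (Sp p) \<le> card {y \<in> S. idx (Suc m) y = p}"
        using finS by (intro card_mono) (auto simp: Sp_def Q_def)
      then show ?thesis using top order_trans by blast
    qed
    have "\<exists>\<C>. finite \<C> \<and> (\<Union>c\<in>\<C>. fst c) = Sp p \<and> (\<forall>c\<in>\<C>. card (fst c) \<le> 2 * x \<and> snd c \<ge> Suc m) \<and>
      cells_separated idx \<C> \<and> (card \<C> \<le> 1 \<or> x * (card \<C> + 3) \<le> 4 * card (Sp p))" for p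
    proof (rule less.hyps)
      show "card (Sp p) < card S" using SpS[of p] False x unfolding n_def by linarith
    qed (use finQ x in \<open>auto simp: Sp_def\<close>)
    then obtain \<D> where \<D>: "\<And>p. finite (\<D> p)" "\<And>p. (\<Union>c\<in>\<D> p. fst c) = Sp p"
      "\<And>p c. c \<in> \<D> p \<Longrightarrow> card (fst c) \<le> 2 * x" "\<And>p c. c \<in> \<D> p \<Longrightarrow> snd c \<ge> Suc m" "\<And>p. cells_separated idx (\<D> p)"
      "\<And>p. card (\<D> p) \<le> 1 \<or> x * (card (\<D> p) + 3) \<le> 4 * card (Sp p)" by metis
    \<comment> \<open>The remainder \<open>S - Q\<close> keeps the level \<open>k\<close> of its
      outer square; it has fewer than \<open>x\<close> points.\<close>
    define \<C> where "\<C> = insert (S - Q, k) (\<Union>p\<in>P. \<D> p)"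
    have "finite \<C>" unfolding \<C>_def using finP \<D>(1) by auto
    moreover have "(\<Union>c\<in>\<C>. fst c) = S"
    proof -
      have "(\<Union>c\<in>\<C>. fst c) = (S - Q) \<union> (\<Union>p\<in>P. \<Union>c\<in>\<D> p. fst c)" unfolding \<C>_def by auto
      also have "\<dots> = (S - Q) \<union> Q" unfolding \<D>(2) by (auto simp: Sp_def P_def)
      finally show ?thesis using QS by blast
    qed
    moreover have "card (fst c) \<le> 2 * x \<and> snd c \<ge> k" if c: "c \<in> \<C>" for c
    proof -
      have SQ: "card (S - Q) \<le> 2 * x" using q finS QS finQ unfolding Q_def[symmetric] n_def by (simp add: card_Diff_subset)
      consider "c = (S - Q, k)" | p where "c \<in> \<D> p" using c unfolding \<C>_def by blast
      then show ?thesis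
      proof cases
        case 2 then show ?thesis using \<D>(3)[OF 2] \<D>(4)[OF 2] km by simp
      qed (use SQ in auto)
    qed
    moreover have "cells_separated idx \<C>"
    proof -
      have inD: "y \<in> Q \<and> idx (Suc m) y = p" if "c \<in> \<D> p" "y \<in> fst c" for c p y
        using \<D>(2)[of p] that unfolding Sp_def by blast
      have new: "idx j y \<noteq> idx j z" if "y \<in> S - Q" "c \<in> \<D> p" "z \<in> fst c" "j \<ge> Suc m" for y z c p j
      proof
        assume "idx j y = idx j z"
        then have "idx m y = idx m z" by (rule refine) (use that(4) in simp)
        moreover have "z \<in> Q" using inD[OF that(2,3)] by blast
        ultimately show False using that(1) by (simp add: Q_def)
      qed
      have old: "idx (max (snd c) (snd d)) y \<noteq> idx (max (snd c) (snd d)) z"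
        if "c \<in> \<D> p" "d \<in> \<D> p'" "c \<noteq> d" "y \<in> fst c" "z \<in> fst d" for c d p p' y z
      proof (cases "p = p'")
        case True
        then show ?thesis using \<D>(5)[of p] that unfolding cells_separated_def by blast
      next
        case False
        show ?thesis
        proof
          assume "idx (max (snd c) (snd d)) y = idx (max (snd c) (snd d)) z"
          moreover have "Suc m \<le> max (snd c) (snd d)" using \<D>(4)[OF that(1)] by simp
          ultimately have "idx (Suc m) y = idx (Suc m) z" by (rule refine)
          then show False using inD[OF that(1,4)] inD[OF that(2,5)] False by simp
        qed
      qed
      show ?thesis
        unfolding cells_separated_def
      proof (intro conjI ballI impI)
        fix c d y z assume cd: "c \<in> \<C>" "d \<in> \<C>" "c \<noteq> d" "y \<in> fst c" "z \<in> fst d"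
        consider "c = (S - Q, k)" "\<exists>p. d \<in> \<D> p" | "d = (S - Q, k)" "\<exists>p. c \<in> \<D> p" | "\<exists>p. c \<in> \<D> p" "\<exists>p. d \<in> \<D> p"
          using cd(1-3) unfolding \<C>_def by blast
        then show "idx (max (snd c) (snd d)) y \<noteq> idx (max (snd c) (snd d)) z"
        proof cases
          case 1
          then obtain p where p: "d \<in> \<D> p" by blast
          show ?thesis using new[of y d p z] p 1(1) cd(4,5) \<D>(4)[OF p] by (simp add: le_max_iff_disj)
        next
          case 2
          then obtain p where p: "c \<in> \<D> p" by blast
          show ?thesis using new[of z c p y] p 2(1) cd(4,5) \<D>(4)[OF p] by (metis fst_conv le_max_iff_disj)
        next
          case 3
          then obtain p p' where "c \<in> \<D> p" "d \<in> \<D> p'" by blast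
          then show ?thesis using old cd(3-5) by blast
        qed
      next
        fix c y z assume "c \<in> \<C>" "y \<in> fst c" "z \<in> fst c"
        then consider "c = (S - Q, k)" | "\<exists>p. c \<in> \<D> p" unfolding \<C>_def by blast
        then show "idx (snd c) y = idx (snd c) z"
        proof cases
          case 1 then show ?thesis using same[of y z] \<open>y \<in> fst c\<close> \<open>z \<in> fst c\<close> by simp
        next
          case 2 then show ?thesis using \<D>(5) \<open>y \<in> fst c\<close> \<open>z \<in> fst c\<close> unfolding cells_separated_def by blast
        qed
      qed
    qed
    moreover have "x * (card \<C> + 3) \<le> 4 * card S"
    proof -
      have "card \<C> \<le> 1 + card (\<Union>p\<in>P. \<D> p)" unfolding \<C>_def
        using card_insert_le_m1 by (simp add: card_insert_if finP \<D>(1))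
      also have "\<dots> \<le> 1 + (\<Sum>p\<in>P. card (\<D> p))" using card_UN_le[OF finP] by simp
      finally have cC: "real (card \<C>) \<le> 1 + (\<Sum>p\<in>P. real (card (\<D> p)))" by (metis of_nat_1 of_nat_add of_nat_mono of_nat_sum)
      have "(\<Sum>p\<in>P. card (Sp p)) = card (\<Union>p\<in>P. Sp p)"
        by (rule card_UN_disjoint[symmetric]) (use finP finQ in \<open>auto simp: Sp_def\<close>)
      also have "\<dots> \<le> n" unfolding n_def using QS finS by (intro card_mono) (auto simp: Sp_def)
      finally have sumn: "(\<Sum>p\<in>P. real (card (Sp p))) \<le> real n" by (metis of_nat_mono of_nat_sum)
      have "real x * (1 + (\<Sum>p\<in>P. real (card (\<D> p))) + 3) \<le> 4 * real n"
      proof (rule cell_count_arith[OF finP P4 _ _ _ _ _ sumn])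
        fix p assume "p \<in> P"
        show "real (card (\<D> p)) \<le> 1 \<or> real x * (real (card (\<D> p)) + 3) \<le> 4 * real (card (Sp p))"
        proof -
          have "x * (card (\<D> p) + 3) \<le> 4 * card (Sp p) \<Longrightarrow> real (x * (card (\<D> p) + 3)) \<le> real (4 * card (Sp p))"
            by (simp only: of_nat_le_iff)
          then show ?thesis using \<D>(6)[of p] by auto
        qed
        show "real (card (Sp p)) \<le> real n - real x" using SpS[of p] False by linarith
      qed (use x False in auto)
      moreover have "real x * (real (card \<C>) + 3) \<le> real x * (1 + (\<Sum>p\<in>P. real (card (\<D> p))) + 3)"
        using cC by (intro mult_left_mono) auto
      ultimately have "real (x * (card \<C> + 3)) \<le> real (4 * n)" by simp
      then show ?thesis unfolding n_def of_nat_le_iff .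
    qed
    ultimately show ?thesis by blast
  qed
qed

end

text \<open>The index of the half-open square of side \<open>r / 2 ^ k\<close> that contains
  \<open>y\<close>, in the grid with a corner at \<open>org\<close>.\<close>

definition grid :: "complex \<Rightarrow> real \<Rightarrow> nat \<Rightarrow> complex \<Rightarrow> int \<times> int"
  where "grid org r k y = (\<lfloor>Re (y - org) / r * 2 ^ k\<rfloor>, \<lfloor>Im (y - org) / r * 2 ^ k\<rfloor>)"

lemma floor_half: "\<lfloor>t\<rfloor> = \<lfloor>2 * t\<rfloor> div 2" for t :: real
  using floor_divide_real_eq_div[of 2 "2 * t"] by simp

lemma floor_double: "\<lfloor>2 * t\<rfloor> \<in> {2 * \<lfloor>t\<rfloor>, 2 * \<lfloor>t\<rfloor> + 1}" for t :: real
  unfolding floor_half[of t] by auto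

lemma grid_Suc: "grid org r (Suc k) y = (\<lfloor>2 * (Re (y - org) / r * 2 ^ k)\<rfloor>, \<lfloor>2 * (Im (y - org) / r * 2 ^ k)\<rfloor>)"
  unfolding grid_def by (simp add: mult.commute mult.left_commute)

lemma floors_eventually_differ:
  fixes s t :: real
  assumes "s \<noteq> t"
  shows "\<exists>k. \<lfloor>s * 2 ^ k\<rfloor> \<noteq> \<lfloor>t * 2 ^ k\<rfloor>"
proof -
  obtain k where k: "1 / \<bar>s - t\<bar> < 2 ^ k" using real_arch_pow[of 2 "1 / \<bar>s - t\<bar>"] by auto
  have "1 < \<bar>s - t\<bar> * 2 ^ k" using k assms by (simp add: field_simps)
  also have "\<dots> = \<bar>s * 2 ^ k - t * 2 ^ k\<bar>" by (simp add: abs_mult flip: left_diff_distrib)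
  finally have "1 < \<bar>s * 2 ^ k - t * 2 ^ k\<bar>" .
  then have "\<lfloor>s * 2 ^ k\<rfloor> \<noteq> \<lfloor>t * 2 ^ k\<rfloor>" by linarith
  then show ?thesis by blast
qed

lemma hierarchy_grid:
  assumes "r > 0"
  shows "hierarchy (grid org r)"
proof
  show "grid org r k y = grid org r k z" if "grid org r (Suc k) y = grid org r (Suc k) z" for k y z
    using that unfolding grid_Suc unfolding grid_def floor_half[of "_ / _ * _"] by simp
  show "\<exists>k. grid org r k y \<noteq> grid org r k z" if "y \<noteq> z" for y z
  proof (cases "Re y = Re z")
    case True
    then have "Im (y - org) / r \<noteq> Im (z - org) / r" using that assms by (simp add: complex_eq_iff)
    from floors_eventually_differ[OF this] show ?thesis unfolding grid_def by auto
  next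
    case False
    then have "Re (y - org) / r \<noteq> Re (z - org) / r" using assms by simp
    from floors_eventually_differ[OF this] show ?thesis unfolding grid_def by auto
  qed
  fix S :: "complex set" and k
  assume same: "\<And>y z. y \<in> S \<Longrightarrow> z \<in> S \<Longrightarrow> grid org r k y = grid org r k z" and "finite S"
  show "card (grid org r (Suc k) ` S) \<le> 4"
  proof (cases "S = {}")
    case False
    then obtain y where y: "y \<in> S" by blast
    define a where "a = fst (grid org r k y)"
    define b where "b = snd (grid org r k y)"
    have "grid org r (Suc k) z \<in> {2 * a, 2 * a + 1} \<times> {2 * b, 2 * b + 1}" if "z \<in> S" for z
      using floor_double[of "Re (z - org) / r * 2 ^ k"] floor_double[of "Im (z - org) / r * 2 ^ k"]
        same[OF y that] unfolding grid_Suc a_def b_def by (auto simp: grid_def)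
    then have "grid org r (Suc k) ` S \<subseteq> {2 * a, 2 * a + 1} \<times> {2 * b, 2 * b + 1}" by blast
    then have "card (grid org r (Suc k) ` S) \<le> card ({2 * a, 2 * a + 1} \<times> {2 * b, 2 * b + 1})"
      by (intro card_mono) auto
    then show ?thesis by (simp add: card_cartesian_product)
  qed simp
qed

text \<open>In units of the side length, points of one square are less than 2 apart, crudely by
  adding the coordinates. Coordinates of the images then differ by less than 2 and their floors by
  at most 2, which leaves 25 squares.\<close>

lemma grid_close:
  assumes r: "r > 0" and same: "grid org r k y = grid org r k y'" and d: "dist y y' = dist w w'"
  shows "grid org r k w' \<in> {fst (grid org r k w) - 2..fst (grid org r k w) + 2} \<times> {snd (grid org r k w) - 2..snd (grid org r k w) + 2}"
proof -
  define q where "q = 2 ^ k / r"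
  have q: "q > 0" using r by (simp add: q_def)
  have sc: "Re z / r * 2 ^ k = Re z * q" "Im z / r * 2 ^ k = Im z * q" for z by (simp_all add: q_def)
  have "\<bar>Re (y - org) * q - Re (y' - org) * q\<bar> < 1" "\<bar>Im (y - org) * q - Im (y' - org) * q\<bar> < 1"
    using same unfolding grid_def sc by (simp_all) linarith+
  moreover have df: "Re (z - org) * q - Re (z' - org) * q = Re (z - z') * q"
    "Im (z - org) * q - Im (z' - org) * q = Im (z - z') * q" for z z' by (simp_all add: algebra_simps)
  ultimately have "\<bar>Re (y - y')\<bar> * q < 1" "\<bar>Im (y - y')\<bar> * q < 1"
    unfolding df using q by (simp_all only: abs_mult abs_of_pos)
  then have "(\<bar>Re (y - y')\<bar> + \<bar>Im (y - y')\<bar>) * q < 2" by (simp add: distrib_right)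
  moreover have "cmod (y - y') * q \<le> (\<bar>Re (y - y')\<bar> + \<bar>Im (y - y')\<bar>) * q"
    using q by (intro mult_right_mono cmod_le) simp
  ultimately have c: "cmod (w - w') * q < 2" using d by (simp add: dist_norm)
  have "\<bar>Re (w - w')\<bar> * q \<le> cmod (w - w') * q" "\<bar>Im (w - w')\<bar> * q \<le> cmod (w - w') * q"
    using q by (intro mult_right_mono abs_Re_le_cmod abs_Im_le_cmod; simp)+
  then have "\<bar>Re (w - w') * q\<bar> < 2" "\<bar>Im (w - w') * q\<bar> < 2"
    using c q by (simp_all only: abs_mult abs_of_pos)
  then have "\<bar>Re (w - org) * q - Re (w' - org) * q\<bar> < 2" "\<bar>Im (w - org) * q - Im (w' - org) * q\<bar> < 2"
    unfolding df .
  then show ?thesis unfolding grid_def sc mem_Times_iff fst_conv snd_conv atLeastAtMost_iff by linarith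
qed

text \<open>A partial isometry given by its graph, so that passing to the converse exchanges the
  roles of source and target.\<close>

definition isometric :: "(complex \<times> complex) set \<Rightarrow> bool"
  where "isometric G \<longleftrightarrow> (\<forall>g\<in>G. \<forall>h\<in>G. dist (fst g) (fst h) = dist (snd g) (snd h))"

text \<open>
  The image of a cell of level \<open>k\<close> meets boundedly many squares of level \<open>k\<close>, and each of these squares meets at
  most one cell that is not finer.
\<close>

lemma card_coarser_cells_met:
  assumes r: "r > 0" and sep: "cells_separated (grid org r) \<C>" and c: "c \<in> \<C>" and G: "isometric G"
  shows "card {d \<in> \<C>. snd d \<le> snd c \<and> G \<inter> fst c \<times> fst d \<noteq> {}} \<le> 25"
proof -
  interpret hierarchy "grid org r" using hierarchy_grid[OF r] .
  let ?D = "{d \<in> \<C>. snd d \<le> snd c \<and> G \<inter> fst c \<times> fst d \<noteq> {}}"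
  define g where "g d = (SOME g. g \<in> G \<inter> fst c \<times> fst d)" for d :: "complex set \<times> nat"
  have g: "g d \<in> G \<and> fst (g d) \<in> fst c \<and> snd (g d) \<in> fst d" if "d \<in> ?D" for d
  proof -
    have "g d \<in> G \<inter> fst c \<times> fst d" unfolding g_def by (rule someI_ex) (use that in blast)
    then show ?thesis by auto
  qed
  define \<phi> where "\<phi> d = grid org r (snd c) (snd (g d))" for d
  \<comment> \<open>Two cells reached in the same square of level \<open>snd c\<close> would, by
    refinement, be met by one square at the larger of their own levels, against separation.\<close>
  have inj: "inj_on \<phi> ?D"
  proof (rule inj_onI, rule ccontr)
    fix d e assume de: "d \<in> ?D" "e \<in> ?D" "\<phi> d = \<phi> e" "d \<noteq> e"
    have "max (snd d) (snd e) \<le> snd c" using de by simp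
    then have "grid org r (max (snd d) (snd e)) (snd (g d)) = grid org r (max (snd d) (snd e)) (snd (g e))"
      using refine[OF de(3)[unfolded \<phi>_def]] by blast
    moreover have "snd (g d) \<in> fst d" "snd (g e) \<in> fst e" using g de by blast+
    moreover have "d \<in> \<C>" "e \<in> \<C>" using de by auto
    ultimately show False using sep de(4) unfolding cells_separated_def by blast
  qed
  show ?thesis
  proof (cases "?D = {}")
    case True then show ?thesis by (metis card.empty le0)
  next
    case False
    then obtain d0 where d0: "d0 \<in> ?D" by blast
    define a where "a = fst (\<phi> d0)"
    define b where "b = snd (\<phi> d0)"
    have "\<phi> ` ?D \<subseteq> {a - 2..a + 2} \<times> {b - 2..b + 2}"
    proof (rule image_subsetI)
      fix d assume d: "d \<in> ?D"
      have "grid org r (snd c) (fst (g d0)) = grid org r (snd c) (fst (g d))"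
        using sep c g[OF d] g[OF d0] unfolding cells_separated_def by blast
      moreover have "dist (fst (g d0)) (fst (g d)) = dist (snd (g d0)) (snd (g d))"
        using G g[OF d] g[OF d0] unfolding isometric_def by blast
      ultimately show "\<phi> d \<in> {a - 2..a + 2} \<times> {b - 2..b + 2}"
        using grid_close[OF r] unfolding a_def b_def \<phi>_def by blast
    qed
    from card_inj_on_le[OF inj this] show ?thesis by (simp add: card_cartesian_product)
  qed
qed

text \<open>Pairs whose second cell is not finer are counted with \<open>G\<close>, the others with
  its converse; hence twice 25.\<close>

lemma card_cell_pairs_met:
  assumes r: "r > 0" and sep: "cells_separated (grid org r) \<C>" and fin: "finite \<C>" and G: "isometric G"
  shows "card {(c, d). c \<in> \<C> \<and> d \<in> \<C> \<and> G \<inter> fst c \<times> fst d \<noteq> {}} \<le> 50 * card \<C>"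
proof -
  let ?P = "{(c, d). c \<in> \<C> \<and> d \<in> \<C> \<and> G \<inter> fst c \<times> fst d \<noteq> {}}"
  define U where "U H = Sigma \<C> (\<lambda>c. {d \<in> \<C>. snd d \<le> snd c \<and> H \<inter> fst c \<times> fst d \<noteq> {}})" for H
  have U: "card (U H) \<le> 25 * card \<C>" "finite (U H)" if "isometric H" for H
  proof -
    have "card (U H) = (\<Sum>c\<in>\<C>. card {d \<in> \<C>. snd d \<le> snd c \<and> H \<inter> fst c \<times> fst d \<noteq> {}})"
      unfolding U_def using fin by (intro card_SigmaI) auto
    also have "\<dots> \<le> (\<Sum>c\<in>\<C>. 25)" by (intro sum_mono card_coarser_cells_met[OF r sep _ that])
    finally show "card (U H) \<le> 25 * card \<C>" by simp
    show "finite (U H)" using fin by (simp add: U_def)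
  qed
  have iG: "isometric (G\<inverse>)" using G unfolding isometric_def by clarsimp (metis fst_conv snd_conv)
  have "?P \<subseteq> U G \<union> prod.swap ` U (G\<inverse>)"
  proof
    fix p assume "p \<in> ?P"
    then obtain c d where cd: "p = (c, d)" "c \<in> \<C>" "d \<in> \<C>" "G \<inter> fst c \<times> fst d \<noteq> {}" by blast
    then have "G\<inverse> \<inter> fst d \<times> fst c \<noteq> {}" by blast
    then have "snd d \<le> snd c \<Longrightarrow> (c, d) \<in> U G" "snd c \<le> snd d \<Longrightarrow> (d, c) \<in> U (G\<inverse>)"
      using cd by (auto simp: U_def)
    then show "p \<in> U G \<union> prod.swap ` U (G\<inverse>)"
      using cd(1) nat_le_linear[of "snd c" "snd d"] by force
  qed
  then have "card ?P \<le> card (U G \<union> prod.swap ` U (G\<inverse>))"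
    using U(2)[OF G] U(2)[OF iG] by (intro card_mono) auto
  also have "\<dots> \<le> card (U G) + card (U (G\<inverse>))"
    using card_Un_le card_image_le[OF U(2)[OF iG]] by (meson add_left_mono order_trans)
  also have "\<dots> \<le> 50 * card \<C>" using U(1)[OF G] U(1)[OF iG] by simp
  finally show ?thesis .
qed

lemma isometry_partition:
  fixes A :: "complex set" and x :: nat
  assumes fin: "finite A" and x: "x \<ge> 1"
  shows "\<exists>\<C> :: (complex set \<times> nat) set. finite \<C> \<and> (\<Union>c\<in>\<C>. fst c) = A \<and>
    (\<forall>c\<in>\<C>. card (fst c) \<le> 2 * x) \<and> (\<forall>c\<in>\<C>. \<forall>d\<in>\<C>. c \<noteq> d \<longrightarrow> fst c \<inter> fst d = {}) \<and>
    x * card \<C> \<le> x + 4 * card A \<and>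
    (\<forall>G. isometric G \<longrightarrow> card {(c, d). c \<in> \<C> \<and> d \<in> \<C> \<and> G \<inter> fst c \<times> fst d \<noteq> {}} \<le> 50 * card \<C>)"
proof -
  obtain R where R: "R > 0" "\<And>z. z \<in> A \<Longrightarrow> cmod z < R"
    using finite_imp_bounded[OF fin] unfolding bounded_pos_less by blast
  \<comment> \<open>The square of side \<open>2 * R\<close> centred at 0 contains \<open>A\<close>,
    so all of \<open>A\<close> has index \<open>(0, 0)\<close> at level 0.\<close>
  define org where "org = Complex (- R) (- R)"
  define r where "r = 2 * R"
  have r: "r > 0" using R by (simp add: r_def)
  interpret hierarchy "grid org r" using hierarchy_grid[OF r] .
  have root: "grid org r 0 z = (0, 0)" if "z \<in> A" for z
    using R(2)[OF that] abs_Re_le_cmod[of z] abs_Im_le_cmod[of z] R(1)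
    unfolding grid_def org_def r_def by (auto simp: floor_eq_iff field_simps)
  obtain \<C> where C: "finite \<C>" "(\<Union>c\<in>\<C>. fst c) = A" "\<And>c. c \<in> \<C> \<Longrightarrow> card (fst c) \<le> 2 * x"
    "cells_separated (grid org r) \<C>" "card \<C> \<le> 1 \<or> x * (card \<C> + 3) \<le> 4 * card A"
  proof -
    have same: "grid org r 0 y = grid org r 0 z" if "y \<in> A" "z \<in> A" for y z by (simp add: root that)
    from cells_exist[OF fin same x] show thesis using that by blast
  qed
  have "x * card \<C> \<le> x + 4 * card A"
  proof (cases "card \<C> \<le> 1")
    case True
    from mult_le_mono2[OF True, of x] show ?thesis unfolding mult_1_right by (rule trans_le_add1)
  next
    case False then show ?thesis using C(5) by (simp add: algebra_simps)
  qed
  moreover have "fst c \<inter> fst d = {}" if "c \<in> \<C>" "d \<in> \<C>" "c \<noteq> d" for c d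
    using C(4) that unfolding cells_separated_def by blast
  ultimately show ?thesis using C(1,2,3) card_cell_pairs_met[OF r C(4,1)] by (intro exI[of _ \<C>] conjI ballI allI impI) blast+
qed

section \<open>Energy of rotations\<close>

text \<open>
  The Elekes--Sharir line: \<open>(z, t)\<close> lies on \<open>es_line (x, x')\<close> iff \<open>x'\<close> is the image of \<open>x\<close> under the rotation about \<open>z\<close>
  with multiplier \<open>- (1 - \<i> t) / (1 + \<i> t)\<close>. Every rotation except the identity arises for exactly one \<open>(z, t)\<close>.
\<close>

definition es_line :: "complex \<times> complex \<Rightarrow> complex \<times> complex"
  where "es_line q = ((fst q + snd q) / 2, - (\<i> * (fst q - snd q)) / 2)"

text \<open>The part of the graph of the rotation \<open>w\<close> inside \<open>X\<close> times
  \<open>Y\<close>; its size is the number of lines through the point \<open>w\<close> of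
  space.\<close>

definition rot :: "complex set \<Rightarrow> complex set \<Rightarrow> complex \<times> real \<Rightarrow> (complex \<times> complex) set"
  where "rot X Y w = {q \<in> X \<times> Y. lpt (es_line q) (snd w) = fst w}"

lemma inj_es_line: "inj es_line"
proof (rule injI)
  fix p q assume "es_line p = es_line q"
  then have "(fst p + snd p) / 2 = (fst q + snd q) / 2" "- (\<i> * (fst p - snd p)) / 2 = - (\<i> * (fst q - snd q)) / 2"
    unfolding es_line_def by blast+
  then have "fst p + snd p = fst q + snd q" "fst p - snd p = fst q - snd q"
    by (simp_all only: divide_cancel_right neg_equal_iff_equal mult_cancel_left) auto
  then have "2 * fst p = 2 * fst q" "2 * snd p = 2 * snd q" by algebra+
  then show "p = q" by (simp add: prod_eq_iff)
qed

lemma lpt_es_line_iff: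
  "lpt (es_line q) t = z \<longleftrightarrow> (1 - \<i> * of_real t) * fst q + (1 + \<i> * of_real t) * snd q = 2 * z"
proof -
  have "2 * lpt (es_line q) t = (1 - \<i> * of_real t) * fst q + (1 + \<i> * of_real t) * snd q"
    unfolding lpt_def es_line_def by (simp add: field_simps)
  then show ?thesis by (metis mult_cancel_left zero_neq_numeral)
qed

lemma norm_1_plus_minus_it: "cmod (1 - \<i> * of_real t) = cmod (1 + \<i> * of_real t)" "1 + \<i> * of_real t \<noteq> 0"
  by (simp_all add: cmod_def complex_eq_iff)

lemma isometric_rot: "isometric (rot X Y w)"
  unfolding isometric_def
proof (intro ballI)
  fix p q assume "p \<in> rot X Y w" "q \<in> rot X Y w"
  let ?t = "of_real (snd w) :: complex"
  have "(1 - \<i> * ?t) * fst p + (1 + \<i> * ?t) * snd p = (1 - \<i> * ?t) * fst q + (1 + \<i> * ?t) * snd q"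
    using \<open>p \<in> rot X Y w\<close> \<open>q \<in> rot X Y w\<close> unfolding rot_def lpt_es_line_iff by auto
  then have "(1 + \<i> * ?t) * (snd p - snd q) = - ((1 - \<i> * ?t) * (fst p - fst q))" by algebra
  then have "cmod ((1 + \<i> * ?t) * (snd p - snd q)) = cmod (- ((1 - \<i> * ?t) * (fst p - fst q)))" by simp
  then have "cmod (1 + \<i> * ?t) * cmod (snd p - snd q) = cmod (1 + \<i> * ?t) * cmod (fst p - fst q)"
    by (simp only: norm_minus_cancel norm_mult norm_1_plus_minus_it(1))
  then show "dist (fst p) (fst q) = dist (snd p) (snd q)"
    using norm_1_plus_minus_it(2)[of "snd w"] unfolding dist_norm by (metis mult_cancel_left norm_eq_zero)
qed

lemma finite_rot: "finite X \<Longrightarrow> finite Y \<Longrightarrow> finite (rot X Y w)"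
  unfolding rot_def by auto

lemma inj_on_fst_rot: "inj_on fst (rot X Y w)"
proof (rule inj_onI)
  fix p q assume pq: "p \<in> rot X Y w" "q \<in> rot X Y w" "fst p = fst q"
  then have "dist (snd p) (snd q) = 0" using isometric_rot[of X Y w] unfolding isometric_def by (metis dist_self)
  then show "p = q" using pq(3) by (simp add: prod_eq_iff)
qed

lemma card_rot_le: "finite X \<Longrightarrow> card (rot X Y w) \<le> card X"
  by (rule card_inj_on_le[OF inj_on_fst_rot]) (auto simp: rot_def)

text \<open>For fixed \<open>x\<close>, moving the target by \<open>d\<close> moves the line by
  \<open>(d / 2, \<i> * d / 2)\<close>. If both lines are in the plane, \<open>n\<close> is
  orthogonal to \<open>d\<close> and to \<open>\<i> * d\<close>, so \<open>d = 0\<close>: each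
  \<open>x\<close> gives at most one line.\<close>

lemma card_es_line_plane_le:
  assumes fin: "finite X" "finite Y" and n: "n \<noteq> 0"
  shows "card {l \<in> es_line ` (X \<times> Y). inner n (fst l) = \<mu> \<and> inner n (snd l) = \<nu>} \<le> card X"
proof -
  let ?Q = "{q \<in> X \<times> Y. inner n (fst (es_line q)) = \<mu> \<and> inner n (snd (es_line q)) = \<nu>}"
  have img: "{l \<in> es_line ` (X \<times> Y). inner n (fst l) = \<mu> \<and> inner n (snd l) = \<nu>} = es_line ` ?Q" by auto
  have "card {l \<in> es_line ` (X \<times> Y). inner n (fst l) = \<mu> \<and> inner n (snd l) = \<nu>} \<le> card ?Q"
    unfolding img using fin by (intro card_image_le) simp
  also have "\<dots> \<le> card X"
  proof (rule card_inj_on_le[where f = fst])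
    show "inj_on fst ?Q"
    proof (rule inj_onI)
      fix p q assume p: "p \<in> ?Q" and q: "q \<in> ?Q" and e: "fst p = fst q"
      define d where "d = snd p - snd q"
      have "inner n (fst (es_line p) - fst (es_line q)) = 0" "inner n (snd (es_line p) - snd (es_line q)) = 0"
        using p q by (auto simp: inner_diff_right)
      moreover have "fst (es_line p) - fst (es_line q) = d / 2" "snd (es_line p) - snd (es_line q) = \<i> * d / 2"
        unfolding es_line_def d_def using e by (simp_all add: field_simps)
      ultimately have "Re n * Re d + Im n * Im d = 0" "Im n * Re d - Re n * Im d = 0"
        by (simp_all add: inner_complex_def field_simps)
      then have "((Re n)\<^sup>2 + (Im n)\<^sup>2) * Re d = 0" "((Re n)\<^sup>2 + (Im n)\<^sup>2) * Im d = 0" by algebra+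
      moreover have "(Re n)\<^sup>2 + (Im n)\<^sup>2 \<noteq> 0" using n by (simp add: complex_eq_iff sum_power2_eq_zero_iff)
      ultimately have "Re d = 0" "Im d = 0" by (metis mult_eq_0_iff)+
      then have "d = 0" by (simp add: complex_eq_iff)
      then show "p = q" using e by (simp add: d_def prod_eq_iff)
    qed
  qed (use fin in auto)
  finally show ?thesis .
qed

text \<open>The lines of \<open>X\<close> times \<open>Y\<close> number at most \<open>B\<close>
  squared, with at most \<open>B\<close> in a plane. A pair \<open>(w, q)\<close> becomes the
  incidence of the line of \<open>q\<close> at height \<open>snd w\<close>; line and height recover
  the point.\<close>

lemma local_rich_sum_le:
  assumes fin: "finite X" "finite Y" "finite W" and B: "card X \<le> B" "card Y \<le> B"
  shows "(\<Sum>w\<in>{w \<in> W. 3 \<le> card (rot X Y w)}. card (rot X Y w)) \<le> 60 * B * (card X * card Y)"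
proof -
  define L where "L = es_line ` (X \<times> Y)"
  have cL: "card L = card X * card Y"
    unfolding L_def using inj_es_line by (simp add: card_image inj_on_subset card_cartesian_product)
  have fL: "finite L" using fin by (simp add: L_def)
  have "card L \<le> B\<^sup>2" unfolding cL power2_eq_square using B by (rule mult_le_mono)
  moreover have "card {l \<in> L. inner n (fst l) = \<mu> \<and> inner n (snd l) = \<nu>} \<le> B" if "n \<noteq> 0" for n \<mu> \<nu>
    unfolding L_def using card_es_line_plane_le[OF fin(1,2) that] B(1) order_trans by blast
  ultimately have rich: "finite (rich L)" "card (rich L) \<le> 60 * B * card L"
    using card_rich_le[OF fL] by blast+
  let ?W = "{w \<in> W. 3 \<le> card (rot X Y w)}"
  let ?f = "\<lambda>(w, q). (es_line q, snd w) :: (complex \<times> complex) \<times> real"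
  have "(\<Sum>w\<in>?W. card (rot X Y w)) = card (Sigma ?W (rot X Y))"
    using fin finite_rot by (intro card_SigmaI[symmetric]) auto
  also have "\<dots> \<le> card (rich L)"
  proof (rule card_inj_on_le[where f = ?f])
    show "inj_on ?f (Sigma ?W (rot X Y))"
    proof (rule inj_onI)
      fix a b assume ab: "a \<in> Sigma ?W (rot X Y)" "b \<in> Sigma ?W (rot X Y)" "?f a = ?f b"
      obtain w q w' q' where e: "a = (w, q)" "b = (w', q')" by (metis surj_pair)
      then have "q = q'" "snd w = snd w'" using ab(3) injD[OF inj_es_line] by auto
      moreover have "fst w = lpt (es_line q) (snd w)" "fst w' = lpt (es_line q') (snd w')"
        using ab(1,2) e by (auto simp: rot_def)
      ultimately have "w = w'" "q = q'" by (metis prod_eq_iff)+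
      then show "a = b" using e by simp
    qed
    show "?f ` Sigma ?W (rot X Y) \<subseteq> rich L"
    proof
      fix y assume "y \<in> ?f ` Sigma ?W (rot X Y)"
      then obtain w q where wq: "w \<in> ?W" "q \<in> rot X Y w" "y = (es_line q, snd w)" by auto
      have "through L (es_line q) (snd w) = es_line ` rot X Y w"
        using wq(2) unfolding through_def L_def rot_def by auto
      then have "card (through L (es_line q) (snd w)) = card (rot X Y w)"
        using inj_es_line by (simp add: card_image inj_on_subset)
      then show "y \<in> rich L" using wq unfolding rich_def L_def by (auto simp: rot_def)
    qed
  qed (rule rich)
  finally show ?thesis using rich(2) cL by simp
qed

text \<open>
  The cells are chosen so large that pairs of cells matched in at most two points contribute less than half of
  each \<open>rot A A w\<close>.
\<close>

lemma rot_sum_le: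
  assumes fin: "finite A" "finite W" and j: "j \<ge> 3" and W: "\<And>w. w \<in> W \<Longrightarrow> j \<le> card (rot A A w)"
  shows "j * (\<Sum>w\<in>W. card (rot A A w)) \<le> 400000 * card A ^ 3"
proof -
  define N where "N = card A"
  consider "j < 400" | "W = {}" | "j \<ge> 400" "W \<noteq> {}" by linarith
  then show ?thesis
  proof cases
    case 1
    \<comment> \<open>For bounded \<open>j\<close> the set \<open>A\<close> itself serves as the
      only cell.\<close>
    have "{w \<in> W. 3 \<le> card (rot A A w)} = W" using W j by force
    then have "(\<Sum>w\<in>W. card (rot A A w)) \<le> 60 * N * (N * N)"
      using local_rich_sum_le[OF fin(1,1,2), of N] by (simp add: N_def)
    then have "j * (\<Sum>w\<in>W. card (rot A A w)) \<le> 400 * (60 * N * (N * N))"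
      using 1 by (intro mult_le_mono) auto
    also have "\<dots> \<le> 400000 * N ^ 3" by (simp add: power3_eq_cube)
    finally show ?thesis unfolding N_def .
  next
    case 2
    then show ?thesis by simp
  next
    case 3
    then obtain w0 where "w0 \<in> W" by blast
    then have jN: "j \<le> N" using W[of w0] card_rot_le[OF fin(1), of A w0] by (simp add: N_def)
    \<comment> \<open>With this size \<open>K <= 1 + 4 * N / x <= 1 + j / 400\<close>, hence
      \<open>200 * K <= j\<close> as \<open>j >= 400\<close>. At most \<open>50 * K\<close> pairs of
      cells are met, so those with at most two matches contribute at most
      \<open>100 * K <= j / 2\<close>.\<close>
    define x where "x = 1600 * N div j + 1"
    have x1: "x \<ge> 1" by (simp add: x_def)
    have "x * j = 1600 * N div j * j + j" by (simp add: x_def)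
    moreover have "1600 * N div j * j + 1600 * N mod j = 1600 * N" by (rule div_mult_mod_eq)
    moreover have "1600 * N mod j < j" using 3 by simp
    ultimately have xj: "1600 * N \<le> x * j" "x * j \<le> 1601 * N" using jN by linarith+
    obtain \<C> :: "(complex set \<times> nat) set" where C0: "finite \<C> \<and> (\<Union>c\<in>\<C>. fst c) = A \<and>
      (\<forall>c\<in>\<C>. card (fst c) \<le> 2 * x) \<and> (\<forall>c\<in>\<C>. \<forall>d\<in>\<C>. c \<noteq> d \<longrightarrow> fst c \<inter> fst d = {}) \<and>
      x * card \<C> \<le> x + 4 * card A \<and>
      (\<forall>G. isometric G \<longrightarrow> card {(c, d). c \<in> \<C> \<and> d \<in> \<C> \<and> G \<inter> fst c \<times> fst d \<noteq> {}} \<le> 50 * card \<C>)"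
      by (rule exE[OF isometry_partition[OF fin(1) x1]])
    then have C: "finite \<C>" "(\<Union>c\<in>\<C>. fst c) = A" "x * card \<C> \<le> x + 4 * card A" by blast+
    have C3: "card (fst c) \<le> 2 * x" if "c \<in> \<C>" for c
      using C0[THEN conjunct2, THEN conjunct2, THEN conjunct1] that by blast
    have C4: "fst c \<inter> fst d = {}" if "c \<in> \<C>" "d \<in> \<C>" "c \<noteq> d" for c d
      using C0[THEN conjunct2, THEN conjunct2, THEN conjunct2, THEN conjunct1] that by blast
    have C6: "card {(c, d). c \<in> \<C> \<and> d \<in> \<C> \<and> G \<inter> fst c \<times> fst d \<noteq> {}} \<le> 50 * card \<C>" if "isometric G" for G
      using C0[THEN conjunct2, THEN conjunct2, THEN conjunct2, THEN conjunct2, THEN conjunct2] that by blast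
    define K where "K = card \<C>"
    have K: "200 * K \<le> j"
    proof -
      have "400 * (x * K) \<le> 400 * x + 1600 * N" using C(3) unfolding K_def N_def by linarith
      then have "x * (400 * K) \<le> x * (400 + j)" using xj(1) by (simp add: algebra_simps)
      then have "400 * K \<le> 400 + j" using x1 by simp
      then show ?thesis using 3 by linarith
    qed
    have finc: "finite (fst c)" if "c \<in> \<C>" for c by (rule finite_subset[OF _ fin(1)]) (use C(2) that in blast)
    define r where "r w p = card (rot (fst (fst p)) (fst (snd p)) w)"
      for w and p :: "(complex set \<times> nat) \<times> (complex set \<times> nat)"
    have single: "card (rot A A w) \<le> 2 * (\<Sum>p\<in>\<C> \<times> \<C>. if 3 \<le> r w p then r w p else 0)" if w: "w \<in> W" for w
    proof -
      let ?P = "{(c, d). c \<in> \<C> \<and> d \<in> \<C> \<and> rot A A w \<inter> fst c \<times> fst d \<noteq> {}}"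
      have P: "?P \<subseteq> \<C> \<times> \<C>" by auto
      have finP: "finite ?P" by (rule finite_subset[OF P]) (simp add: C(1))
      have "rot A A w \<subseteq> (\<Union>p\<in>?P. rot (fst (fst p)) (fst (snd p)) w)"
      proof
        fix q assume q: "q \<in> rot A A w"
        then have "fst q \<in> A" "snd q \<in> A" by (auto simp: rot_def)
        then obtain c d where cd: "c \<in> \<C>" "d \<in> \<C>" "fst q \<in> fst c" "snd q \<in> fst d" using C(2) by blast
        then have "q \<in> rot A A w \<inter> fst c \<times> fst d" using q by (simp add: mem_Times_iff)
        then have m1: "(c, d) \<in> ?P" using cd by blast
        have m2: "q \<in> rot (fst c) (fst d) w" using q cd by (auto simp: rot_def mem_Times_iff)
        show "q \<in> (\<Union>p\<in>?P. rot (fst (fst p)) (fst (snd p)) w)" by (rule UN_I[OF m1]) (simp add: m2)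
      qed
      moreover have "finite (\<Union>p\<in>?P. rot (fst (fst p)) (fst (snd p)) w)"
        using finP finc by (auto intro!: finite_rot)
      ultimately have "card (rot A A w) \<le> card (\<Union>p\<in>?P. rot (fst (fst p)) (fst (snd p)) w)" by (rule card_mono[rotated])
      also have "\<dots> \<le> (\<Sum>p\<in>?P. r w p)" unfolding r_def by (rule card_UN_le[OF finP])
      also have "\<dots> \<le> (\<Sum>p\<in>?P. (if 3 \<le> r w p then r w p else 0) + 2)" by (intro sum_mono) auto
      also have "\<dots> = (\<Sum>p\<in>?P. if 3 \<le> r w p then r w p else 0) + 2 * card ?P"
        by (simp only: sum.distrib sum_constant mult.commute of_nat_id)
      also have "\<dots> \<le> (\<Sum>p\<in>\<C> \<times> \<C>. if 3 \<le> r w p then r w p else 0) + 100 * K"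
      proof (rule add_mono)
        show "(\<Sum>p\<in>?P. if 3 \<le> r w p then r w p else 0) \<le> (\<Sum>p\<in>\<C> \<times> \<C>. if 3 \<le> r w p then r w p else 0)"
          using P C(1) by (intro sum_mono2) auto
        show "2 * card ?P \<le> 100 * K" using C6[OF isometric_rot[of A A w]] by (simp add: K_def)
      qed
      finally have "card (rot A A w) \<le> (\<Sum>p\<in>\<C> \<times> \<C>. if 3 \<le> r w p then r w p else 0) + 100 * K" .
      then show ?thesis using K W[OF w] by linarith
    qed
    have "(\<Sum>w\<in>W. card (rot A A w)) \<le> (\<Sum>w\<in>W. 2 * (\<Sum>p\<in>\<C> \<times> \<C>. if 3 \<le> r w p then r w p else 0))"
      by (intro sum_mono single)
    also have "\<dots> = 2 * (\<Sum>p\<in>\<C> \<times> \<C>. \<Sum>w\<in>W. if 3 \<le> r w p then r w p else 0)"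
      unfolding sum_distrib_left[symmetric] by (subst sum.swap) (rule refl)
    also have "\<dots> \<le> 2 * (\<Sum>p\<in>\<C> \<times> \<C>. 120 * x * (card (fst (fst p)) * card (fst (snd p))))"
    proof (intro mult_le_mono2 sum_mono)
      fix p assume p: "p \<in> \<C> \<times> \<C>"
      then have c: "fst p \<in> \<C>" "snd p \<in> \<C>" by auto
      have "(\<Sum>w\<in>W. if 3 \<le> r w p then r w p else 0) = (\<Sum>w\<in>{w \<in> W. 3 \<le> r w p}. r w p)"
        using fin(2) by (simp add: sum.inter_filter)
      also have "\<dots> \<le> 60 * (2 * x) * (card (fst (fst p)) * card (fst (snd p)))"
        unfolding r_def by (rule local_rich_sum_le[OF finc[OF c(1)] finc[OF c(2)] fin(2) C3[OF c(1)] C3[OF c(2)]])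
      finally show "(\<Sum>w\<in>W. if 3 \<le> r w p then r w p else 0) \<le> 120 * x * (card (fst (fst p)) * card (fst (snd p)))" by simp
    qed
    also have "(\<Sum>p\<in>\<C> \<times> \<C>. 120 * x * (card (fst (fst p)) * card (fst (snd p)))) =
        120 * x * ((\<Sum>c\<in>\<C>. card (fst c)) * (\<Sum>c\<in>\<C>. card (fst c)))"
      unfolding sum_distrib_left[symmetric] by (simp add: sum_product sum.cartesian_product case_prod_unfold)
    also have "(\<Sum>c\<in>\<C>. card (fst c)) = N"
      unfolding N_def C(2)[symmetric] using C(1) C4 finc by (intro card_UN_disjoint[symmetric]) auto
    finally have "j * (\<Sum>w\<in>W. card (rot A A w)) \<le> j * (2 * (120 * x * (N * N)))" by (rule mult_le_mono2)
    also have "\<dots> = 240 * (x * j) * (N * N)" by simp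
    also have "\<dots> \<le> 240 * (1601 * N) * (N * N)" using xj(2) by (intro mult_le_mono1 mult_le_mono2)
    also have "\<dots> \<le> 400000 * N ^ 3" by (simp add: power3_eq_cube)
    finally show ?thesis unfolding N_def .
  qed
qed

lemma harm_le_1_plus_ln: "n \<ge> 1 \<Longrightarrow> harm n \<le> 1 + ln (real n)"
  using decseqD[OF decseq_harm_diff_ln, of 0 "n - 1"] by (simp add: harm_expand)

text \<open>The square of \<open>R\<close> is the sum of \<open>R\<close> over
  \<open>j = 1, ..., R\<close>. After exchanging sums, level \<open>j\<close> contributes
  \<open>O(N^3 / j)\<close>, and the harmonic sum gives the logarithm.\<close>

lemma rotation_energy_le:
  assumes fin: "finite A" "finite W" and W: "\<And>w. w \<in> W \<Longrightarrow> 3 \<le> card (rot A A w)" and A: "A \<noteq> {}"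
  shows "(\<Sum>w\<in>W. real (card (rot A A w)) ^ 2) \<le> 400000 * real (card A) ^ 3 * (1 + ln (real (card A)))"
proof -
  define N where "N = card A"
  have N1: "N \<ge> 1" using fin A unfolding N_def by (simp add: Suc_leI card_gt_0_iff)
  define R where "R w = card (rot A A w)" for w
  have RN: "R w \<le> N" for w unfolding R_def N_def by (rule card_rot_le[OF fin(1)])
  have level: "(\<Sum>w\<in>{w \<in> W. j \<le> R w}. real (R w)) \<le> 400000 * real N ^ 3 * inverse (real j)" if j: "j \<in> {1..N}" for j
  proof -
    \<comment> \<open>The levels 1 and 2 coincide with level 3, because all rotations in
      \<open>W\<close> have at least three matches.\<close>
    let ?j = "max 3 j"
    have "?j * (\<Sum>w\<in>{w \<in> W. j \<le> R w}. R w) \<le> 400000 * N ^ 3"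
      unfolding R_def N_def by (rule rot_sum_le) (use fin W in auto)
    then have "j * (\<Sum>w\<in>{w \<in> W. j \<le> R w}. R w) \<le> 400000 * N ^ 3"
      by (meson max.cobounded2 mult_le_mono1 order_trans)
    then have "real (j * (\<Sum>w\<in>{w \<in> W. j \<le> R w}. R w)) \<le> real (400000 * N ^ 3)" by (simp only: of_nat_le_iff)
    then have "real j * (\<Sum>w\<in>{w \<in> W. j \<le> R w}. real (R w)) \<le> 400000 * real N ^ 3" by simp
    then show ?thesis using j by (simp add: field_simps)
  qed
  have "(\<Sum>w\<in>W. real (R w) ^ 2) = (\<Sum>w\<in>W. \<Sum>j\<in>{1..N}. if j \<le> R w then real (R w) else 0)"
  proof (intro sum.cong refl)
    fix w
    have "(\<Sum>j\<in>{1..N}. if j \<le> R w then real (R w) else 0) = (\<Sum>j\<in>{j \<in> {1..N}. j \<le> R w}. real (R w))"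
      by (rule sum.inter_filter[symmetric]) simp
    also have "{j \<in> {1..N}. j \<le> R w} = {1..R w}" using RN[of w] by auto
    finally show "real (R w) ^ 2 = (\<Sum>j\<in>{1..N}. if j \<le> R w then real (R w) else 0)"
      by (simp add: power2_eq_square)
  qed
  also have "\<dots> = (\<Sum>j\<in>{1..N}. \<Sum>w\<in>{w \<in> W. j \<le> R w}. real (R w))"
    by (subst sum.swap, intro sum.cong refl sum.inter_filter[symmetric] fin)
  also have "\<dots> \<le> (\<Sum>j\<in>{1..N}. 400000 * real N ^ 3 * inverse (real j))" by (intro sum_mono level)
  also have "\<dots> = 400000 * real N ^ 3 * harm N" by (simp add: harm_def sum_distrib_left)
  also have "\<dots> \<le> 400000 * real N ^ 3 * (1 + ln (real N))"
    using harm_le_1_plus_ln[OF N1] by (intro mult_left_mono) auto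
  finally show ?thesis unfolding R_def N_def .
qed

section \<open>Reflections and circumcentres\<close>

definition bis :: "complex \<Rightarrow> complex \<Rightarrow> complex set"
  where "bis a b = {x. cmod (a - x) = cmod (b - x)}"

lemma bis_commute: "bis a b = bis b a"
  by (auto simp: bis_def)

lemma cmod_eq_iff: "cmod u = cmod v \<longleftrightarrow> (Re u)\<^sup>2 + (Im u)\<^sup>2 = (Re v)\<^sup>2 + (Im v)\<^sup>2"
  by (simp add: cmod_def)

text \<open>The reflection in an axis through \<open>z\<close>, as a unit multiple of conjugation
  about \<open>z\<close>. The multiplier depends only on the direction of \<open>b - a\<close>, so
  pairs with a common bisector share it.\<close>

lemma reflection_coefficient:
  assumes "z \<in> bis a b" "a \<noteq> b"
  shows "b - z = - ((b - a) / cnj (b - a)) * cnj (a - z)"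
proof -
  have n: "(b - z) * cnj (b - z) = (a - z) * cnj (a - z)"
    using assms(1) unfolding bis_def mem_Collect_eq complex_norm_square[symmetric] by simp
  have "(b - z) * cnj (b - a) = - (b - a) * cnj (a - z)"
    using n by (simp add: algebra_simps)
  moreover have "cnj (b - a) \<noteq> 0" using assms(2) by simp
  ultimately show ?thesis by (simp add: field_simps)
qed

lemma common_reflection:
  assumes z: "z \<in> bis a b" and eq: "bis a b = bis c d" and ab: "a \<noteq> b" and cd: "c \<noteq> d"
  shows "\<exists>\<omega>. cmod \<omega> = 1 \<and> b - z = \<omega> * cnj (a - z) \<and> d - z = \<omega> * cnj (c - z)"
proof -
  have zc: "z \<in> bis c d" using z eq by simp
  \<comment> \<open>A second point of the axis; its membership in the other bisector makes
    \<open>d - c\<close> parallel to \<open>b - a\<close>.\<close>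
  have "z + \<i> * (b - a) \<in> bis a b"
    using z unfolding bis_def mem_Collect_eq cmod_eq_iff by (simp add: power2_eq_square algebra_simps)
  then have "z + \<i> * (b - a) \<in> bis c d" using eq by simp
  with zc have par: "Re (d - c) * Im (b - a) = Im (d - c) * Re (b - a)"
    unfolding bis_def mem_Collect_eq cmod_eq_iff by (simp add: power2_eq_square algebra_simps)
  then have "(d - c) * cnj (b - a) = cnj (d - c) * (b - a)"
    by (simp add: complex_eq_iff algebra_simps)
  then have "(d - c) / cnj (d - c) = (b - a) / cnj (b - a)"
    using ab cd by (simp add: field_simps)
  moreover have "cmod (- ((b - a) / cnj (b - a))) = 1"
    unfolding norm_minus_cancel norm_divide complex_mod_cnj using ab by simp
  ultimately show ?thesis using reflection_coefficient[OF z ab] reflection_coefficient[OF zc cd]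
    by (intro exI[of _ "- ((b - a) / cnj (b - a))"]) simp
qed

lemma midpoint_in_bis: "(a + b) / 2 \<in> bis a b"
proof -
  have "a - (a + b) / 2 = - (b - (a + b) / 2)" by (simp add: field_simps)
  then show ?thesis unfolding bis_def mem_Collect_eq by (metis norm_minus_cancel)
qed

text \<open>At the midpoint of \<open>a\<close> and \<open>b\<close>, which differs from
  \<open>a\<close>, the multiplier is determined by \<open>a\<close> and \<open>b\<close>; so the
  image of \<open>c\<close> is too.\<close>

lemma reflection_unique:
  assumes "bis a b = bis c d" "bis a b = bis c d'" "a \<noteq> b" "c \<noteq> d" "c \<noteq> d'"
  shows "d = d'"
proof -
  let ?z = "(a + b) / 2"
  obtain \<omega> where w: "b - ?z = \<omega> * cnj (a - ?z)" "d - ?z = \<omega> * cnj (c - ?z)"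
    using common_reflection[OF midpoint_in_bis assms(1,3,4)] by blast
  obtain \<omega>' where w': "b - ?z = \<omega>' * cnj (a - ?z)" "d' - ?z = \<omega>' * cnj (c - ?z)"
    using common_reflection[OF midpoint_in_bis assms(2,3,5)] by blast
  have "a - ?z \<noteq> 0" using assms(3) by (simp add: field_simps)
  then have "\<omega> = \<omega>'" using w(1) w'(1) by (metis complex_cnj_zero_iff mult_cancel_right)
  then show ?thesis using w(2) w'(2) by (metis diff_add_cancel)
qed

text \<open>The Cayley transform \<open>(1 + \<rho>) / (1 - \<rho>)\<close> of a unit
  \<open>\<rho>\<close> is purely imaginary; its imaginary part is \<open>t\<close>.\<close>

lemma unit_cayley:
  assumes "cmod \<rho> = 1" "\<rho> \<noteq> 1"
  shows "\<exists>t::real. (1 - \<i> * of_real t) + (1 + \<i> * of_real t) * \<rho> = 0"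
proof -
  let ?s = "(1 + \<rho>) / (1 - \<rho>)"
  have r: "(Re \<rho>)\<^sup>2 + (Im \<rho>)\<^sup>2 = 1" using assms(1) by (simp add: cmod_def)
  have "Re ?s = 0" using r by (simp add: Re_divide power2_eq_square algebra_simps)
  then have "\<i> * of_real (Im ?s) = ?s" by (simp add: complex_eq_iff)
  then have "(1 - \<i> * of_real (Im ?s)) + (1 + \<i> * of_real (Im ?s)) * \<rho> = (1 - ?s) + (1 + ?s) * \<rho>" by simp
  also have "\<dots> = 0" using assms(2) by (simp add: field_simps)
  finally show ?thesis by blast
qed

text \<open>One reflection undone and the other applied is the rotation about \<open>z\<close> with
  multiplier \<open>\<rho> = \<omega>' / \<omega>\<close>, for both pairs at once. The condition
  \<open>b ~= b'\<close> excludes the identity, which has no parameter.\<close>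

lemma rotation_of_reflections:
  assumes "cmod \<omega> = 1" "cmod \<omega>' = 1" "b - z = \<omega> * cnj (a - z)" "d - z = \<omega> * cnj (c - z)"
    "b' - z = \<omega>' * cnj (a - z)" "d' - z = \<omega>' * cnj (c - z)" "b \<noteq> b'"
  shows "\<exists>t. lpt (es_line (b, b')) t = z \<and> lpt (es_line (d, d')) t = z"
proof -
  define \<rho> where "\<rho> = \<omega>' / \<omega>"
  have w0: "\<omega> \<noteq> 0" using assms(1) by auto
  have bb: "b' - z = \<rho> * (b - z)" and dd: "d' - z = \<rho> * (d - z)"
    unfolding \<rho>_def assms(3-6) using w0 by (simp_all add: field_simps)
  have "cmod \<rho> = 1" using assms(1,2) by (simp add: \<rho>_def norm_divide)
  moreover have "\<rho> \<noteq> 1" using bb assms(7) by auto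
  ultimately obtain t where t: "(1 - \<i> * of_real t) + (1 + \<i> * of_real t) * \<rho> = 0" using unit_cayley by blast
  have "lpt (es_line (x, x')) t = z" if "x' - z = \<rho> * (x - z)" for x x'
  proof -
    have "(1 - \<i> * of_real t) * x + (1 + \<i> * of_real t) * x' =
        2 * z + ((1 - \<i> * of_real t) + (1 + \<i> * of_real t) * \<rho>) * (x - z)" using that by algebra
    then show ?thesis unfolding lpt_es_line_iff t by simp
  qed
  then show ?thesis using bb dd by blast
qed

lemma lpt_es_line_inj:
  assumes "lpt (es_line (b, b')) t = lpt (es_line (b, b')) s" "b \<noteq> b'"
  shows "t = s"
proof -
  have "of_real (t - s) * snd (es_line (b, b')) = 0" using assms(1) by (simp add: lpt_def algebra_simps)
  moreover have "snd (es_line (b, b')) \<noteq> 0" using assms(2) by (simp add: es_line_def)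
  ultimately show ?thesis by simp
qed

lemma circumcentre_exists:
  assumes "inner (\<i> * (b - a)) (b' - a) \<noteq> 0"
  shows "\<exists>z. cmod (a - z) = cmod (b - z) \<and> cmod (a - z) = cmod (b' - z)"
proof -
  define p q r s where "p = Re (b - a)" "q = Im (b - a)" "r = Re (b' - a)" "s = Im (b' - a)"
  define \<Delta> where "\<Delta> = p * s - q * r"
  have \<Delta>: "\<Delta> \<noteq> 0" using assms unfolding \<Delta>_def p_q_r_s_def by (simp add: inner_complex_def algebra_simps)
  \<comment> \<open>Cramer's rule for the two bisector equations, with the origin moved to
    \<open>a\<close>.\<close>
  define x where "x = ((p\<^sup>2 + q\<^sup>2) * s - (r\<^sup>2 + s\<^sup>2) * q) / (2 * \<Delta>)"
  define y where "y = (p * (r\<^sup>2 + s\<^sup>2) - r * (p\<^sup>2 + q\<^sup>2)) / (2 * \<Delta>)"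
  have xy: "2 * \<Delta> * x = (p\<^sup>2 + q\<^sup>2) * s - (r\<^sup>2 + s\<^sup>2) * q" "2 * \<Delta> * y = p * (r\<^sup>2 + s\<^sup>2) - r * (p\<^sup>2 + q\<^sup>2)"
    using \<Delta> by (simp_all add: x_def y_def)
  have "\<Delta> * (2 * (p * x + q * y)) = \<Delta> * (p\<^sup>2 + q\<^sup>2)" "\<Delta> * (2 * (r * x + s * y)) = \<Delta> * (r\<^sup>2 + s\<^sup>2)"
    using xy unfolding \<Delta>_def by algebra+
  then have e: "2 * (p * x + q * y) = p\<^sup>2 + q\<^sup>2" "2 * (r * x + s * y) = r\<^sup>2 + s\<^sup>2" using \<Delta> by simp_all
  define z where "z = a + Complex x y"
  have "x\<^sup>2 + y\<^sup>2 = (p - x)\<^sup>2 + (q - y)\<^sup>2" "x\<^sup>2 + y\<^sup>2 = (r - x)\<^sup>2 + (s - y)\<^sup>2"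
    using e by (simp_all add: power2_eq_square algebra_simps)
  then have "cmod (a - z) = cmod (b - z) \<and> cmod (a - z) = cmod (b' - z)"
    unfolding cmod_eq_iff z_def p_q_r_s_def by (simp add: algebra_simps)
  then show ?thesis by blast
qed

text \<open>The exponent is chosen so that \<open>2 * (3 / 4) ^ 8 \<le> 1 / 4\<close>.\<close>

definition rich_thr :: nat where "rich_thr = 4 * 3 ^ 8"

text \<open>Inversion at \<open>a\<close> turns lines and circles through \<open>a\<close> into lines.\<close>

lemma circles_through_point_bound:
  "\<exists>c::nat. \<forall>a (B::complex set) m Z. finite B \<longrightarrow> finite Z \<longrightarrow> a \<notin> B \<longrightarrow>
    (\<forall>u e. u \<noteq> 0 \<longrightarrow> card {b \<in> B. inner u (b - a) = e * (cmod (b - a))\<^sup>2} \<le> m) \<longrightarrow>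
    (\<forall>z\<in>Z. rich_thr \<le> card {b \<in> B. dist z b = dist z a}) \<longrightarrow>
    (\<Sum>z\<in>Z. real (card {b \<in> B. dist z b = dist z a}) ^ 2) \<le> 1 / 4 * real (card B) ^ 2 + real c * real m * real (card B)"
proof -
  obtain c :: nat where c: "\<And>S M (\<L> :: complex set set). finite S \<Longrightarrow> finite \<L> \<Longrightarrow>
    (\<forall>u e. u \<noteq> 0 \<longrightarrow> card (S \<inter> hyp u e) \<le> M) \<Longrightarrow>
    (\<forall>l\<in>\<L>. (\<exists>u e. u \<noteq> 0 \<and> l = hyp u e) \<and> card (S \<inter> l) \<ge> 4 * 3 ^ 8) \<Longrightarrow>
    (\<Sum>l\<in>\<L>. real (card (S \<inter> l)) ^ 2) \<le> 2 * (3 / 4) ^ 8 * real (card S) ^ 2 + real c * real M * real (card S)"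
    using rich_lines_bound[of 8] by blast
  have "(\<Sum>z\<in>Z. real (card {b \<in> B. dist z b = dist z a}) ^ 2) \<le> 1 / 4 * real (card B) ^ 2 + real c * real m * real (card B)"
    if fin: "finite B" "finite Z" and a: "a \<notin> B"
      and m: "\<forall>u e. u \<noteq> 0 \<longrightarrow> card {b \<in> B. inner u (b - a) = e * (cmod (b - a))\<^sup>2} \<le> m"
      and Z: "\<forall>z\<in>Z. rich_thr \<le> card {b \<in> B. dist z b = dist z a}" for a B m Z
  proof -
    define iv where "iv b = inverse ((cmod (b - a))\<^sup>2) *\<^sub>R (b - a)" for b
    have pos: "cmod (b - a) > 0" if "b \<in> B" for b using that a by auto
    have norm_iv: "cmod (iv b) = inverse (cmod (b - a))" if "b \<in> B" for b
      using pos[OF that] by (simp add: iv_def power2_eq_square)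
    have inj: "inj_on iv B"
    proof (rule inj_onI)
      fix b b' assume b: "b \<in> B" "b' \<in> B" "iv b = iv b'"
      then have "cmod (b - a) = cmod (b' - a)" using norm_iv by (metis inverse_eq_iff_eq)
      then show "b = b'" using b(3) pos[OF b(2)] by (simp add: iv_def)
    qed
    \<comment> \<open>In the original plane the equation on the right is a line through
      \<open>a\<close> if \<open>e = 0\<close>, and otherwise a circle through \<open>a\<close> with
      centre \<open>a + u / (2 e)\<close>.\<close>
    have hypiv: "iv b \<in> hyp u e \<longleftrightarrow> inner u (b - a) = e * (cmod (b - a))\<^sup>2" if "b \<in> B" for b u e
    proof -
      have "inner u (iv b) = inner u (b - a) / (cmod (b - a))\<^sup>2" by (simp add: iv_def divide_inverse mult.commute)
      then show ?thesis using pos[OF that] by (simp add: hyp_def divide_eq_eq)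
    qed
    define S where "S = iv ` B"
    have cS: "card S = card B" unfolding S_def using inj by (rule card_image)
    have cut: "S \<inter> hyp u e = iv ` {b \<in> B. inner u (b - a) = e * (cmod (b - a))\<^sup>2}" for u e
      using hypiv unfolding S_def by blast
    have ccut: "card (S \<inter> hyp u e) = card {b \<in> B. inner u (b - a) = e * (cmod (b - a))\<^sup>2}" for u e
      unfolding cut by (rule card_image) (rule inj_on_subset[OF inj], auto)
    have circ: "dist z b = dist z a \<longleftrightarrow> inner (z - a) (b - a) = 1 / 2 * (cmod (b - a))\<^sup>2" for z b
    proof -
      have "dist z b = dist z a \<longleftrightarrow> (dist z b)\<^sup>2 = (dist z a)\<^sup>2" by (simp add: power2_eq_iff_nonneg)
      also have "(dist z b)\<^sup>2 = (dist z a)\<^sup>2 - 2 * inner (z - a) (b - a) + (cmod (b - a))\<^sup>2"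
      proof -
        have "z - b = (z - a) - (b - a)" by simp
        then show ?thesis unfolding dist_norm power2_norm_eq_inner by (simp add: inner_diff_left inner_diff_right inner_commute)
      qed
      finally show ?thesis by auto
    qed
    have czl: "card (S \<inter> hyp (z - a) (1 / 2)) = card {b \<in> B. dist z b = dist z a}" for z
      unfolding ccut circ ..
    have za: "z \<noteq> a" if "z \<in> Z" for z
    proof
      assume "z = a"
      then have emp: "{b \<in> B. dist z b = dist z a} = {}" using a by auto
      have "rich_thr \<le> card {b \<in> B. dist z b = dist z a}" using Z that by blast
      then show False unfolding emp by (simp add: rich_thr_def)
    qed
    \<comment> \<open>With the offset fixed at 1/2 a line determines its normal, so distinct centres
      give distinct lines.\<close>
    have injZ: "inj_on (\<lambda>z. hyp (z - a) (1 / 2)) Z"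
    proof (rule inj_onI)
      fix z w assume zw: "z \<in> Z" "w \<in> Z" "hyp (z - a) (1 / 2) = hyp (w - a) (1 / 2)"
      define u where "u = z - a"
      define v where "v = w - a"
      define n where "n = (Re u)\<^sup>2 + (Im u)\<^sup>2"
      have n: "n \<noteq> 0" using za[OF zw(1)] unfolding n_def u_def by (simp add: complex_eq_iff sum_power2_eq_zero_iff)
      have nn: "inner u u = n" "inner u (\<i> * u) = 0" by (simp_all add: inner_complex_def n_def power2_eq_square)
      have "(1 / (2 * n)) *\<^sub>R u \<in> hyp u (1 / 2)" "(1 / (2 * n)) *\<^sub>R u + \<i> * u \<in> hyp u (1 / 2)"
        using n nn unfolding hyp_def by (simp_all add: inner_add_right)
      then have "(1 / (2 * n)) *\<^sub>R u \<in> hyp v (1 / 2)" "(1 / (2 * n)) *\<^sub>R u + \<i> * u \<in> hyp v (1 / 2)"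
        using zw(3) unfolding u_def v_def by auto
      then have "inner v u = n" "inner v (\<i> * u) = 0"
        using n unfolding hyp_def by (simp_all add: inner_add_right)
      then have e: "Re v * Re u + Im v * Im u = n" "Im v * Re u - Re v * Im u = 0"
        by (simp_all add: inner_complex_def)
      have "n * Re v = n * Re u" "n * Im v = n * Im u" using e unfolding n_def by algebra+
      then have "v = u" using n by (simp add: complex_eq_iff)
      then show "z = w" by (simp add: u_def v_def)
    qed
    define \<L> where "\<L> = (\<lambda>z. hyp (z - a) (1 / 2)) ` Z"
    have "(\<Sum>z\<in>Z. real (card {b \<in> B. dist z b = dist z a}) ^ 2) = (\<Sum>l\<in>\<L>. real (card (S \<inter> l)) ^ 2)"
      unfolding \<L>_def sum.reindex[OF injZ] by (simp add: czl)
    also have "\<dots> \<le> 2 * (3 / 4) ^ 8 * real (card S) ^ 2 + real c * real m * real (card S)"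
    proof (rule c)
      show "finite S" "finite \<L>" using fin by (simp_all add: S_def \<L>_def)
      show "\<forall>u e. u \<noteq> 0 \<longrightarrow> card (S \<inter> hyp u e) \<le> m" using m unfolding ccut .
      show "\<forall>l\<in>\<L>. (\<exists>u e. u \<noteq> 0 \<and> l = hyp u e) \<and> card (S \<inter> l) \<ge> 4 * 3 ^ 8"
      proof
        fix l assume "l \<in> \<L>"
        then obtain z where z: "z \<in> Z" "l = hyp (z - a) (1 / 2)" unfolding \<L>_def by blast
        have "4 * 3 ^ 8 \<le> card (S \<inter> l)" using Z z czl[of z] unfolding rich_thr_def by simp
        moreover have "z - a \<noteq> 0" using za[OF z(1)] by simp
        ultimately show "(\<exists>u e. u \<noteq> 0 \<and> l = hyp u e) \<and> card (S \<inter> l) \<ge> 4 * 3 ^ 8" using z(2) by blast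
      qed
    qed
    also have "2 * (3 / 4) ^ 8 * real (card S) ^ 2 \<le> 1 / 4 * real (card S) ^ 2"
      by (intro mult_right_mono) (simp_all add: power_divide)
    finally show ?thesis unfolding cS by simp
  qed
  then show ?thesis by blast
qed

section \<open>Pairs related by a reflection\<close>

text \<open>Choosing the constant once, outside every configuration, keeps
  \<open>energy_const\<close> absolute.\<close>

definition beck_const :: nat
  where "beck_const = (SOME c. \<forall>a (B::complex set) m Z. finite B \<longrightarrow> finite Z \<longrightarrow> a \<notin> B \<longrightarrow>
    (\<forall>u e. u \<noteq> 0 \<longrightarrow> card {b \<in> B. inner u (b - a) = e * (cmod (b - a))\<^sup>2} \<le> m) \<longrightarrow>
    (\<forall>z\<in>Z. rich_thr \<le> card {b \<in> B. dist z b = dist z a}) \<longrightarrow>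
    (\<Sum>z\<in>Z. real (card {b \<in> B. dist z b = dist z a}) ^ 2) \<le> 1 / 4 * real (card B) ^ 2 + real c * real m * real (card B))"

lemma beck_const:
  assumes "finite B" "finite Z" "a \<notin> B"
    "\<forall>u e. u \<noteq> 0 \<longrightarrow> card {b \<in> B. inner u (b - a) = e * (cmod (b - a))\<^sup>2} \<le> m"
    "\<forall>z\<in>Z. rich_thr \<le> card {b \<in> B. dist z b = dist z a}"
  shows "(\<Sum>z\<in>Z. real (card {b \<in> B. dist z b = dist z a}) ^ 2) \<le> 1 / 4 * real (card B) ^ 2 + real beck_const * real m * real (card B)"
  using someI_ex[OF circles_through_point_bound, folded beck_const_def, rule_format, OF assms(1-3)] assms(4,5) by blast

lemma quadratic_le:
  fixes x b c :: real
  assumes "x \<ge> 0" "b \<ge> 0" "c \<ge> 0" "x\<^sup>2 \<le> b * x + c"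
  shows "x \<le> b + sqrt c"
proof (rule ccontr)
  assume "\<not> ?thesis"
  then have gt: "x > b + sqrt c" by simp
  have s: "sqrt c \<ge> 0" using assms by simp
  have xs: "x \<ge> sqrt c" using gt assms by linarith
  have "sqrt c * sqrt c \<le> sqrt c * x" using xs s by (rule mult_left_mono)
  then have "c \<le> sqrt c * x" using assms by simp
  moreover have "x > 0" using gt assms s by linarith
  then have "(b + sqrt c) * x < x * x" using gt by simp
  ultimately show False using assms(4) by (simp add: power2_eq_square algebra_simps)
qed

text \<open>The coefficients in \<open>D_le\<close> after half of \<open>D\<close> is moved to the
  left and all else is doubled; 800000 is twice the constant of
  \<open>rotation_energy_le\<close>.\<close>

definition energy_const :: real
  where "energy_const = 4 + 4 * real beck_const + 800000 * real rich_thr"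

text \<open>Poorness enters only through its consequences for lines and circles through a pair. The
  condition \<open>z ~= a\<close> makes the radius positive.\<close>

locale poor_configuration =
  fixes A :: "complex set" and M :: nat and poor :: "complex \<Rightarrow> complex \<Rightarrow> bool"
  assumes finA: "finite A" and neA: "A \<noteq> {}"
    and poor_sym: "poor a b \<Longrightarrow> poor b a"
    and poor_line: "a \<in> A \<Longrightarrow> b \<in> A \<Longrightarrow> poor a b \<Longrightarrow> u \<noteq> 0 \<Longrightarrow> inner u a = inner u b \<Longrightarrow>
      card {y \<in> A. inner u y = inner u a} \<le> M"
    and poor_circle: "a \<in> A \<Longrightarrow> b \<in> A \<Longrightarrow> poor a b \<Longrightarrow> z \<noteq> a \<Longrightarrow> dist z a = dist z b \<Longrightarrow>
      card {y \<in> A. dist z y = dist z a} \<le> M"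
begin

definition V :: "(complex \<times> complex) set"
  where "V = {p \<in> A \<times> A. fst p \<noteq> snd p}"

definition adj :: "complex \<times> complex \<Rightarrow> complex \<times> complex \<Rightarrow> bool"
  where "adj p q \<longleftrightarrow> p \<in> V \<and> q \<in> V \<and> poor (fst p) (fst q) \<and> fst p \<noteq> fst q \<and> snd p \<noteq> snd q \<and>
    bis (fst p) (fst q) = bis (snd p) (snd q)"

definition nb :: "complex \<times> complex \<Rightarrow> (complex \<times> complex) set"
  where "nb p = {q. adj p q}"

text \<open>Being equidistant from the first points puts \<open>z\<close> on the common axis; these
  are the neighbours of \<open>p\<close> reflected in axes through \<open>z\<close>.\<close>

definition lam :: "complex \<times> complex \<Rightarrow> complex \<Rightarrow> (complex \<times> complex) set"
  where "lam p z = {q \<in> nb p. dist z (fst q) = dist z (fst p)}"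

lemma finV: "finite V" "card V \<le> (card A)\<^sup>2"
proof -
  show "finite V" using finA by (simp add: V_def)
  have "card V \<le> card (A \<times> A)" using finA by (intro card_mono) (auto simp: V_def)
  then show "card V \<le> (card A)\<^sup>2" by (simp add: card_cartesian_product power2_eq_square)
qed

lemma nb_V: "nb p \<subseteq> V"
  unfolding nb_def adj_def by blast

lemma fin_nb: "finite (nb p)" "finite (lam p z)"
  using finite_subset[OF nb_V finV(1)] by (simp_all add: lam_def)

lemma adj_sym: "adj p q \<Longrightarrow> adj q p"
  unfolding adj_def using poor_sym bis_commute by metis

text \<open>The first points determine the axis, and the axis determines \<open>snd q\<close>.
  Neighbourhoods can thus be treated as planar point sets.\<close>

lemma adj_unique:
  assumes "adj p q" "adj p q'" "fst q = fst q'"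
  shows "q = q'"
proof -
  have "snd q = snd q'"
    by (rule reflection_unique[of "fst p" "fst q" "snd p"]) (use assms in \<open>auto simp: adj_def\<close>)
  then show ?thesis using assms(3) by (simp add: prod_eq_iff)
qed

lemma inj_fst_nb: "inj_on fst (nb p)"
  unfolding nb_def using adj_unique by (intro inj_onI) blast

text \<open>Collinearity, including \<open>b = b'\<close>; a noncollinear triple therefore has
  \<open>fst q ~= fst q'\<close>.\<close>

definition col :: "complex \<Rightarrow> complex \<Rightarrow> complex \<Rightarrow> bool"
  where "col a b b' \<longleftrightarrow> inner (\<i> * (b - a)) (b' - a) = 0"

definition circumcentre :: "complex \<Rightarrow> complex \<Rightarrow> complex \<Rightarrow> complex"
  where "circumcentre a b b' = (SOME z. cmod (a - z) = cmod (b - z) \<and> cmod (a - z) = cmod (b' - z))"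

lemma circumcentre:
  assumes "\<not> col a b b'"
  shows "cmod (a - circumcentre a b b') = cmod (b - circumcentre a b b')" "cmod (a - circumcentre a b b') = cmod (b' - circumcentre a b b')"
  using someI_ex[OF circumcentre_exists[OF assms[unfolded col_def]], folded circumcentre_def] by auto

text \<open>A finite range for all centres that occur; collinear triples may only add unspecified
  points.\<close>

definition centres :: "complex set"
  where "centres = (\<lambda>(a, b, b'). circumcentre a b b') ` (A \<times> A \<times> A)"

lemma finite_centres: "finite centres" using finA by (simp add: centres_def)

definition E :: nat where "E = (\<Sum>p\<in>V. card (nb p))"

definition D :: nat where "D = (\<Sum>p\<in>V. (card (nb p))\<^sup>2)"

lemma VA: "p \<in> V \<Longrightarrow> fst p \<in> A \<and> snd p \<in> A"
  unfolding V_def by auto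

lemma nb_A: "q \<in> nb p \<Longrightarrow> fst q \<in> A"
  using nb_V VA by blast

lemma card_collinear_le:
  assumes "adj p q"
  shows "card {q' \<in> nb p. col (fst p) (fst q) (fst q')} \<le> M"
proof -
  let ?u = "\<i> * (fst q - fst p)"
  have u: "?u \<noteq> 0" using assms by (auto simp: adj_def)
  have "inner ?u (fst q - fst p) = 0" by (simp add: inner_complex_def algebra_simps)
  then have e: "inner ?u (fst p) = inner ?u (fst q)" by (simp add: inner_diff_right)
  have "card {q' \<in> nb p. col (fst p) (fst q) (fst q')} = card (fst ` {q' \<in> nb p. col (fst p) (fst q) (fst q')})"
    by (rule card_image[symmetric]) (rule inj_on_subset[OF inj_fst_nb], auto)
  also have "\<dots> \<le> card {y \<in> A. inner ?u y = inner ?u (fst p)}"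
  proof (rule card_mono)
    show "fst ` {q' \<in> nb p. col (fst p) (fst q) (fst q')} \<subseteq> {y \<in> A. inner ?u y = inner ?u (fst p)}"
      using nb_A unfolding col_def by (fastforce simp: inner_diff_right)
  qed (use finA in simp)
  also have "\<dots> \<le> M"
    by (rule poor_line[OF _ _ _ u e]) (use assms VA in \<open>auto simp: adj_def\<close>)
  finally show ?thesis .
qed

text \<open>A line or circle through \<open>fst p\<close> that contains the first point of a
  neighbour contains a poor pair, hence at most \<open>M\<close> points of \<open>A\<close>. This is
  the hypothesis of the bound for circles through a point.\<close>

lemma sum_lam_sq_le:
  assumes p: "p \<in> V" and Z: "finite Z" "\<And>z. z \<in> Z \<Longrightarrow> rich_thr \<le> card (lam p z)"
  shows "(\<Sum>z\<in>Z. real (card (lam p z)) ^ 2) \<le> 1 / 4 * real (card (nb p)) ^ 2 + real beck_const * real M * real (card (nb p))"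
proof -
  define a where "a = fst p"
  define B where "B = fst ` nb p"
  have cB: "card B = card (nb p)" unfolding B_def by (rule card_image[OF inj_fst_nb])
  have BA: "B \<subseteq> A" unfolding B_def using nb_V VA by blast
  have finB: "finite B" using BA finA finite_subset by blast
  have aA: "a \<in> A" using VA[OF p] by (simp add: a_def)
  have Bp: "poor a b \<and> b \<noteq> a \<and> b \<in> A" if "b \<in> B" for b
    using that BA unfolding B_def nb_def adj_def a_def by auto
  have clam: "card {b \<in> B. dist z b = dist z a} = card (lam p z)" for z
  proof -
    have "{b \<in> B. dist z b = dist z a} = fst ` lam p z" unfolding B_def lam_def a_def by auto
    moreover have "inj_on fst (lam p z)" by (rule inj_on_subset[OF inj_fst_nb]) (auto simp: lam_def)
    ultimately show ?thesis by (simp add: card_image)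
  qed
  have m: "card {b \<in> B. inner u (b - a) = e * (cmod (b - a))\<^sup>2} \<le> M" if u: "u \<noteq> 0" for u e
  proof (cases "{b \<in> B. inner u (b - a) = e * (cmod (b - a))\<^sup>2} = {}")
    case True
    then show ?thesis by (simp only: card.empty)
  next
    case False
    then obtain b where b: "b \<in> B" "inner u (b - a) = e * (cmod (b - a))\<^sup>2" by blast
    show ?thesis
    proof (cases "e = 0")
      case True
      have "card {b \<in> B. inner u (b - a) = e * (cmod (b - a))\<^sup>2} \<le> card {y \<in> A. inner u y = inner u a}"
        using finA BA True by (intro card_mono) (auto simp: inner_diff_right)
      also have "\<dots> \<le> M"
        by (rule poor_line[of a b u]) (use aA u Bp[OF b(1)] b(2) True in \<open>auto simp: inner_diff_right\<close>)
      finally show ?thesis .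
    next
      case False
      \<comment> \<open>The centre obtained by completing the square in
        \<open>inner u (y - a) = e * |y - a|^2\<close>.\<close>
      define z where "z = a + (1 / (2 * e)) *\<^sub>R u"
      have circ: "dist z y = dist z a" if "inner u (y - a) = e * (cmod (y - a))\<^sup>2" for y
      proof -
        have gen: "(cmod (v - w))\<^sup>2 = (cmod v)\<^sup>2 - 2 * inner v w + (cmod w)\<^sup>2" for v w
          by (simp add: power2_norm_eq_inner inner_diff_left inner_diff_right inner_commute)
        have d: "z - y = (1 / (2 * e)) *\<^sub>R u - (y - a)" "z - a = (1 / (2 * e)) *\<^sub>R u" by (simp_all add: z_def)
        have "(dist z y)\<^sup>2 = (dist z a)\<^sup>2 - 2 * ((1 / (2 * e)) * inner u (y - a)) + (cmod (y - a))\<^sup>2"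
          unfolding dist_norm d gen inner_scaleR_left ..
        also have "\<dots> = (dist z a)\<^sup>2" using that False by simp
        finally show ?thesis by (simp add: power2_eq_iff_nonneg)
      qed
      have "card {b \<in> B. inner u (b - a) = e * (cmod (b - a))\<^sup>2} \<le> card {y \<in> A. dist z y = dist z a}"
        by (intro card_mono subsetI) (use finA in simp, use BA circ in blast)
      also have "\<dots> \<le> M"
      proof (rule poor_circle[OF aA])
        show "b \<in> A" "poor a b" using Bp[OF b(1)] by auto
        show "z \<noteq> a" using u False by (simp add: z_def)
        show "dist z a = dist z b" using circ[OF b(2)] by simp
      qed
      finally show ?thesis .
    qed
  qed
  have "(\<Sum>z\<in>Z. real (card {b \<in> B. dist z b = dist z a}) ^ 2) \<le> 1 / 4 * real (card B) ^ 2 + real beck_const * real M * real (card B)"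
    by (rule beck_const[OF finB Z(1)]) (use Bp m Z(2) clam in auto)
  then show ?thesis unfolding clam cB .
qed

section \<open>Classification of the triples by centre and rotation\<close>

definition T :: "((complex \<times> complex) \<times> (complex \<times> complex) \<times> (complex \<times> complex)) set"
  where "T = Sigma V (\<lambda>p. nb p \<times> nb p)"

lemma card_T: "card T = D" "finite T"
  unfolding T_def D_def using finV fin_nb
  by (simp_all add: card_SigmaI card_cartesian_product power2_eq_square)

definition triple_col :: "(complex \<times> complex) \<times> (complex \<times> complex) \<times> (complex \<times> complex) \<Rightarrow> bool"
  where "triple_col = (\<lambda>(p, q, q'). col (fst p) (fst q) (fst q'))"

definition triple_centre :: "(complex \<times> complex) \<times> (complex \<times> complex) \<times> (complex \<times> complex) \<Rightarrow> complex"
  where "triple_centre = (\<lambda>(p, q, q'). circumcentre (fst p) (fst q) (fst q'))"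

lemma T_D:
  assumes "(p, q, q') \<in> T"
  shows "adj p q" "adj p q'" "fst p \<in> A" "snd p \<in> A" "fst q \<in> A" "snd q \<in> A" "fst q' \<in> A" "snd q' \<in> A"
  using assms VA unfolding T_def nb_def adj_def by auto

lemma card_T_col: "card {x \<in> T. triple_col x} \<le> M * E"
proof -
  have "{x \<in> T. triple_col x} = Sigma V (\<lambda>p. Sigma (nb p) (\<lambda>q. {q' \<in> nb p. col (fst p) (fst q) (fst q')}))"
    unfolding T_def triple_col_def by auto
  also have "card \<dots> = (\<Sum>p\<in>V. \<Sum>q\<in>nb p. card {q' \<in> nb p. col (fst p) (fst q) (fst q')})"
    using finV fin_nb by (simp add: card_SigmaI)
  also have "\<dots> \<le> (\<Sum>p\<in>V. \<Sum>q\<in>nb p. M)"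
    by (intro sum_mono card_collinear_le) (simp add: nb_def)
  finally show ?thesis by (simp add: E_def sum_distrib_left mult.commute)
qed

lemma T_centre:
  assumes x: "(p, q, q') \<in> T" "\<not> triple_col (p, q, q')"
  defines "z \<equiv> triple_centre (p, q, q')"
  shows "z \<in> centres" "q \<in> lam p z" "q' \<in> lam p z" "p \<in> lam q z"
    "\<exists>t. lpt (es_line (fst q, fst q')) t = z \<and> lpt (es_line (snd q, snd q')) t = z" "fst q \<noteq> fst q'"
proof -
  note a = T_D[OF x(1)]
  have zeq: "z = circumcentre (fst p) (fst q) (fst q')" by (simp add: z_def triple_centre_def)
  have nc: "\<not> col (fst p) (fst q) (fst q')" using x(2) by (simp add: triple_col_def)
  show "z \<in> centres" unfolding zeq centres_def using a by force
  have d: "cmod (fst p - z) = cmod (fst q - z)" "cmod (fst p - z) = cmod (fst q' - z)"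
    using circumcentre[OF nc] unfolding zeq by auto
  show "q \<in> lam p z" "q' \<in> lam p z" "p \<in> lam q z"
    using d a(1,2) adj_sym[OF a(1)] unfolding lam_def nb_def dist_norm by (auto simp: norm_minus_commute)
  show ne: "fst q \<noteq> fst q'"
  proof
    assume "fst q = fst q'"
    then have "col (fst p) (fst q) (fst q')" unfolding col_def by (simp add: inner_complex_def algebra_simps)
    with nc show False by blast
  qed
  have zb: "z \<in> bis (fst p) (fst q)" "z \<in> bis (fst p) (fst q')" using d by (simp_all add: bis_def)
  obtain \<omega> where w: "cmod \<omega> = 1" "fst q - z = \<omega> * cnj (fst p - z)" "snd q - z = \<omega> * cnj (snd p - z)"
    using common_reflection[OF zb(1)] a(1) unfolding adj_def by blast
  obtain \<omega>' where w': "cmod \<omega>' = 1" "fst q' - z = \<omega>' * cnj (fst p - z)" "snd q' - z = \<omega>' * cnj (snd p - z)"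
    using common_reflection[OF zb(2)] a(2) unfolding adj_def by blast
  show "\<exists>t. lpt (es_line (fst q, fst q')) t = z \<and> lpt (es_line (snd q, snd q')) t = z"
    by (rule rotation_of_reflections[OF w(1) w'(1) w(2,3) w'(2,3) ne])
qed

definition rich_centres :: "complex \<times> complex \<Rightarrow> complex set"
  where "rich_centres p = {z \<in> centres. rich_thr \<le> card (lam p z)}"

lemma sum_rich_centres_le:
  "(\<Sum>p\<in>V. \<Sum>z\<in>rich_centres p. real (card (lam p z)) ^ 2) \<le> real D / 4 + real beck_const * real M * real E"
proof -
  have "(\<Sum>p\<in>V. \<Sum>z\<in>rich_centres p. real (card (lam p z)) ^ 2)
    \<le> (\<Sum>p\<in>V. 1 / 4 * real (card (nb p)) ^ 2 + real beck_const * real M * real (card (nb p)))"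
    by (intro sum_mono sum_lam_sq_le) (use finite_centres in \<open>auto simp: rich_centres_def\<close>)
  also have "\<dots> = 1 / 4 * (\<Sum>p\<in>V. real (card (nb p)) ^ 2) + real beck_const * real M * (\<Sum>p\<in>V. real (card (nb p)))"
    unfolding sum.distrib sum_distrib_left ..
  finally show ?thesis unfolding D_def E_def by simp
qed

lemma finite_rich_centres: "finite (rich_centres p)" using finite_centres by (simp add: rich_centres_def)

text \<open>Both \<open>q\<close> and \<open>q'\<close> lie in \<open>lam p z\<close>, so the
  squares of its size over rich \<open>z\<close> cover these triples.\<close>

lemma card_T_rich1:
  "real (card {x \<in> T. \<not> triple_col x \<and> rich_thr \<le> card (lam (fst x) (triple_centre x))}) \<le> real D / 4 + real beck_const * real M * real E"
proof -
  let ?X = "{x \<in> T. \<not> triple_col x \<and> rich_thr \<le> card (lam (fst x) (triple_centre x))}"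
  let ?Y = "Sigma V (\<lambda>p. \<Union>z\<in>rich_centres p. lam p z \<times> lam p z)"
  have "?X \<subseteq> ?Y"
  proof
    fix x assume x: "x \<in> ?X"
    obtain p q q' where e: "x = (p, q, q')" by (metis surj_pair)
    have "(p, q, q') \<in> T" "\<not> triple_col (p, q, q')" using x e by auto
    note c = T_centre[OF this]
    have "triple_centre (p, q, q') \<in> rich_centres p" using c(1) x e by (simp add: rich_centres_def)
    moreover have "p \<in> V" using x e by (simp add: T_def)
    ultimately show "x \<in> ?Y" unfolding e using c(2,3) by blast
  qed
  then have "card ?X \<le> card ?Y" using finV finite_rich_centres fin_nb by (intro card_mono) auto
  also have "card ?Y = (\<Sum>p\<in>V. card (\<Union>z\<in>rich_centres p. lam p z \<times> lam p z))"
    using finV finite_rich_centres fin_nb by (intro card_SigmaI) auto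
  also have "\<dots> \<le> (\<Sum>p\<in>V. \<Sum>z\<in>rich_centres p. card (lam p z \<times> lam p z))"
    by (intro sum_mono card_UN_le finite_rich_centres)
  also have "\<dots> = (\<Sum>p\<in>V. \<Sum>z\<in>rich_centres p. card (lam p z) ^ 2)" by (simp add: card_cartesian_product power2_eq_square)
  finally have "real (card ?X) \<le> real (\<Sum>p\<in>V. \<Sum>z\<in>rich_centres p. card (lam p z) ^ 2)" by (simp only: of_nat_le_iff)
  also have "\<dots> = (\<Sum>p\<in>V. \<Sum>z\<in>rich_centres p. real (card (lam p z)) ^ 2)" by simp
  finally show ?thesis using sum_rich_centres_le by simp
qed

text \<open>Emptied when large, so that its size is bounded without a side condition.\<close>

definition lamp :: "complex \<times> complex \<Rightarrow> complex \<Rightarrow> (complex \<times> complex) set"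
  where "lamp p z = (if card (lam p z) < rich_thr then lam p z else {})"

lemma lamp: "finite (lamp p z)" "card (lamp p z) \<le> rich_thr"
  using fin_nb by (auto simp: lamp_def)

text \<open>Here the circle is rich for \<open>q\<close> only. Start from \<open>q\<close> and
  choose \<open>p\<close> in \<open>lam q z\<close>; fewer than \<open>rich_thr\<close> choices
  remain for \<open>q'\<close>, and \<open>rich_thr <= card (lam q z)\<close>, so squares suffice
  again.\<close>

lemma card_T_rich2:
  "real (card {x \<in> T. \<not> triple_col x \<and> card (lam (fst x) (triple_centre x)) < rich_thr \<and> rich_thr \<le> card (lam (fst (snd x)) (triple_centre x))})
    \<le> real D / 4 + real beck_const * real M * real E"
proof -
  let ?X = "{x \<in> T. \<not> triple_col x \<and> card (lam (fst x) (triple_centre x)) < rich_thr \<and> rich_thr \<le> card (lam (fst (snd x)) (triple_centre x))}"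
  let ?Y = "Sigma V (\<lambda>q. \<Union>z\<in>rich_centres q. Sigma (lam q z) (\<lambda>p. lamp p z))"
  let ?f = "\<lambda>x :: (complex \<times> complex) \<times> (complex \<times> complex) \<times> (complex \<times> complex). (fst (snd x), fst x, snd (snd x))"
  have sub: "?f ` ?X \<subseteq> ?Y"
  proof (rule image_subsetI)
    fix x assume x: "x \<in> ?X"
    obtain p q q' where e: "x = (p, q, q')" by (metis surj_pair)
    have t: "(p, q, q') \<in> T" "\<not> triple_col (p, q, q')" using x e by auto
    note c = T_centre[OF t]
    have "triple_centre (p, q, q') \<in> rich_centres q" using c(1) x e by (simp add: rich_centres_def)
    moreover have "q \<in> V" using T_D(1)[OF t(1)] by (simp add: adj_def)
    moreover have "q' \<in> lamp p (triple_centre (p, q, q'))" using c(3) x e by (simp add: lamp_def)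
    ultimately have "(q, p, q') \<in> ?Y" using c(4) by blast
    then show "?f x \<in> ?Y" by (simp add: e)
  qed
  have finY: "finite ?Y" using finV finite_rich_centres fin_nb lamp by auto
  have "card ?X \<le> card ?Y"
    by (rule card_inj_on_le[OF _ sub finY]) (auto simp: inj_on_def)
  also have "card ?Y = (\<Sum>q\<in>V. card (\<Union>z\<in>rich_centres q. Sigma (lam q z) (\<lambda>p. lamp p z)))"
    using finV finite_rich_centres fin_nb lamp by (intro card_SigmaI) auto
  also have "\<dots> \<le> (\<Sum>q\<in>V. \<Sum>z\<in>rich_centres q. card (Sigma (lam q z) (\<lambda>p. lamp p z)))"
    by (intro sum_mono card_UN_le finite_rich_centres)
  also have "\<dots> \<le> (\<Sum>q\<in>V. \<Sum>z\<in>rich_centres q. card (lam q z) ^ 2)"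
  proof (intro sum_mono)
    fix q z assume z: "z \<in> rich_centres q"
    have "card (Sigma (lam q z) (\<lambda>p. lamp p z)) = (\<Sum>p\<in>lam q z. card (lamp p z))"
      using fin_nb lamp by (intro card_SigmaI) auto
    also have "\<dots> \<le> (\<Sum>p\<in>lam q z. rich_thr)" by (intro sum_mono lamp)
    also have "\<dots> \<le> card (lam q z) ^ 2" using z by (simp add: rich_centres_def power2_eq_square)
    finally show "card (Sigma (lam q z) (\<lambda>p. lamp p z)) \<le> card (lam q z) ^ 2" .
  qed
  finally have "real (card ?X) \<le> real (\<Sum>p\<in>V. \<Sum>z\<in>rich_centres p. card (lam p z) ^ 2)" by (simp only: of_nat_le_iff)
  also have "\<dots> = (\<Sum>p\<in>V. \<Sum>z\<in>rich_centres p. real (card (lam p z)) ^ 2)" by simp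
  finally show ?thesis using sum_rich_centres_le by simp
qed

text \<open>Computed from first points alone, so that the rotation of a triple depends only on the
  first points of \<open>p\<close>, \<open>q\<close> and \<open>q'\<close>.\<close>

definition rot_param :: "complex \<Rightarrow> complex \<Rightarrow> complex \<Rightarrow> real"
  where "rot_param b b' z = (SOME t. lpt (es_line (b, b')) t = z)"

definition triple_rot :: "(complex \<times> complex) \<times> (complex \<times> complex) \<times> (complex \<times> complex) \<Rightarrow> complex \<times> real"
  where "triple_rot x = (triple_centre x, rot_param (fst (fst (snd x))) (fst (snd (snd x))) (triple_centre x))"

lemma T_rotation:
  assumes x: "(p, q, q') \<in> T" "\<not> triple_col (p, q, q')"
  shows "(fst q, fst q') \<in> rot A A (triple_rot (p, q, q'))" "(snd q, snd q') \<in> rot A A (triple_rot (p, q, q'))"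
proof -
  let ?z = "triple_centre (p, q, q')"
  obtain t where t: "lpt (es_line (fst q, fst q')) t = ?z" "lpt (es_line (snd q, snd q')) t = ?z"
    using T_centre(5)[OF x] by blast
  have s: "lpt (es_line (fst q, fst q')) (rot_param (fst q) (fst q') ?z) = ?z"
    unfolding rot_param_def by (rule someI[of "\<lambda>t. lpt (es_line (fst q, fst q')) t = ?z", OF t(1)])
  then have "rot_param (fst q) (fst q') ?z = t" using lpt_es_line_inj[OF _ T_centre(6)[OF x]] t(1) by metis
  then show "(fst q, fst q') \<in> rot A A (triple_rot (p, q, q'))" "(snd q, snd q') \<in> rot A A (triple_rot (p, q, q'))"
    using t T_D[OF x(1)] unfolding rot_def triple_rot_def by auto
qed

definition rich_rots :: "(complex \<times> real) set"
  where "rich_rots = {w \<in> triple_rot ` T. 3 \<le> card (rot A A w)}"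

lemma finite_rich_rots: "finite rich_rots" using card_T(2) by (simp add: rich_rots_def)

text \<open>A triple is encoded by its rotation, the matched pair of first points, the matched pair
  of second points, and \<open>p\<close>. The two pairs give \<open>R\<close> squared choices and
  determine \<open>q\<close> and \<open>q'\<close>; at most \<open>rich_thr\<close> choices remain
  for \<open>p\<close>.\<close>

lemma card_T_poor:
  "real (card {x \<in> T. \<not> triple_col x \<and> card (lam (fst (snd x)) (triple_centre x)) < rich_thr \<and> 3 \<le> card (rot A A (triple_rot x))})
    \<le> real rich_thr * (400000 * real (card A) ^ 3 * (1 + ln (real (card A))))"
proof -
  let ?X = "{x \<in> T. \<not> triple_col x \<and> card (lam (fst (snd x)) (triple_centre x)) < rich_thr \<and> 3 \<le> card (rot A A (triple_rot x))}"
  let ?Y = "Sigma rich_rots (\<lambda>w. Sigma (rot A A w \<times> rot A A w) (\<lambda>r. lamp (fst (fst r), fst (snd r)) (fst w)))"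
  let ?f = "\<lambda>x. (triple_rot x, ((fst (fst (snd x)), fst (snd (snd x))), (snd (fst (snd x)), snd (snd (snd x)))), fst x)"
  have sub: "?f ` ?X \<subseteq> ?Y"
  proof (rule image_subsetI)
    fix x assume x: "x \<in> ?X"
    obtain p q q' where e: "x = (p, q, q')" by (metis surj_pair)
    have t: "(p, q, q') \<in> T" "\<not> triple_col (p, q, q')" using x e by auto
    have "p \<in> lamp (fst q, snd q) (fst (triple_rot (p, q, q')))"
      using T_centre(4)[OF t] x e by (simp add: lamp_def triple_rot_def)
    moreover have "triple_rot (p, q, q') \<in> rich_rots" using x e by (auto simp: rich_rots_def)
    ultimately show "?f x \<in> ?Y" using T_rotation[OF t] by (simp add: e)
  qed
  have inj: "inj_on ?f ?X" by (rule inj_onI) (auto simp: prod_eq_iff)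
  have finR: "finite (rot A A w \<times> rot A A w)" for w using finite_rot[OF finA finA] by simp
  have finY: "finite ?Y" by (intro finite_SigmaI finite_rich_rots finite_rot finA lamp(1))
  have "card ?X \<le> card ?Y" by (rule card_inj_on_le[OF inj sub finY])
  also have "card ?Y = (\<Sum>w\<in>rich_rots. card (Sigma (rot A A w \<times> rot A A w) (\<lambda>r. lamp (fst (fst r), fst (snd r)) (fst w))))"
    by (intro card_SigmaI ballI finite_SigmaI finite_rich_rots finite_rot finA lamp(1))
  also have "\<dots> \<le> (\<Sum>w\<in>rich_rots. rich_thr * card (rot A A w) ^ 2)"
  proof (intro sum_mono)
    fix w
    have "card (Sigma (rot A A w \<times> rot A A w) (\<lambda>r. lamp (fst (fst r), fst (snd r)) (fst w)))
      = (\<Sum>r\<in>rot A A w \<times> rot A A w. card (lamp (fst (fst r), fst (snd r)) (fst w)))"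
      using finR lamp(1) by (intro card_SigmaI) auto
    also have "\<dots> \<le> (\<Sum>r\<in>rot A A w \<times> rot A A w. rich_thr)" by (intro sum_mono lamp)
    also have "\<dots> = rich_thr * card (rot A A w) ^ 2"
      by (simp add: card_cartesian_product power2_eq_square)
    finally show "card (Sigma (rot A A w \<times> rot A A w) (\<lambda>r. lamp (fst (fst r), fst (snd r)) (fst w)))
      \<le> rich_thr * card (rot A A w) ^ 2" .
  qed
  finally have "real (card ?X) \<le> real (\<Sum>w\<in>rich_rots. rich_thr * card (rot A A w) ^ 2)" by (simp only: of_nat_le_iff)
  also have "\<dots> = real rich_thr * (\<Sum>w\<in>rich_rots. real (card (rot A A w)) ^ 2)" by (simp add: sum_distrib_left)
  also have "\<dots> \<le> real rich_thr * (400000 * real (card A) ^ 3 * (1 + ln (real (card A))))"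
    by (intro mult_left_mono rotation_energy_le finA finite_rich_rots neA) (auto simp: rich_rots_def)
  finally show ?thesis .
qed

text \<open>The three first points fix the rotation, so \<open>snd q\<close> is one of at most two
  sources. Then \<open>q\<close> and \<open>fst p\<close> determine \<open>p\<close>, and
  \<open>p\<close> and \<open>fst q'\<close> determine \<open>q'\<close>.\<close>

lemma card_T_few: "card {x \<in> T. \<not> triple_col x \<and> card (rot A A (triple_rot x)) \<le> 2} \<le> 2 * card A ^ 3"
proof -
  let ?X = "{x \<in> T. \<not> triple_col x \<and> card (rot A A (triple_rot x)) \<le> 2}"
  define w where "w a b b' = (circumcentre a b b', rot_param b b' (circumcentre a b b'))" for a b b'
  define S where "S = (\<lambda>(a, b, b'). if card (rot A A (w a b b')) \<le> 2 then fst ` rot A A (w a b b') else {})"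
  let ?Y = "Sigma (A \<times> A \<times> A) S"
  let ?f = "\<lambda>x :: (complex \<times> complex) \<times> (complex \<times> complex) \<times> (complex \<times> complex).
    ((fst (fst x), fst (fst (snd x)), fst (snd (snd x))), snd (fst (snd x)))"
  have sub: "?f ` ?X \<subseteq> ?Y"
  proof (rule image_subsetI)
    fix x assume x: "x \<in> ?X"
    obtain p q q' where e: "x = (p, q, q')" by (metis surj_pair)
    have t: "(p, q, q') \<in> T" "\<not> triple_col (p, q, q')" using x e by auto
    have we: "triple_rot (p, q, q') = w (fst p) (fst q) (fst q')" by (simp add: triple_rot_def w_def triple_centre_def)
    have "card (rot A A (w (fst p) (fst q) (fst q'))) \<le> 2" using x e we by simp
    moreover have "snd q \<in> fst ` rot A A (w (fst p) (fst q) (fst q'))"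
      using T_rotation(2)[OF t] unfolding we by force
    ultimately have "snd q \<in> S (fst p, fst q, fst q')" by (simp add: S_def)
    then show "?f x \<in> ?Y" using T_D[OF t(1)] by (simp add: e)
  qed
  have inj: "inj_on ?f ?X"
  proof (rule inj_onI)
    fix x y assume x: "x \<in> ?X" and y: "y \<in> ?X" and fxy: "?f x = ?f y"
    obtain p q q' where e: "x = (p, q, q')" by (metis surj_pair)
    obtain r s s' where e': "y = (r, s, s')" by (metis surj_pair)
    have t: "(p, q, q') \<in> T" "(r, s, s') \<in> T" using x y e e' by auto
    have eq: "fst p = fst r" "fst q = fst s" "fst q' = fst s'" "snd q = snd s" using fxy e e' by auto
    then have qs: "q = s" by (simp add: prod_eq_iff)
    have "adj q p" "adj q r" using adj_sym T_D(1)[OF t(1)] T_D(1)[OF t(2)] qs by blast+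
    then have pr: "p = r" using adj_unique eq(1) by blast
    have "adj p q'" "adj p s'" using T_D(2)[OF t(1)] T_D(2)[OF t(2)] pr by blast+
    then have "q' = s'" using adj_unique eq(3) by blast
    then show "x = y" using e e' qs pr by simp
  qed
  have S: "finite (S y) \<and> card (S y) \<le> 2" for y
  proof -
    obtain a b b' where y: "y = (a, b, b')" by (metis surj_pair)
    have "finite (rot A A (w a b b'))" by (rule finite_rot[OF finA finA])
    then show ?thesis using card_image_le[of "rot A A (w a b b')" fst] unfolding y S_def by auto
  qed
  have finA3: "finite (A \<times> A \<times> A)" using finA by simp
  have finY: "finite ?Y" using S by (intro finite_SigmaI finA) auto
  have "card ?X \<le> card ?Y" by (rule card_inj_on_le[OF inj sub finY])
  also have "\<dots> = (\<Sum>y\<in>A \<times> A \<times> A. card (S y))" using finA3 S by (intro card_SigmaI) auto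
  also have "\<dots> \<le> (\<Sum>y\<in>A \<times> A \<times> A. 2)" using S by (intro sum_mono) auto
  also have "\<dots> = 2 * card A ^ 3" by (simp add: card_cartesian_product power3_eq_cube)
  finally show ?thesis .
qed

lemma D_le: "real D \<le> energy_const * (real M * real E + real (card A) ^ 3 * (1 + ln (real (card A))))"
proof -
  let ?X1 = "{x \<in> T. triple_col x}"
  let ?X2 = "{x \<in> T. \<not> triple_col x \<and> rich_thr \<le> card (lam (fst x) (triple_centre x))}"
  let ?X3 = "{x \<in> T. \<not> triple_col x \<and> card (lam (fst x) (triple_centre x)) < rich_thr \<and> rich_thr \<le> card (lam (fst (snd x)) (triple_centre x))}"
  let ?X4 = "{x \<in> T. \<not> triple_col x \<and> card (lam (fst (snd x)) (triple_centre x)) < rich_thr \<and> 3 \<le> card (rot A A (triple_rot x))}"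
  let ?X5 = "{x \<in> T. \<not> triple_col x \<and> card (rot A A (triple_rot x)) \<le> 2}"
  have "T \<subseteq> ?X1 \<union> (?X2 \<union> (?X3 \<union> (?X4 \<union> ?X5)))"
  proof
    fix x assume "x \<in> T"
    then show "x \<in> ?X1 \<union> (?X2 \<union> (?X3 \<union> (?X4 \<union> ?X5)))"
      by (cases "card (rot A A (triple_rot x)) \<le> 2"; cases "rich_thr \<le> card (lam (fst x) (triple_centre x))"; cases "rich_thr \<le> card (lam (fst (snd x)) (triple_centre x))") auto
  qed
  then have "D \<le> card (?X1 \<union> (?X2 \<union> (?X3 \<union> (?X4 \<union> ?X5))))"
    unfolding card_T(1)[symmetric] using card_T(2) by (intro card_mono) auto
  also have "\<dots> \<le> card ?X1 + card (?X2 \<union> (?X3 \<union> (?X4 \<union> ?X5)))" by (rule card_Un_le)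
  also have "\<dots> \<le> card ?X1 + (card ?X2 + card (?X3 \<union> (?X4 \<union> ?X5)))" by (intro add_left_mono card_Un_le)
  also have "\<dots> \<le> card ?X1 + (card ?X2 + (card ?X3 + card (?X4 \<union> ?X5)))" by (intro add_left_mono card_Un_le)
  also have "\<dots> \<le> card ?X1 + (card ?X2 + (card ?X3 + (card ?X4 + card ?X5)))" by (intro add_left_mono card_Un_le)
  finally have "real D \<le> real (card ?X1) + (real (card ?X2) + (real (card ?X3) + (real (card ?X4) + real (card ?X5))))"
    unfolding of_nat_add[symmetric] of_nat_le_iff .
  moreover have "real (card ?X1) \<le> real M * real E"
    using card_T_col unfolding of_nat_mult[symmetric] of_nat_le_iff .
  moreover have "real (card ?X5) \<le> 2 * real (card A) ^ 3"
  proof -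
    have "real (card ?X5) \<le> real (2 * card A ^ 3)" using card_T_few unfolding of_nat_le_iff .
    then show ?thesis by simp
  qed
  moreover have add5: "d \<le> a + 2 * b + e + f"
    if "d \<le> x1 + (x2 + (x3 + (x4 + x5)))" "x1 \<le> a" "x5 \<le> f" "x2 \<le> b" "x3 \<le> b" "x4 \<le> e"
    for d a b e f x1 x2 x3 x4 x5 :: real using that by linarith
  ultimately have 1: "real D \<le> real M * real E + 2 * (real D / 4 + real beck_const * real M * real E)
      + real rich_thr * (400000 * real (card A) ^ 3 * (1 + ln (real (card A)))) + 2 * real (card A) ^ 3"
    using card_T_rich1 card_T_rich2 card_T_poor add5 by blast
  define N3 where "N3 = real (card A) ^ 3"
  define l where "l = 1 + ln (real (card A))"
  define ME where "ME = real M * real E"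
  have "card A \<ge> 1" using finA neA by (simp add: Suc_leI card_gt_0_iff)
  then have l: "l \<ge> 1" by (simp add: l_def)
  have N3: "N3 \<ge> 0" "ME \<ge> 0" by (simp_all add: N3_def ME_def)
  have "real D \<le> ME + 2 * (real D / 4 + real beck_const * ME) + real rich_thr * (400000 * N3 * l) + 2 * N3"
    using 1 by (simp add: N3_def l_def ME_def mult.assoc)
  \<comment> \<open>Moving the two quarters of \<open>D\<close> to the left doubles the other
    coefficients.\<close>
  then have 2: "real D \<le> (2 + 4 * real beck_const) * ME + 800000 * real rich_thr * (N3 * l) + 4 * N3"
    by (simp add: algebra_simps)
  have "4 * N3 \<le> 4 * (N3 * l)" using mult_left_mono[OF l N3(1)] by simp
  moreover have "0 \<le> real rich_thr * ME" "0 \<le> real beck_const * (N3 * l)" "0 \<le> N3 * l" using N3 l by simp_all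
  moreover have "energy_const * (ME + N3 * l) = (2 + 4 * real beck_const) * ME + 800000 * real rich_thr * (N3 * l)
      + 4 * (N3 * l) + 2 * ME + 800000 * (real rich_thr * ME) + 4 * (real beck_const * (N3 * l))"
    by (simp add: energy_const_def algebra_simps)
  ultimately have "real D \<le> energy_const * (ME + N3 * l)" using 2 N3 by linarith
  then show ?thesis unfolding N3_def l_def ME_def .
qed

lemma E_sq_le: "real E ^ 2 \<le> real (card A) ^ 2 * real D"
proof -
  have "(\<Sum>p\<in>V. 1 * real (card (nb p)))\<^sup>2 \<le> (\<Sum>p\<in>V. (1::real)\<^sup>2) * (\<Sum>p\<in>V. (real (card (nb p)))\<^sup>2)"
    by (rule Cauchy_Schwarz_ineq_sum)
  then have "real E ^ 2 \<le> real (card V) * real D" by (simp add: E_def D_def)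
  also have "\<dots> \<le> real (card A) ^ 2 * real D"
  proof (rule mult_right_mono)
    have "real (card V) \<le> real ((card A)\<^sup>2)" using finV(2) unfolding of_nat_le_iff .
    then show "real (card V) \<le> real (card A) ^ 2" by simp
  qed simp
  finally show ?thesis .
qed

lemma E_le: "real E \<le> energy_const * real M * real (card A) ^ 2 + sqrt energy_const * sqrt (1 + ln (real (card A))) * real (card A) powr (5 / 2)"
proof -
  define N where "N = real (card A)"
  have "card A \<ge> 1" using finA neA by (simp add: Suc_leI card_gt_0_iff)
  then have N: "N \<ge> 1" by (simp add: N_def)
  have K0: "energy_const \<ge> 0" by (simp add: energy_const_def)
  have l: "1 + ln N \<ge> 0" using N by simp
  have "real E ^ 2 \<le> N ^ 2 * (energy_const * (real M * real E + N ^ 3 * (1 + ln N)))"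
    using E_sq_le mult_left_mono[OF D_le, of "N ^ 2"] unfolding N_def by simp
  also have "\<dots> = (energy_const * real M * N ^ 2) * real E + energy_const * (1 + ln N) * N ^ 5"
    by (simp add: algebra_simps power2_eq_square power3_eq_cube eval_nat_numeral)
  finally have "real E \<le> energy_const * real M * N ^ 2 + sqrt (energy_const * (1 + ln N) * N ^ 5)"
    using K0 l N by (intro quadratic_le) auto
  also have "sqrt (energy_const * (1 + ln N) * N ^ 5) = sqrt energy_const * sqrt (1 + ln N) * N powr (5 / 2)"
  proof -
    have "sqrt (N ^ 5) = N powr (5 / 2)"
    proof (rule real_sqrt_unique)
      have "(N powr (5 / 2))\<^sup>2 = N powr (5 / 2 + 5 / 2)" unfolding power2_eq_square powr_add ..
      also have "5 / 2 + 5 / 2 = (5::real)" by simp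
      also have "N powr 5 = N ^ 5" using N powr_realpow[of N 5] by simp
      finally show "(N powr (5 / 2))\<^sup>2 = N ^ 5" .
    qed simp
    then show ?thesis by (simp add: real_sqrt_mult)
  qed
  finally show ?thesis unfolding N_def .
qed

definition quads :: "(complex \<times> complex \<times> complex \<times> complex) set"
  where "quads = {(a, b, c, d). a \<in> A \<and> b \<in> A \<and> c \<in> A \<and> d \<in> A \<and> poor a b \<and> a \<noteq> b \<and> c \<noteq> d \<and> bis a b = bis c d}"

text \<open>If \<open>a = c\<close>, equality of the bisectors forces \<open>b = d\<close>, which
  leaves at most \<open>(card A)^2\<close> quadruples. The others inject into the edges.\<close>

lemma card_quads_le: "card quads \<le> E + (card A)\<^sup>2"
proof -
  let ?X = "{(a, b, c, d) \<in> quads. a \<noteq> c}" and ?Y = "{(a, b, c, d) \<in> quads. a = c}"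
  have "card ?X \<le> card (Sigma V nb)"
  proof (rule card_inj_on_le[where f = "\<lambda>(a, b, c, d). ((a, c), (b, d))"])
    show "inj_on (\<lambda>(a, b, c, d). ((a, c), (b, d))) ?X" by (auto simp: inj_on_def)
    show "finite (Sigma V nb)" using finV fin_nb by auto
    show "(\<lambda>(a, b, c, d). ((a, c), (b, d))) ` ?X \<subseteq> Sigma V nb"
    proof -
      have "((a, c), (b, d)) \<in> Sigma V nb" if "(a, b, c, d) \<in> quads" "a \<noteq> c" for a b c d
      proof -
        have q: "a \<in> A" "b \<in> A" "c \<in> A" "d \<in> A" "poor a b" "a \<noteq> b" "c \<noteq> d" "bis a b = bis c d"
          using that(1) by (auto simp: quads_def)
        have "b \<noteq> d"
        proof
          assume "b = d"
          then have "bis b a = bis b c" using q(8) bis_commute by metis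
          then have "a = c" using reflection_unique[of b a b a c] q(6,7) \<open>b = d\<close> by metis
          then show False using that(2) by blast
        qed
        then show ?thesis using q that(2) by (simp add: V_def nb_def adj_def)
      qed
      then show ?thesis by fast
    qed
  qed
  also have "card (Sigma V nb) = E" unfolding E_def using finV fin_nb by (intro card_SigmaI) auto
  finally have X: "card ?X \<le> E" .
  have "card ?Y \<le> card (A \<times> A)"
  proof (rule card_inj_on_le[where f = "\<lambda>(a, b, c, d). (a, b)"])
    show "inj_on (\<lambda>(a, b, c, d). (a, b)) ?Y"
    proof -
      have "d = b" if "(a, b, a, d) \<in> quads" for a b d
        using reflection_unique[of a b a b d] that by (auto simp: quads_def)
      then show ?thesis by (clarsimp simp: inj_on_def) metis
    qed
    show "(\<lambda>(a, b, c, d). (a, b)) ` ?Y \<subseteq> A \<times> A" by (auto simp: quads_def)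
  qed (use finA in simp)
  then have Y: "card ?Y \<le> (card A)\<^sup>2" by (simp add: card_cartesian_product power2_eq_square)
  have "quads = ?X \<union> ?Y" by auto
  then have "card quads = card (?X \<union> ?Y)" by (rule arg_cong)
  also have "\<dots> \<le> card ?X + card ?Y" by (rule card_Un_le)
  finally have "card quads \<le> card ?X + card ?Y" .
  with X Y show ?thesis by linarith
qed

end

lemma poor_configuration_bound:
  "\<exists>C>0. \<forall>A M poor. poor_configuration A M poor \<longrightarrow> M \<ge> 1 \<longrightarrow> card A \<ge> 2 \<longrightarrow>
    real (card (poor_configuration.quads A poor))
      \<le> C * (real M * real (card A) ^ 2 + sqrt (ln (real (card A))) * real (card A) powr (5 / 2))"
proof -
  define C where "C = energy_const + 1 + 2 * sqrt energy_const"
  have K0: "energy_const \<ge> 0" by (simp add: energy_const_def)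
  have "real (card (poor_configuration.quads A poor))
      \<le> C * (real M * real (card A) ^ 2 + sqrt (ln (real (card A))) * real (card A) powr (5 / 2))"
    if cfg: "poor_configuration A M poor" and M: "M \<ge> 1" and N2: "card A \<ge> 2" for A M poor
  proof -
    interpret poor_configuration A M poor by (rule cfg)
    define N where "N = real (card A)"
    have N: "N \<ge> 2" using N2 by (simp add: N_def)
    define P where "P = real M * N\<^sup>2"
    define Q where "Q = sqrt (ln N) * N powr (5 / 2)"
    have P0: "P \<ge> 0" by (simp add: P_def)
    have Q0: "Q \<ge> 0" using N by (simp add: Q_def)
    \<comment> \<open>For \<open>N >= 2\<close> the summand 1 is absorbed by the logarithm, since
      \<open>3 * ln 2 >= 1\<close>.\<close>
    have "ln 2 \<le> ln N" using N by simp
    then have "1 + ln N \<le> 4 * ln N" using ln2_ge_two_thirds by linarith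
    then have "sqrt (1 + ln N) \<le> sqrt (4 * ln N)" by (rule real_sqrt_le_mono)
    then have s: "sqrt (1 + ln N) \<le> 2 * sqrt (ln N)" by (simp add: real_sqrt_mult)
    have "sqrt energy_const * sqrt (1 + ln N) * N powr (5 / 2) \<le> sqrt energy_const * (2 * sqrt (ln N)) * N powr (5 / 2)"
      using s K0 by (intro mult_right_mono mult_left_mono) auto
    then have 1: "sqrt energy_const * sqrt (1 + ln N) * N powr (5 / 2) \<le> 2 * sqrt energy_const * Q"
      by (simp add: Q_def mult.assoc mult.left_commute)
    have "1 * N\<^sup>2 \<le> real M * N\<^sup>2" using M by (intro mult_right_mono) auto
    then have 2: "N\<^sup>2 \<le> P" by (simp add: P_def)
    have "real (card quads) \<le> real (E + (card A)\<^sup>2)" using card_quads_le by (simp only: of_nat_le_iff)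
    then have "real (card quads) \<le> real E + N\<^sup>2" by (simp add: N_def)
    moreover have "real E \<le> energy_const * P + sqrt energy_const * sqrt (1 + ln N) * N powr (5 / 2)"
      using E_le by (simp add: N_def P_def mult.assoc)
    ultimately have "real (card quads) \<le> (energy_const + 1) * P + 2 * sqrt energy_const * Q"
      using 1 2 by (simp add: distrib_right)
    also have "\<dots> \<le> C * P + C * Q"
    proof (rule add_mono)
      show "(energy_const + 1) * P \<le> C * P" using P0 K0 by (intro mult_right_mono) (simp_all add: C_def)
      show "2 * sqrt energy_const * Q \<le> C * Q" using Q0 K0 by (intro mult_right_mono) (simp_all add: C_def)
    qed
    finally show ?thesis unfolding P_def Q_def N_def by (simp add: distrib_left)
  qed
  moreover have "C > 0" using K0 by (simp add: C_def add_pos_nonneg add_nonneg_pos)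
  ultimately show ?thesis by blast
qed

section \<open>Transfer to the real plane\<close>

definition toC :: "real^2 \<Rightarrow> complex"
  where "toC x = Complex (x $ 1) (x $ 2)"

definition ofC :: "complex \<Rightarrow> real^2"
  where "ofC z = vector [Re z, Im z]"

lemma toC_ofC [simp]: "toC (ofC z) = z"
  by (simp add: toC_def ofC_def)

lemma ofC_toC [simp]: "ofC (toC x) = x"
  by (simp add: toC_def ofC_def vec_eq_iff forall_2)

lemma inner_ofC: "inner (ofC u) (ofC z) = inner u z"
  by (simp add: ofC_def inner_vec_def sum_2 inner_complex_def)

lemma inner_ofC_left: "inner (ofC u) x = inner u (toC x)"
  using inner_ofC[of u "toC x"] by simp

lemma toC_diff: "toC (x - y) = toC x - toC y"
  by (simp add: toC_def complex_eq_iff)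

lemma norm_toC: "cmod (toC x) = norm x"
proof -
  have "inner (toC x) (toC x) = inner x x" using inner_ofC[of "toC x" "toC x"] by simp
  then show ?thesis unfolding norm_eq_sqrt_inner by simp
qed

lemma inj_toC: "inj toC"
  by (metis injI ofC_toC)

lemma bis_toC: "bis (toC a) (toC b) = toC ` bisector a b"
proof -
  have *: "cmod (toC a - z) = norm (a - ofC z)" for a z
    unfolding norm_toC[symmetric] toC_diff by simp
  show ?thesis
  proof (intro set_eqI iffI)
    fix z assume "z \<in> bis (toC a) (toC b)"
    then have "ofC z \<in> bisector a b" by (simp add: bis_def bisector_def *)
    then show "z \<in> toC ` bisector a b" by (metis image_eqI toC_ofC)
  next
    fix z assume "z \<in> toC ` bisector a b"
    then show "z \<in> bis (toC a) (toC b)" by (auto simp: bis_def bisector_def *)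
  qed
qed

lemma is_line_hyperplane:
  assumes "u \<noteq> 0"
  shows "is_line {x :: real^2. inner u x = e}"
  unfolding is_line_def using affine_hyperplane[of u e] aff_dim_hyperplane[OF assms, of e] by simp

text \<open>Cardinalities are integers, so the real parameter may be replaced by its floor; this is
  how \<open>M\<close> becomes a natural number.\<close>

lemma poor_pairs_card_le:
  assumes "(a, b) \<in> poor_pairs A M" "is_line S \<or> is_circle S" "a \<in> S" "b \<in> S" "M \<ge> 0"
  shows "card (A \<inter> S) \<le> nat \<lfloor>M\<rfloor>"
proof -
  have "\<not> real (card (A \<inter> S)) > M" using assms unfolding poor_pairs_def by blast
  then have "int (card (A \<inter> S)) \<le> \<lfloor>M\<rfloor>" by (simp add: le_floor_iff)
  then show ?thesis by linarith
qed

lemma poor_configuration_toC: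
  assumes fin: "finite A" and ne: "A \<noteq> {}" and M: "M \<ge> 0"
  shows "poor_configuration (toC ` A) (nat \<lfloor>M\<rfloor>) (\<lambda>a b. (ofC a, ofC b) \<in> poor_pairs A M)"
proof
  show "finite (toC ` A)" "toC ` A \<noteq> {}" using fin ne by auto
  show "(ofC b, ofC a) \<in> poor_pairs A M" if "(ofC a, ofC b) \<in> poor_pairs A M" for a b
    using that unfolding poor_pairs_def by auto
next
  fix a b u :: complex
  assume p: "(ofC a, ofC b) \<in> poor_pairs A M" and u: "u \<noteq> 0" and e: "inner u a = inner u b"
  let ?S = "{x :: real^2. inner (ofC u) x = inner u a}"
  have "ofC u \<noteq> 0"
  proof
    assume "ofC u = 0"
    then have "u = toC 0" by (metis toC_ofC)
    then show False using u by (simp add: toC_def complex_eq_iff)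
  qed
  then have "card (A \<inter> ?S) \<le> nat \<lfloor>M\<rfloor>"
    by (intro poor_pairs_card_le[OF p _ _ _ M] disjI1 is_line_hyperplane) (simp_all add: inner_ofC e)
  moreover have "{y \<in> toC ` A. inner u y = inner u a} = toC ` (A \<inter> ?S)" by (auto simp: inner_ofC_left)
  moreover have "card (toC ` (A \<inter> ?S)) = card (A \<inter> ?S)" by (intro card_image inj_on_subset[OF inj_toC]) simp
  ultimately show "card {y \<in> toC ` A. inner u y = inner u a} \<le> nat \<lfloor>M\<rfloor>" by simp
next
  fix a b z :: complex
  assume p: "(ofC a, ofC b) \<in> poor_pairs A M" and z: "z \<noteq> a" and e: "dist z a = dist z b"
  let ?S = "sphere (ofC z) (dist z a)"
  have d: "dist (ofC z) x = dist z (toC x)" for x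
    unfolding dist_norm norm_toC[symmetric] toC_diff by simp
  have "is_circle ?S" unfolding is_circle_def using z by (metis zero_less_dist_iff)
  then have "card (A \<inter> ?S) \<le> nat \<lfloor>M\<rfloor>"
    by (intro poor_pairs_card_le[OF p _ _ _ M] disjI2) (simp_all add: d e)
  moreover have "{y \<in> toC ` A. dist z y = dist z a} = toC ` (A \<inter> ?S)" by (auto simp: d)
  moreover have "card (toC ` (A \<inter> ?S)) = card (A \<inter> ?S)" by (intro card_image inj_on_subset[OF inj_toC]) simp
  ultimately show "card {y \<in> toC ` A. dist z y = dist z a} \<le> nat \<lfloor>M\<rfloor>" by simp
qed

lemma card_bisector_quadruples_le:
  assumes fin: "finite A" and ne: "A \<noteq> {}" and M: "M \<ge> 0"
  shows "card (bisector_quadruples A M)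
    \<le> card (poor_configuration.quads (toC ` A) (\<lambda>a b. (ofC a, ofC b) \<in> poor_pairs A M))"
proof -
  interpret poor_configuration "toC ` A" "nat \<lfloor>M\<rfloor>" "\<lambda>a b. (ofC a, ofC b) \<in> poor_pairs A M"
    by (rule poor_configuration_toC[OF assms])
  let ?f = "\<lambda>(a, b, c, d). (toC a, toC b, toC c, toC d)"
  show ?thesis
  proof (rule card_inj_on_le[where f = ?f])
    show "inj_on ?f (bisector_quadruples A M)" using injD[OF inj_toC] by (auto simp: inj_on_def)
    show "?f ` bisector_quadruples A M \<subseteq> quads"
    proof (rule image_subsetI)
      fix x assume x: "x \<in> bisector_quadruples A M"
      obtain a b c d where e: "x = (a, b, c, d)" by (metis surj_pair)
      have q: "a \<in> A" "b \<in> A" "c \<in> A" "d \<in> A" "(a, b) \<in> poor_pairs A M" "a \<noteq> b" "c \<noteq> d" "bisector a b = bisector c d"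
        using x unfolding e bisector_quadruples_def by auto
      then show "?f x \<in> quads"
        unfolding e quads_def by (simp add: bis_toC) (metis injD inj_toC)
    qed
    have "quads \<subseteq> toC ` A \<times> toC ` A \<times> toC ` A \<times> toC ` A" unfolding quads_def by auto
    then show "finite quads" by (rule finite_subset) (use fin in simp)
  qed
qed

theorem theorem17:
  shows "\<exists>C::real. C > 0 \<and>
    (\<forall>(A::(real^2) set) (N::nat) (M::real).
       finite A \<longrightarrow> card A = N \<longrightarrow> M \<ge> 1 \<longrightarrow>
       real (card (bisector_quadruples A M))
         \<le> C * (M * real N ^ 2 + sqrt (ln (real N)) * real N powr (5/2)))"
proof -
  obtain C where C: "C > 0" and bound: "\<And>A M poor. poor_configuration A M poor \<Longrightarrow> M \<ge> 1 \<Longrightarrow> card A \<ge> 2 \<Longrightarrow>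
    real (card (poor_configuration.quads A poor))
      \<le> C * (real M * real (card A) ^ 2 + sqrt (ln (real (card A))) * real (card A) powr (5 / 2))"
    using poor_configuration_bound by blast
  have "real (card (bisector_quadruples A M)) \<le> C * (M * real N ^ 2 + sqrt (ln (real N)) * real N powr (5/2))"
    if fin: "finite A" and N: "card A = N" and M: "M \<ge> 1" for A :: "(real^2) set" and N M
  proof (cases "N \<ge> 2")
    case True
    then have ne: "A \<noteq> {}" using N by auto
    define m where "m = nat \<lfloor>M\<rfloor>"
    have m: "m \<ge> 1" "real m \<le> M" using M by (simp_all add: m_def le_nat_iff le_floor_iff)
    have cN: "card (toC ` A) = N" using N inj_on_subset[OF inj_toC] by (simp add: card_image)
    let ?Q = "poor_configuration.quads (toC ` A) (\<lambda>a b. (ofC a, ofC b) \<in> poor_pairs A M)"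
    have "real (card (bisector_quadruples A M)) \<le> real (card ?Q)"
      using card_bisector_quadruples_le[OF fin ne] M by simp
    also have "\<dots> \<le> C * (real m * real N ^ 2 + sqrt (ln (real N)) * real N powr (5 / 2))"
      unfolding cN[symmetric]
      by (rule bound) (use poor_configuration_toC[OF fin ne] M m(1) cN True in \<open>simp_all add: m_def\<close>)
    also have "\<dots> \<le> C * (M * real N ^ 2 + sqrt (ln (real N)) * real N powr (5 / 2))"
      using C m(2) by (intro mult_left_mono add_right_mono mult_right_mono) auto
    finally show ?thesis .
  next
    case False
    then have "card A \<le> 1" using N by simp
    then have "a = b" if "a \<in> A" "b \<in> A" for a b
      using that fin by (metis One_nat_def card_le_Suc0_iff_eq)
    then have "bisector_quadruples A M = {}" unfolding bisector_quadruples_def by blast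
    \<comment> \<open>For \<open>N = 0\<close> this rests on the default value of \<open>ln\<close>
      at 0.\<close>
    moreover have "ln (real N) \<ge> 0" using False by (cases "N = 0") (auto simp: not_le less_2_cases_iff)
    ultimately show ?thesis using C M by simp
  qed
  then show ?thesis using C by blast
qed

end
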